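(* Let $a,b>0$, $\alpha\in(0,3)$ and $p>2$. Let $h:\mathbb{Z}^3\to\mathbb{R}$ satisfy: (1) there exists $h_0>0$ with $h(x)\ge h_0$ for all $x\in\mathbb{Z}^3$; (2) $h$ is $\tau$-periodic in $x\in\mathbb{Z}^3$ for some $\tau\in\mathbb{Z}$ (i.e. $h(x+\tau e_j)=h(x)$ for every coordinate direction $e_j$). Then the equation $$-\Big(a+b\int_{\mathbb{Z}^3}|\nabla u|^2\,d\mu\Big)\Delta u+h(x)u=(R_\alpha\ast|u|^p)|u|^{p-2}u,\quad x\in\mathbb{Z}^3,$$ has a ground state solution, i.e. there is $u\in H$ with $J'(u)=0$ and $J(u)=c=\inf_{v\in\mathcal{N}}J(v)$.
   Context: $\mathbb{Z}^3$ is the integer lattice graph: $x\sim y$ iff $\sum_{i=1}^3|x_i-y_i|=1$; $\mu$ is counting measure, so $\int_{\mathbb{Z}^3}f\,d\mu=\sum_{x}f(x)$. For $u:\mathbb{Z}^3\to\mathbb{R}$, $\Delta u(x)=\sum_{y\sim x}(u(y)-u(x))$, $|\nabla u|(x)=\big(\tfrac12\sum_{y\sim x}(u(y)-u(x))^2\big)^{1/2}$, and $\int\nabla u\nabla v\,d\mu=\sum_x\tfrac12\sum_{y\sim x}(u(y)-u(x))(v(y)-v(x))$. $R_\alpha$ is the Green's function of the discrete fractional Laplacian: $R_\alpha(x,y)=\frac{K_\alpha}{(2\pi)^3}\int_{\mathbb{T}^3}e^{i(x-y)\cdot k}\mu(k)^{-\alpha/2}\,dk$, with $K_\alpha=\frac{1}{(2\pi)^3}\int_{\mathbb{T}^3}\mu(k)^{\alpha/2}dk$,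 $\mu(k)=6-2\sum_{j=1}^3\cos k_j$, $\mathbb{T}^3=[0,2\pi]^3$, and $(R_\alpha\ast f)(x)=\sum_y R_\alpha(x,y)f(y)$. $H^1(\mathbb{Z}^3)$ is the completion of finitely supported functions under $\|u\|_{H^1}^2=\sum(|\nabla u|^2+u^2)$; $H=\{u\in H^1(\mathbb{Z}^3):\sum h u^2<\infty\}$ with norm $\|u\|^2=\sum_x(a|\nabla u|^2+h(x)u^2)$. The energy functional is $J(u)=\frac12\|u\|^2+\frac b4\big(\int|\nabla u|^2d\mu\big)^2-\frac1{2p}\int(R_\alpha\ast|u|^p)|u|^p\,d\mu$ on $H$, with $(J'(u),\phi)=\int(a\nabla u\nabla\phi+hu\phi)d\mu+b\int|\nabla u|^2d\mu\int\nabla u\nabla\phi\,d\mu-\int(R_\alpha\ast|u|^p)|u|^{p-2}u\phi\,d\mu$. The Nehari manifold is $\mathcal{N}=\{u\in H\setminus\{0\}:(J'(u),u)=0\}$.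
   Formalization: The period τ is taken to be a positive integer: τ = 0 would make the periodicity condition vacuous and the claim false (e.g. h(x) = 1 + 1/(1+|x|)), and a negative τ is the same as −τ. *)

theory Defs
  imports "HOL-Analysis.Analysis"
begin

definition nbrs :: "int^3 \<Rightarrow> (int^3) set" where
  "nbrs x = {x + axis j 1 | j. True} \<union> {x - axis j 1 | j. True}"

definition lap :: "(int^3 \<Rightarrow> real) \<Rightarrow> int^3 \<Rightarrow> real" where
  "lap u x = (\<Sum>y\<in>nbrs x. u y - u x)"

definition grad_sq :: "(int^3 \<Rightarrow> real) \<Rightarrow> int^3 \<Rightarrow> real" where
  "grad_sq u x = (1/2) * (\<Sum>y\<in>nbrs x. (u y - u x)^2)"

definition grad_norm :: "(int^3 \<Rightarrow> real) \<Rightarrow> int^3 \<Rightarrow> real" where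
  "grad_norm u x = sqrt (grad_sq u x)"

definition grad_inner :: "(int^3 \<Rightarrow> real) \<Rightarrow> (int^3 \<Rightarrow> real) \<Rightarrow> real" where
  "grad_inner u v = (\<Sum>\<^sub>\<infinity>x. (1/2) * (\<Sum>y\<in>nbrs x. (u y - u x) * (v y - v x)))"

definition lap_symbol :: "real^3 \<Rightarrow> real" where
  "lap_symbol k = 6 - 2 * (\<Sum>j\<in>UNIV. cos (k $ j))"

definition torus :: "(real^3) set" where
  "torus = cbox 0 (\<chi> j. 2 * pi)"

definition K_const :: "real \<Rightarrow> real" where
  "K_const \<alpha> = (1 / (2*pi)^3) * integral torus (\<lambda>k. lap_symbol k powr (\<alpha>/2))"

text \<open>Green's function of the discrete fractional Laplacian (it is real-valued; we take the real
  part of the defining complex integral).\<close>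
definition R_alpha :: "real \<Rightarrow> int^3 \<Rightarrow> int^3 \<Rightarrow> real" where
  "R_alpha \<alpha> x y = Re (complex_of_real (K_const \<alpha> / (2*pi)^3) *
     integral torus (\<lambda>k. exp (\<i> * complex_of_real (\<Sum>j\<in>UNIV. real_of_int ((x - y) $ j) * k $ j))
                          * complex_of_real (lap_symbol k powr (- \<alpha>/2))))"

definition conv :: "real \<Rightarrow> (int^3 \<Rightarrow> real) \<Rightarrow> int^3 \<Rightarrow> real" where
  "conv \<alpha> f x = (\<Sum>\<^sub>\<infinity>y. R_alpha \<alpha> x y * f y)"

text \<open>H^1(Z^3): functions of finite H^1 norm (this is the completion of the finitely supported
  functions, realised as functions on Z^3).\<close>
definition H1 :: "(int^3 \<Rightarrow> real) set" where
  "H1 = {u. (\<lambda>x. grad_sq u x + (u x)^2) summable_on UNIV}"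

definition Hsp :: "(int^3 \<Rightarrow> real) \<Rightarrow> (int^3 \<Rightarrow> real) set" where
  "Hsp h = {u \<in> H1. (\<lambda>x. h x * (u x)^2) summable_on UNIV}"

definition Hnorm_sq :: "real \<Rightarrow> (int^3 \<Rightarrow> real) \<Rightarrow> (int^3 \<Rightarrow> real) \<Rightarrow> real" where
  "Hnorm_sq a h u = (\<Sum>\<^sub>\<infinity>x. a * grad_sq u x + h x * (u x)^2)"

definition energy :: "real \<Rightarrow> real \<Rightarrow> real \<Rightarrow> real \<Rightarrow> (int^3 \<Rightarrow> real) \<Rightarrow> (int^3 \<Rightarrow> real) \<Rightarrow> real" where
  "energy a b \<alpha> p h u =
     (1/2) * Hnorm_sq a h u + (b/4) * (\<Sum>\<^sub>\<infinity>x. grad_sq u x)^2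
     - (1/(2*p)) * (\<Sum>\<^sub>\<infinity>x. conv \<alpha> (\<lambda>y. \<bar>u y\<bar> powr p) x * \<bar>u x\<bar> powr p)"

definition energy_deriv :: "real \<Rightarrow> real \<Rightarrow> real \<Rightarrow> real \<Rightarrow> (int^3 \<Rightarrow> real) \<Rightarrow> (int^3 \<Rightarrow> real) \<Rightarrow> (int^3 \<Rightarrow> real) \<Rightarrow> real" where
  "energy_deriv a b \<alpha> p h u \<phi> =
     a * grad_inner u \<phi> + (\<Sum>\<^sub>\<infinity>x. h x * u x * \<phi> x)
     + b * (\<Sum>\<^sub>\<infinity>x. grad_sq u x) * grad_inner u \<phi>
     - (\<Sum>\<^sub>\<infinity>x. conv \<alpha> (\<lambda>y. \<bar>u y\<bar> powr p) x * \<bar>u x\<bar> powr (p - 2) * u x * \<phi> x)"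

definition nehari :: "real \<Rightarrow> real \<Rightarrow> real \<Rightarrow> real \<Rightarrow> (int^3 \<Rightarrow> real) \<Rightarrow> (int^3 \<Rightarrow> real) set" where
  "nehari a b \<alpha> p h = {u \<in> Hsp h. u \<noteq> (\<lambda>_. 0) \<and> energy_deriv a b \<alpha> p h u u = 0}"

end

theory Submission
  imports Defs
begin

text \<open>
  Since \<open>p > 2\<close>, the density \<open>|u|\<^sup>p\<close> of any \<open>u \<in> H \<subseteq> \<ell>\<^sup>2\<close> lies in \<open>\<ell>\<^sup>1\<close>, so no Hardy--Littlewood--Sobolev
  inequality is needed: it suffices that the Green's function is an even bounded kernel with positive
  diagonal that vanishes at infinity. Write \<open>J = A/2 + B/4 - D/(2p)\<close> with \<open>A\<close> the squared norm,
  \<open>B\<close> the Kirchhoff term and \<open>D\<close> the Choquard term. On the Nehari manifold \<open>A + B = D\<close> and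
  \<open>J = \<kappa>\<^sub>1 A + \<kappa>\<^sub>2 B\<close> with positive coefficients. A minimizing sequence is bounded and its sup norm stays
  away from 0, so after periodic translations it converges pointwise to some \<open>u \<noteq> 0\<close>. By Brezis--Lieb
  splitting, either \<open>A + B - D \<le> 0\<close> at \<open>u\<close>, and projecting \<open>u\<close> to the Nehari manifold shows that \<open>u\<close> itself
  is a minimizer, or the remainders \<open>v\<^sub>n - u\<close> eventually satisfy this inequality and their projections
  have energy at most \<open>c - \<kappa>\<^sub>1 A(u) < c\<close>, which is absurd. A minimizer is critical because its energy
  cannot decrease to first order under projected perturbations by point masses, and \<open>J'(u)\<close> is given by
  summation against a function on the lattice, hence is determined by its values on point masses.
\<close>

section \<open>Fourier coefficients on the torus\<close>

text \<open>The Kirchhoff term resists the usual splitting. If v = u + q with q tending weakly to 0,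
  the square of the Dirichlet sum keeps the cross term 2 \<open>G u u * G q q\<close>, which need
  not vanish in the limit. It is nonnegative, however, so up to o(1) the Kirchhoff term of the whole
  dominates the sum over its parts. This one direction suffices twice: it gives I(u) + I(q) \<le>
  I(v) + o(1) for the Nehari functional, hence the dichotomy, and it makes the reduced energy
  superadditive, hence the comparison with the infimum. In this way neither a Palais-Smale property
  of the minimizing sequence nor an equation for its weak limit enters. Criticality is tested on
  point masses because adding a multiple of one changes |u|^p at a single site. Along such a line
  the Choquard term is a quadratic polynomial in one real function, so that no derivative has to be
  taken under an infinite sum.\<close>

lemma Basis_vec_eq_range_axis: "(Basis :: (real^'n) set) = range (\<lambda>j. axis j 1)"
  by (auto simp: Basis_vec_def)

lemma prod_Basis_vec:
  fixes g :: "real^'n \<Rightarrow> 'c::comm_monoid_mult"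
  shows "(\<Prod>b\<in>Basis. g b) = (\<Prod>j\<in>UNIV. g (axis j 1))"
  unfolding Basis_vec_eq_range_axis
  by (subst prod.reindex) (auto simp: inj_on_def axis_eq_axis)

text \<open>Lebesgue measure is the image of a product of one-dimensional Lebesgue measures under
  the coordinate map, so both claims are Fubini. The value serves the Fourier modes, the
  integrability also the majorant of the singular weight.\<close>

lemma
  fixes f :: "'a::euclidean_space \<Rightarrow> real \<Rightarrow> 'b::{real_normed_field,banach,second_countable_topology}"
  assumes int: "\<And>b. b \<in> Basis \<Longrightarrow> integrable lborel (f b)"
  shows integrable_lborel_prod_Basis: "integrable lborel (\<lambda>x. \<Prod>b\<in>Basis. f b (x \<bullet> b))"
    and integral_lborel_prod_Basis:
      "(\<integral>x. (\<Prod>b\<in>Basis. f b (x \<bullet> b)) \<partial>lborel) = (\<Prod>b\<in>Basis. \<integral>x. f b x \<partial>lborel)"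
proof -
  interpret product_sigma_finite "\<lambda>b::'a. lborel :: real measure" ..
  have [measurable]: "f b \<in> borel_measurable borel" if "b \<in> Basis" for b
    using int[OF that] by (simp add: integrable_iff_bounded)
  let ?D = "distr (\<Pi>\<^sub>M b\<in>(Basis :: 'a set). lborel) borel (\<lambda>f. \<Sum>b\<in>Basis. f b *\<^sub>R b)"
  have D: "lborel = ?D" by (rule lborel_eq)
  have meas: "(\<lambda>f. \<Sum>b\<in>Basis. f b *\<^sub>R b) \<in> (\<Pi>\<^sub>M b\<in>(Basis :: 'a set). lborel) \<rightarrow>\<^sub>M borel"
    by measurable
  have eq: "(\<Prod>b\<in>Basis. f b ((\<Sum>b\<in>Basis. y b *\<^sub>R b) \<bullet> b)) = (\<Prod>b\<in>Basis. f b (y b))" for y :: "'a \<Rightarrow> real"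
    by (intro prod.cong refl) simp
  have fm: "(\<lambda>x. \<Prod>b\<in>Basis. f b (x \<bullet> b)) \<in> borel_measurable borel"
    by measurable
  show "integrable lborel (\<lambda>x. \<Prod>b\<in>Basis. f b (x \<bullet> b))"
    by (subst D, subst integrable_distr_eq[OF meas fm], subst eq, rule product_integrable_prod)
       (use int in auto)
  show "(\<integral>x. (\<Prod>b\<in>Basis. f b (x \<bullet> b)) \<partial>lborel) = (\<Prod>b\<in>Basis. \<integral>x. f b x \<partial>lborel)"
    by (subst D, subst integral_distr[OF meas fm], subst eq, rule product_integral_prod)
       (use int in auto)
qed

lemma integral_exp_int_period:
  assumes "n \<noteq> (0::int)"
  shows "integral {0..2*pi} (\<lambda>t. exp (\<i> * (of_int n * complex_of_real t))) = 0"
proof -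
  let ?F = "\<lambda>t::real. exp (\<i> * (of_int n * complex_of_real t)) / (\<i> * of_int n)"
  have "((\<lambda>t. exp (\<i> * (of_int n * complex_of_real t))) has_integral (?F (2*pi) - ?F 0)) {0..2*pi}"
  proof (intro fundamental_theorem_of_calculus)
    fix x assume "x \<in> {0..2*pi}"
    have "((\<lambda>t. exp (\<i> * (of_int n * t)) / (\<i> * of_int n)) has_field_derivative
            exp (\<i> * (of_int n * complex_of_real x))) (at (complex_of_real x))"
      using assms by (auto intro!: derivative_eq_intros simp: field_simps)
    then have "(?F has_vector_derivative exp (\<i> * (of_int n * complex_of_real x))) (at x)"
      by (rule has_vector_derivative_real_field)
    then show "(?F has_vector_derivative exp (\<i> * (of_int n * complex_of_real x))) (at x within {0..2*pi})"
      by (rule has_vector_derivative_at_within)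
  qed simp
  moreover have "exp (\<i> * (of_int n * complex_of_real (2*pi))) = 1"
    using exp_integer_2pi[of "of_int n"] by (simp add: mult_ac)
  ultimately show ?thesis
    by (auto dest!: integral_unique)
qed

lemma indicator_torus:
  "indicator torus k = (\<Prod>j\<in>UNIV. indicator {0..2*pi} (k $ j) :: 'a::{comm_semiring_1,semiring_no_zero_divisors})"
proof (cases "k \<in> torus")
  case True
  then show ?thesis by (auto simp: torus_def mem_box_cart)
next
  case False
  then obtain j where "k $ j \<notin> {0..2*pi}" by (auto simp: torus_def mem_box_cart)
  then have "(\<Prod>j\<in>UNIV. indicator {0..2*pi} (k $ j) :: 'a) = 0"
    by (intro prod_zero bexI[of _ j]) (auto simp: indicator_def)
  with False show ?thesis by simp
qed

definition phase :: "int^3 \<Rightarrow> real^3 \<Rightarrow> real" where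
  "phase z k = (\<Sum>j\<in>UNIV. of_int (z $ j) * k $ j)"

lemma continuous_on_phase [continuous_intros]: "continuous_on A (phase z)"
  unfolding phase_def by (intro continuous_intros)

text \<open>The complex exponential factors over the coordinates, and a coordinate in which
  \<open>z\<close> is nonzero contributes the factor 0. The cosine is its real part.\<close>

lemma integral_torus_cos_phase:
  assumes "z \<noteq> 0"
  shows "integral torus (\<lambda>k. cos (phase z k)) = 0"
proof -
  let ?e = "\<lambda>k. exp (\<i> * complex_of_real (phase z k))"
  define c where "c b = complex_of_real ((\<chi> j. of_int (z $ j)) \<bullet> b)" for b :: "real^3"
  let ?f = "\<lambda>b t. indicator {0..2*pi} t * exp (\<i> * (c b * complex_of_real t))"
  have int: "set_integrable lborel {0..2*pi} (\<lambda>t. exp (\<i> * (c b * complex_of_real t)))" for b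
    by (rule borel_integrable_atLeastAtMost') (intro continuous_intros)
  have ind: "indicator A x *\<^sub>R y = indicator A x * y" for A and x :: 'z and y :: complex
    by (auto simp: indicator_def)
  have int': "integrable lborel (?f b)" for b
    using int[of b] by (simp add: set_integrable_def ind)
  have prod: "indicator torus k * ?e k = (\<Prod>b\<in>Basis. ?f b (k \<bullet> b))" for k
    by (simp add: prod_Basis_vec c_def phase_def inner_axis prod.distrib indicator_torus exp_sum[symmetric] sum_distrib_left)
  obtain i where i: "z $ i \<noteq> 0" using assms by (auto simp: vec_eq_iff)
  have "(\<integral>t. ?f (axis i 1) t \<partial>lborel) = integral {0..2*pi} (\<lambda>t. exp (\<i> * (c (axis i 1) * complex_of_real t)))"
    using set_borel_integral_eq_integral(2)[OF int] by (simp add: set_lebesgue_integral_def ind)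
  also have "\<dots> = 0" using integral_exp_int_period[OF i] by (simp add: c_def inner_axis)
  finally have "(\<Prod>b\<in>Basis. \<integral>x. ?f b x \<partial>lborel) = 0"
    by (intro prod_zero) auto
  with integral_lborel_prod_Basis[of ?f, OF int'] have *: "(\<integral>k. indicator torus k * ?e k \<partial>lborel) = 0"
    by (simp add: prod)
  have s: "set_integrable lborel torus ?e"
    using integrable_lborel_prod_Basis[of ?f, OF int'] by (simp add: set_integrable_def ind prod)
  have "integral torus ?e = 0"
    using set_borel_integral_eq_integral(2)[OF s] * by (simp add: set_lebesgue_integral_def ind)
  moreover have "integral torus (Re \<circ> ?e) = Re (integral torus ?e)"
    by (rule integral_linear[OF set_borel_integral_eq_integral(1)[OF s] bounded_linear_Re])
  ultimately show ?thesis by (simp add: o_def cis_conv_exp[symmetric])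
qed

text \<open>The real part taken in \<open>R_alpha\<close> is, up to the constant in front, this
  coefficient of the weight; cosines keep the computation real.\<close>

definition cos_coeff :: "(real^3 \<Rightarrow> real) \<Rightarrow> int^3 \<Rightarrow> real" where
  "cos_coeff f z = integral torus (\<lambda>k. cos (phase z k) * f k)"

lemma phase_add: "phase (y + z) k = phase y k + phase z k"
  and phase_diff: "phase (y - z) k = phase y k - phase z k"
  and phase_minus: "phase (- z) k = - phase z k"
  and phase_axis: "phase (axis j 1) k = k $ j"
  by (auto simp: phase_def algebra_simps sum.distrib sum_subtractf sum_negf axis_def if_distrib if_distribR cong: if_cong)

text \<open>On a discrete group the filter \<open>cofinite\<close> expresses escape to infinity. It
  is translation invariant because preimages of finite sets under translations are finite.\<close>

lemma filterlim_add_cofinite: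
  fixes c :: "'a::group_add"
  shows "filterlim (\<lambda>z. z + c) cofinite cofinite"
  unfolding filterlim_def le_filter_def eventually_filtermap eventually_cofinite
proof safe
  fix P assume "finite {x::'a. \<not> P x}"
  then have "finite ((\<lambda>z. z + c) -` {x. \<not> P x})"
    by (rule finite_vimageI) simp
  then show "finite {x. \<not> P (x + c)}" by (simp add: vimage_def)
qed

lemma filterlim_diff_cofinite:
  fixes c :: "'a::group_add"
  shows "filterlim (\<lambda>z. z - c) cofinite cofinite"
  using filterlim_add_cofinite[of "-c"] by simp

text \<open>The symbol of the Laplacian is \<open>12 (1 - q)\<close>, where \<open>q\<close> is the symbol of the lazy random walk. Laziness
  makes \<open>q\<close> nonnegative, so that the binomial series of \<open>(1 - q) powr (-\<alpha>/2)\<close> converges monotonically;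
  this reduces the Riemann--Lebesgue lemma for the singular weight to powers of \<open>q\<close>.\<close>

definition lazy_symbol :: "real^3 \<Rightarrow> real" where
  "lazy_symbol k = 1/2 + (1/6) * (\<Sum>j\<in>UNIV. cos (k $ j))"

lemma integrable_torus_continuous:
  fixes f :: "real^3 \<Rightarrow> real"
  assumes "continuous_on UNIV f"
  shows "f integrable_on torus"
  unfolding torus_def by (rule integrable_continuous) (use assms continuous_on_subset in blast)

lemma continuous_on_lazy_symbol [continuous_intros]: "continuous_on A lazy_symbol"
  unfolding lazy_symbol_def by (intro continuous_intros)

text \<open>By the product formula for cosines, multiplication by cos k_j averages the two
  translates by \<open>axis j 1\<close>. On coefficients, \<open>lazy_symbol\<close> therefore acts
  as one step of the lazy random walk.\<close>

lemma cos_coeff_lazy_mult: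
  assumes f: "continuous_on UNIV f"
  shows "cos_coeff (\<lambda>k. lazy_symbol k * f k) z
       = 1/2 * cos_coeff f z + (1/12) * (\<Sum>j\<in>UNIV. cos_coeff f (z + axis j 1) + cos_coeff f (z - axis j 1))"
proof -
  have I: "(\<lambda>k. cos (phase y k) * f k) integrable_on torus" for y
    by (intro integrable_torus_continuous continuous_intros f)
  have "cos (phase z k) * (lazy_symbol k * f k) = 1/2 * (cos (phase z k) * f k)
     + (1/12) * (\<Sum>j\<in>UNIV. cos (phase (z + axis j 1) k) * f k + cos (phase (z - axis j 1) k) * f k)" for k
    by (simp add: lazy_symbol_def phase_add phase_diff phase_axis cos_add cos_diff algebra_simps
        sum_distrib_left sum.distrib)
  then show ?thesis
    unfolding cos_coeff_def
    by (simp only:, subst integral_add)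
       (auto intro!: integrable_add integrable_sum I simp: integral_sum integral_add I integrable_add)
qed

text \<open>The constant function has only the mode 0, and each step of the walk averages finitely
  many translates, which preserves the limit 0 along \<open>cofinite\<close>.\<close>

lemma cos_coeff_lazy_power: "(cos_coeff (\<lambda>k. lazy_symbol k ^ n) \<longlongrightarrow> 0) cofinite"
proof (induction n)
  case 0
  have "eventually (\<lambda>z::int^3. z \<noteq> 0) cofinite"
    by (simp add: eventually_cofinite)
  then have "eventually (\<lambda>z. cos_coeff (\<lambda>k. lazy_symbol k ^ 0) z = 0) cofinite"
    by eventually_elim (simp add: cos_coeff_def integral_torus_cos_phase)
  then show ?case by (rule tendsto_eventually)
next
  case (Suc n)
  let ?F = "cos_coeff (\<lambda>k. lazy_symbol k ^ n)"
  have "((\<lambda>z. 1/2 * ?F z + (1/12) * (\<Sum>j\<in>UNIV. ?F (z + axis j 1) + ?F (z - axis j 1)))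
        \<longlongrightarrow> 1/2 * 0 + (1/12) * (\<Sum>j\<in>(UNIV::3 set). 0 + 0)) cofinite"
    by (intro tendsto_intros Suc filterlim_compose[OF Suc] filterlim_add_cofinite filterlim_diff_cofinite)
  moreover have "cos_coeff (\<lambda>k. lazy_symbol k ^ Suc n)
      = (\<lambda>z. 1/2 * ?F z + (1/12) * (\<Sum>j\<in>UNIV. ?F (z + axis j 1) + ?F (z - axis j 1)))"
    by (intro ext) (simp only: power_Suc, intro cos_coeff_lazy_mult continuous_intros)
  ultimately show ?case by simp
qed

section \<open>The Green's function\<close>

text \<open>Jordan's inequality: the concave sine lies above its chord.\<close>

lemma sin_ge_linear:
  assumes "0 \<le> x" "x \<le> pi/2"
  shows "sin x \<ge> 2 / pi * x"
proof -
  have "concave_on {0..pi/2} sin"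
    by (rule f''_le0_imp_concave[where f' = cos and f'' = "\<lambda>x. - sin x"])
       (auto intro!: derivative_eq_intros sin_ge_zero)
  from concave_onD[OF this, of "2 / pi * x" 0 "pi/2"] assms
  show ?thesis by (simp add: field_simps)
qed

text \<open>The sine of t/2 vanishes linearly at both ends of the period, so the singularities
  compare with those of \<open>t powr (-s)\<close> and \<open>(2*pi - t) powr (-s)\<close>, which
  are integrable for s < 1.\<close>

lemma integrable_two_sin_powr:
  assumes "0 \<le> s" "s < 1"
  shows "integrable lborel (\<lambda>t. indicator {0<..<2*pi} t * (2 * sin (t/2)) powr (-s))"
proof -
  define B where "B = (\<lambda>t::real. (2/pi) powr (-s) * (t powr (-s) + (2*pi - t) powr (-s)))"
  have I1: "(\<lambda>t. t powr (-s)) integrable_on cbox 0 (2*pi)"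
    using integrable_on_powr_from_0[of "-s" "2*pi"] assms by simp
  have I2: "(\<lambda>t. (2*pi - t) powr (-s)) integrable_on {0..2*pi}"
    using integrable_affinity[OF I1, of "-1" "2*pi"] by simp
  have "B integrable_on {0..2*pi}"
    unfolding B_def using I1 I2 integrable_on_cmult_left[OF integrable_add[of "\<lambda>t. t powr (-s)" "{0..2*pi}" "\<lambda>t. (2*pi - t) powr (-s)"], of "(2/pi) powr (-s)"] by simp
  then have "B absolutely_integrable_on {0..2*pi}"
    by (intro nonnegative_absolutely_integrable_1) (auto simp: B_def)
  then have int: "integrable lborel (\<lambda>t. indicator {0..2*pi} t * B t)"
    unfolding set_integrable_def
    by (subst (asm) integrable_completion) (auto simp: B_def)
  show ?thesis
  proof (rule Bochner_Integration.integrable_bound[OF int])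
    show "(\<lambda>t. indicator {0<..<2*pi} t * (2 * sin (t/2)) powr (-s)) \<in> borel_measurable lborel"
      by measurable
    have "(2 * sin (t/2)) powr (-s) \<le> B t" if t: "0 < t" "t < 2*pi" for t
    proof (cases "t \<le> pi")
      case True
      with sin_ge_linear[of "t/2"] t have "2/pi * t \<le> 2 * sin (t/2)" by simp
      then have "(2 * sin (t/2)) powr (-s) \<le> (2/pi * t) powr (-s)"
        using t assms by (intro powr_mono2') auto
      also have "\<dots> = (2/pi) powr (-s) * t powr (-s)"
        using t by (subst powr_mult) auto
      also have "\<dots> \<le> B t" by (simp add: B_def algebra_simps)
      finally show ?thesis .
    next
      case False
      \<comment> \<open>In the right half of the period the reflection of t/2 at pi/2 reduces the
        estimate to the left half.\<close>
      with sin_ge_linear[of "pi - t/2"] t have "2/pi * (pi - t/2) \<le> sin (t/2)"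
        unfolding sin_pi_minus by simp
      then have "2/pi * (2*pi - t) \<le> 2 * sin (t/2)" by (simp add: field_simps)
      then have "(2 * sin (t/2)) powr (-s) \<le> (2/pi * (2*pi - t)) powr (-s)"
        using t assms by (intro powr_mono2') auto
      also have "\<dots> = (2/pi) powr (-s) * (2*pi - t) powr (-s)"
        using t by (subst powr_mult) auto
      also have "\<dots> \<le> B t" by (simp add: B_def algebra_simps)
      finally show ?thesis .
    qed
    then show "AE t in lborel. norm (indicator {0<..<2*pi} t * (2 * sin (t/2)) powr (-s))
        \<le> norm (indicator {0..2*pi} t * B t)"
      by (intro AE_I2) (auto simp: indicator_def intro!: order_trans[OF _ abs_ge_self])
  qed
qed

text \<open>The symbol vanishes at the corners of \<open>torus\<close>, so pointwise statements
  about negative powers are made on the open box; its boundary is a null set and integrals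
  agree.\<close>

abbreviation "open_torus \<equiv> box 0 (\<chi> j. 2 * pi) :: (real^3) set"

lemma mem_open_torus: "k \<in> open_torus \<longleftrightarrow> (\<forall>j. 0 < k $ j \<and> k $ j < 2*pi)"
  by (auto simp: mem_box_cart)

text \<open>As a sum of squares the symbol is visibly nonnegative, has its zeros in plain sight, and
  is bounded below by each coordinate separately.\<close>

lemma lap_symbol_half_angle: "lap_symbol k = (\<Sum>j\<in>UNIV. (2 * sin (k $ j / 2))^2)"
proof -
  have "(2 * sin (x/2))^2 = 2 - 2 * cos x" for x :: real
    using cos_double_sin[of "x/2"] by (simp add: power_mult_distrib)
  then show ?thesis by (simp add: lap_symbol_def sum_subtractf sum_distrib_left)
qed

lemma lap_symbol_nonneg: "0 \<le> lap_symbol k"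
  unfolding lap_symbol_half_angle by (intro sum_nonneg) auto

lemma lap_symbol_le: "lap_symbol k \<le> 12"
proof -
  have "(\<Sum>j\<in>(UNIV::3 set). - 1) \<le> (\<Sum>j\<in>UNIV. cos (k $ j))" by (intro sum_mono) auto
  then show ?thesis by (simp add: lap_symbol_def)
qed

lemma lap_symbol_pos:
  assumes "k \<in> open_torus"
  shows "0 < lap_symbol k"
  unfolding lap_symbol_half_angle
proof (rule sum_pos)
  fix j :: 3
  have "0 < k $ j \<and> k $ j < 2*pi" using assms by (simp only: mem_open_torus)
  then have "0 < sin (k $ j / 2)" by (intro sin_gt_zero) auto
  then show "0 < (2 * sin (k $ j / 2))\<^sup>2" by simp
qed auto

lemma continuous_on_lap_symbol [continuous_intros]: "continuous_on A lap_symbol"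
  unfolding lap_symbol_def by (intro continuous_intros)

lemma lap_symbol_lazy: "lap_symbol k = 12 * (1 - lazy_symbol k)"
  by (simp add: lap_symbol_def lazy_symbol_def)

text \<open>Each half-angle square is at most the symbol, so the symbol to a negative power is dominated by a
  product of one-dimensional factors; this is integrable precisely because \<open>\<alpha> / 3 < 1\<close>.\<close>

lemma lap_symbol_powr_integrable:
  assumes "0 < \<alpha>" "\<alpha> < 3"
  shows "(\<lambda>k. lap_symbol k powr (- \<alpha>/2)) absolutely_integrable_on torus"
proof -
  let ?w = "\<lambda>k. lap_symbol k powr (- \<alpha>/2)"
  let ?f = "\<lambda>b t. indicator {0<..<2*pi} t * (2 * sin (t/2)) powr (-(\<alpha>/3))"
  have int: "integrable lborel (\<lambda>x::real^3. \<Prod>b\<in>Basis. ?f b (x \<bullet> b))"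
    using assms by (intro integrable_lborel_prod_Basis integrable_two_sin_powr) auto
  have "integrable lborel (\<lambda>k. indicator open_torus k * ?w k)"
  proof (rule Bochner_Integration.integrable_bound[OF int])
    have [measurable]: "lap_symbol \<in> borel_measurable borel"
      by (intro borel_measurable_continuous_onI continuous_intros)
    show "(\<lambda>k. indicator open_torus k * ?w k) \<in> borel_measurable lborel"
      by measurable
    show "AE k in lborel. norm (indicator open_torus k * ?w k) \<le> norm (\<Prod>b\<in>Basis. ?f b (k \<bullet> b))"
    proof (intro AE_I2)
      fix k :: "real^3"
      show "norm (indicator open_torus k * ?w k) \<le> norm (\<Prod>b\<in>Basis. ?f b (k \<bullet> b))"
      proof (cases "k \<in> open_torus")
        case True
        then have kj: "0 < k $ j" "k $ j < 2*pi" for j by (auto simp: mem_open_torus)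
        have pos: "0 < 2 * sin (k $ j / 2)" for j
          using kj[of j] by (simp add: sin_gt_zero)
        \<comment> \<open>The power is shared equally among the three coordinates, and each third is
          then estimated by its own half-angle square.\<close>
        have "?w k = (\<Prod>j\<in>(UNIV::3 set). lap_symbol k powr (- \<alpha>/6))"
          using lap_symbol_pos[OF True] by (simp add: powr_realpow[symmetric] powr_powr)
        also have "\<dots> \<le> (\<Prod>j\<in>(UNIV::3 set). (2 * sin (k $ j / 2)) powr (-(\<alpha>/3)))"
        proof (intro prod_mono conjI)
          fix j :: 3
          have "(2 * sin (k $ j / 2))^2 \<le> lap_symbol k"
            unfolding lap_symbol_half_angle by (rule member_le_sum) auto
          then have "lap_symbol k powr (- \<alpha>/6) \<le> ((2 * sin (k $ j / 2))^2) powr (- \<alpha>/6)"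
            using pos[of j] assms by (intro powr_mono2') auto
          also have "\<dots> = (2 * sin (k $ j / 2)) powr (-(\<alpha>/3))"
            using powr_powr[of "2 * sin (k $ j / 2)" 2 "-\<alpha>/6"] pos[of j] by (simp add: powr_numeral)
          finally show "lap_symbol k powr (- \<alpha>/6) \<le> (2 * sin (k $ j / 2)) powr (-(\<alpha>/3))" .
        qed simp
        also have "\<dots> = (\<Prod>b\<in>Basis. ?f b (k \<bullet> b))"
          using kj by (simp add: prod_Basis_vec inner_axis)
        finally show ?thesis using True by simp
      qed simp
    qed
  qed
  then have "set_integrable lborel open_torus ?w"
    by (simp add: set_integrable_def)
  then have "?w integrable_on open_torus"
    by (rule set_borel_integral_eq_integral)
  then have "?w integrable_on torus"
    unfolding torus_def integrable_on_open_interval .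
  then show ?thesis by (rule nonnegative_absolutely_integrable_1) simp
qed

section \<open>Binomial expansion of the singular weight\<close>

lemma lazy_symbol_bounds:
  assumes "k \<in> open_torus"
  shows "0 \<le> lazy_symbol k" "lazy_symbol k < 1"
  using lap_symbol_pos[OF assms] lap_symbol_le[of k] by (auto simp: lap_symbol_lazy)

text \<open>Truncated binomial series of \<open>(12 * (1 - q)) powr (-\<beta>)\<close> with q the
  lazy symbol. For \<beta> > 0 the coefficients \<open>pochhammer \<beta> n / fact n\<close> are
  nonnegative, so the truncations increase with \<open>N\<close> wherever q is nonnegative.\<close>

definition lazy_partial :: "real \<Rightarrow> nat \<Rightarrow> real^3 \<Rightarrow> real" where
  "lazy_partial \<beta> N k = (\<Sum>n<N. 12 powr (-\<beta>) * (pochhammer \<beta> n / fact n) * lazy_symbol k ^ n)"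

lemma lazy_partial_sums:
  assumes k: "k \<in> open_torus"
  shows "(\<lambda>n. 12 powr (-\<beta>) * (pochhammer \<beta> n / fact n) * lazy_symbol k ^ n) sums (lap_symbol k powr (-\<beta>))"
proof -
  note q = lazy_symbol_bounds[OF k]
  have "(\<lambda>n. ((-\<beta>) gchoose n) * (- lazy_symbol k)^n) sums (1 + - lazy_symbol k) powr (-\<beta>)"
    using q by (intro gen_binomial_real) auto
  \<comment> \<open>The alternating sign of the generalized binomial coefficient at a negative
    argument cancels the sign of \<open>(- lazy_symbol k)^n\<close>.\<close>
  moreover have "((-\<beta>) gchoose n) * (- lazy_symbol k)^n = pochhammer \<beta> n / fact n * lazy_symbol k ^ n" for n
  proof -
    have "(-1)^n * ((-1)^n * y) = y" for y :: real
      by (cases "even n") auto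
    then show ?thesis
      unfolding gbinomial_pochhammer power_minus[of "lazy_symbol k"] by (simp add: mult_ac)
  qed
  ultimately have "(\<lambda>n. 12 powr (-\<beta>) * (pochhammer \<beta> n / fact n * lazy_symbol k ^ n)) sums
      (12 powr (-\<beta>) * (1 - lazy_symbol k) powr (-\<beta>))"
    by (intro sums_mult) simp
  moreover have "12 powr (-\<beta>) * (1 - lazy_symbol k) powr (-\<beta>) = lap_symbol k powr (-\<beta>)"
    unfolding lap_symbol_lazy by (subst powr_mult) (use q in auto)
  ultimately show ?thesis by (simp add: mult.assoc)
qed

lemma continuous_on_lazy_partial: "continuous_on A (lazy_partial \<beta> N)"
  unfolding lazy_partial_def by (intro continuous_intros)

lemma integral_torus_open: "integral torus f = integral open_torus (f :: real^3 \<Rightarrow> real)"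
  by (simp add: torus_def integral_open_interval)

lemma integrable_torus_open: "f integrable_on torus \<longleftrightarrow> (f :: real^3 \<Rightarrow> real) integrable_on open_torus"
  by (simp add: torus_def integrable_on_open_interval)

lemma integrable_cos_phase:
  assumes "f absolutely_integrable_on torus"
  shows "(\<lambda>k. cos (phase z k) * f k) integrable_on torus"
proof -
  have "(\<lambda>k. cos (phase z k) * f k) absolutely_integrable_on torus"
  proof (rule absolutely_integrable_bounded_measurable_product[OF bilinear_times _ _ _ assms])
    show "torus \<in> sets lebesgue" by (simp add: torus_def)
    then show "(\<lambda>k. cos (phase z k)) \<in> borel_measurable (lebesgue_on torus)"
      by (intro continuous_imp_measurable_on_sets_lebesgue continuous_intros)
    show "bounded ((\<lambda>k. cos (phase z k)) ` torus)"
      by (rule boundedI[of _ 1]) auto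
  qed
  then show ?thesis by (simp add: absolutely_integrable_on_def)
qed

text \<open>A Riemann-Lebesgue lemma. As 0 \<le> \<open>S N\<close> \<le> \<open>w\<close> and
  cosines are at most 1, the coefficients of \<open>w\<close> and \<open>S N\<close> differ by at
  most the integral of \<open>w - S N\<close>, uniformly in z. Dominated convergence makes this
  small, and for fixed \<open>N\<close> the coefficients of \<open>S N\<close> are a finite
  combination of decaying ones.\<close>

lemma cos_coeff_lap_symbol_powr:
  assumes "0 < \<alpha>" "\<alpha> < 3"
  shows "(cos_coeff (\<lambda>k. lap_symbol k powr (- \<alpha>/2)) \<longlongrightarrow> 0) cofinite"
proof (rule tendstoI)
  fix e :: real assume e: "e > 0"
  define w where "w = (\<lambda>k. lap_symbol k powr (- \<alpha>/2))"
  define S where "S = lazy_partial (\<alpha>/2)"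
  have w: "w absolutely_integrable_on torus" unfolding w_def by (rule lap_symbol_powr_integrable[OF assms])
  then have wI: "w integrable_on torus" by (simp add: absolutely_integrable_on_def)
  have Sc: "continuous_on A (S N)" for A N unfolding S_def by (rule continuous_on_lazy_partial)
  have SI: "S N integrable_on torus" for N by (intro integrable_torus_continuous Sc)
  have coeff: "0 \<le> 12 powr (-(\<alpha>/2)) * (pochhammer (\<alpha>/2) n / fact n)" for n
    using assms by (auto intro!: mult_nonneg_nonneg divide_nonneg_nonneg pochhammer_nonneg)
  have lim: "(\<lambda>N. S N k) \<longlonglongrightarrow> w k" if "k \<in> open_torus" for k
    using lazy_partial_sums[OF that, of "\<alpha>/2"] by (simp add: sums_def w_def S_def lazy_partial_def)
  have bnd: "0 \<le> S N k \<and> S N k \<le> w k" if k: "k \<in> open_torus" for N k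
  proof
    have nn: "0 \<le> 12 powr (-(\<alpha>/2)) * (pochhammer (\<alpha>/2) n / fact n) * lazy_symbol k ^ n" for n
      by (rule mult_nonneg_nonneg[OF coeff]) (use lazy_symbol_bounds[OF k] in simp)
    then show "0 \<le> S N k" unfolding S_def lazy_partial_def by (intro sum_nonneg) auto
    have "incseq (\<lambda>N. S N k)"
      unfolding S_def lazy_partial_def by (intro incseq_SucI) (use nn in auto)
    then show "S N k \<le> w k" using lim[OF k] by (rule incseq_le)
  qed
  have "(\<lambda>N. integral open_torus (S N)) \<longlonglongrightarrow> integral open_torus w"
    by (rule dominated_convergence(2)[where h = w])
       (use SI wI bnd lim in \<open>auto simp: integrable_torus_open\<close>)
  then have "(\<lambda>N. integral torus (S N)) \<longlonglongrightarrow> integral torus w"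
    by (simp add: integral_torus_open)
  with e obtain N where N: "dist (integral torus (S N)) (integral torus w) < e/2"
    by (metis LIMSEQ_def half_gt_zero order_refl)
  have "(cos_coeff (S N) \<longlongrightarrow> (\<Sum>n<N. 12 powr (-(\<alpha>/2)) * (pochhammer (\<alpha>/2) n / fact n) * 0)) cofinite"
  proof -
    have "cos_coeff (S N) = (\<lambda>z. \<Sum>n<N. 12 powr (-(\<alpha>/2)) * (pochhammer (\<alpha>/2) n / fact n) * cos_coeff (\<lambda>k. lazy_symbol k ^ n) z)"
    proof
      fix z
      have "cos_coeff (S N) z = integral torus (\<lambda>k. \<Sum>n<N. 12 powr (-(\<alpha>/2)) * (pochhammer (\<alpha>/2) n / fact n) * (cos (phase z k) * lazy_symbol k ^ n))"
        unfolding cos_coeff_def S_def lazy_partial_def by (simp add: sum_distrib_left mult_ac)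
      also have "\<dots> = (\<Sum>n<N. 12 powr (-(\<alpha>/2)) * (pochhammer (\<alpha>/2) n / fact n) * cos_coeff (\<lambda>k. lazy_symbol k ^ n) z)"
        unfolding cos_coeff_def
        by (subst integral_sum)
           (auto intro!: integrable_torus_continuous continuous_intros simp del: times_divide_eq_right)
      finally show "cos_coeff (S N) z = \<dots>" .
    qed
    then show ?thesis by (simp only:) (intro tendsto_intros cos_coeff_lazy_power)
  qed
  then have "(cos_coeff (S N) \<longlongrightarrow> 0) cofinite" by simp
  then have "eventually (\<lambda>z. dist (cos_coeff (S N) z) 0 < e/2) cofinite"
    using e by (intro tendstoD) auto
  moreover have "dist (cos_coeff w z) (cos_coeff (S N) z) \<le> dist (integral torus (S N)) (integral torus w)" for z
  proof -
    have Iw: "(\<lambda>k. cos (phase z k) * w k) integrable_on torus" by (rule integrable_cos_phase[OF w])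
    have IS: "(\<lambda>k. cos (phase z k) * S N k) integrable_on torus"
      by (intro integrable_torus_continuous continuous_intros Sc)
    have "norm (integral open_torus (\<lambda>k. cos (phase z k) * w k - cos (phase z k) * S N k)) 
       \<le> integral open_torus (\<lambda>k. w k - S N k)"
    proof (rule integral_norm_bound_integral)
      show "(\<lambda>k. cos (phase z k) * w k - cos (phase z k) * S N k) integrable_on open_torus"
        using Iw IS by (auto simp: integrable_torus_open intro!: integrable_diff)
      show "(\<lambda>k. w k - S N k) integrable_on open_torus"
        using wI SI by (auto simp: integrable_torus_open intro!: integrable_diff)
      fix k assume "k \<in> open_torus"
      then have "0 \<le> w k - S N k" using bnd by auto
      then have "\<bar>cos (phase z k)\<bar> * (w k - S N k) \<le> 1 * (w k - S N k)"
        by (intro mult_right_mono) auto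
      with \<open>0 \<le> w k - S N k\<close> show "norm (cos (phase z k) * w k - cos (phase z k) * S N k) \<le> w k - S N k"
        by (simp add: right_diff_distrib[symmetric] abs_mult)
    qed
    also have "integral open_torus (\<lambda>k. w k - S N k) = integral torus w - integral torus (S N)"
      using wI SI by (simp add: integral_diff integral_torus_open[symmetric])
    also have "integral open_torus (\<lambda>k. cos (phase z k) * w k - cos (phase z k) * S N k)
        = cos_coeff w z - cos_coeff (S N) z"
      using Iw IS by (simp add: integral_diff integral_torus_open[symmetric] cos_coeff_def)
    finally show ?thesis by (simp add: dist_real_def)
  qed
  ultimately have "eventually (\<lambda>z. dist (cos_coeff w z) 0 < e) cofinite"
  proof (elim eventually_mono)
    fix z assume "dist (cos_coeff (S N) z) 0 < e/2"
      and "\<And>z. dist (cos_coeff w z) (cos_coeff (S N) z) \<le> dist (integral torus (S N)) (integral torus w)"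
    with N have "dist (cos_coeff w z) (cos_coeff (S N) z) < e/2" by (meson le_less_trans)
    with \<open>dist (cos_coeff (S N) z) 0 < e/2\<close> dist_triangle[of "cos_coeff w z" 0 "cos_coeff (S N) z"]
    show "dist (cos_coeff w z) 0 < e" by linarith
  qed
  then show "eventually (\<lambda>z. dist (cos_coeff (\<lambda>k. lap_symbol k powr (- \<alpha>/2)) z) 0 < e) cofinite"
    by (simp add: w_def)
qed

section \<open>Bounds, positivity and decay of the kernel\<close>

definition green :: "real \<Rightarrow> int^3 \<Rightarrow> real" where
  "green \<alpha> z = K_const \<alpha> / (2*pi)^3 * cos_coeff (\<lambda>k. lap_symbol k powr (- \<alpha>/2)) z"

text \<open>The real part moves under the integral because the integrand is integrable, which rests
  on absolute integrability of the singular weight.\<close>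

lemma R_alpha_eq_green:
  assumes "0 < \<alpha>" "\<alpha> < 3"
  shows "R_alpha \<alpha> x y = green \<alpha> (x - y)"
proof -
  let ?w = "\<lambda>k. lap_symbol k powr (- \<alpha>/2)"
  let ?e = "\<lambda>k. exp (\<i> * complex_of_real (phase (x - y) k)) * complex_of_real (?w k)"
  have w: "(\<lambda>k. complex_of_real (?w k)) absolutely_integrable_on torus"
    using absolutely_integrable_linear[OF lap_symbol_powr_integrable[OF assms] bounded_linear_of_real]
    by (simp add: o_def)
  have "?e absolutely_integrable_on torus"
  proof (rule absolutely_integrable_bounded_measurable_product[OF bilinear_times _ _ _ w])
    show "torus \<in> sets lebesgue" by (simp add: torus_def)
    then show "(\<lambda>k. exp (\<i> * complex_of_real (phase (x - y) k))) \<in> borel_measurable (lebesgue_on torus)"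
      by (intro continuous_imp_measurable_on_sets_lebesgue continuous_intros)
    show "bounded ((\<lambda>k. exp (\<i> * complex_of_real (phase (x - y) k))) ` torus)"
      by (rule boundedI[of _ 1]) auto
  qed
  then have "?e integrable_on torus" by (simp add: absolutely_integrable_on_def)
  then have "integral torus (Re \<circ> ?e) = Re (integral torus ?e)"
    by (rule integral_linear[OF _ bounded_linear_Re])
  moreover have "Re \<circ> ?e = (\<lambda>k. cos (phase (x - y) k) * ?w k)"
    by (auto simp: fun_eq_iff cis_conv_exp[symmetric])
  moreover have "R_alpha \<alpha> x y = K_const \<alpha> / (2*pi)^3 * Re (integral torus ?e)"
    unfolding R_alpha_def phase_def[symmetric] by simp
  ultimately show ?thesis
    by (simp add: green_def cos_coeff_def)
qed

lemma green_minus: "green \<alpha> (- z) = green \<alpha> z"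
  by (simp add: green_def cos_coeff_def phase_minus)

lemma green_tendsto_0: "0 < \<alpha> \<Longrightarrow> \<alpha> < 3 \<Longrightarrow> (green \<alpha> \<longlongrightarrow> 0) cofinite"
  unfolding green_def by (intro tendsto_mult_right_zero cos_coeff_lap_symbol_powr)

lemma vol_torus: "integral torus (\<lambda>k. c) = (2*pi)^3 * (c::real)"
proof -
  have "(0::real^3) \<in> cbox 0 (\<chi> j. 2*pi)" by (simp add: mem_box_cart)
  then show ?thesis unfolding torus_def by (auto simp: content_cbox_if_cart)
qed

text \<open>The integrand is continuous and nonnegative. A vanishing integral would force it to be 0
  on the whole box, yet it is positive at the centre.\<close>

lemma K_const_pos:
  assumes "0 < \<alpha>"
  shows "0 < K_const \<alpha>"
proof -
  let ?m = "\<lambda>k. lap_symbol k powr (\<alpha>/2)"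
  have c: "continuous_on torus ?m"
    using assms by (intro continuous_on_powr' continuous_intros) (auto simp: lap_symbol_nonneg)
  have I: "?m integrable_on torus" using c unfolding torus_def by (rule integrable_continuous)
  then have "0 \<le> integral torus ?m" by (intro integral_nonneg) auto
  moreover have "integral torus ?m \<noteq> 0"
  proof
    assume 0: "integral torus ?m = 0"
    have "(\<chi> j. pi) \<in> open_torus" by (simp add: mem_open_torus)
    then have ne: "open_torus \<noteq> {}" by blast
    have "(?m has_integral 0) torus" using integrable_integral[OF I] 0 by simp
    then have "?m k = 0" if "k \<in> torus" for k
      using has_integral_0_cbox_imp_0[of 0 "\<chi> j. 2*pi" ?m] c ne that by (auto simp: torus_def)
    from this[of "\<chi> j. pi"] lap_symbol_pos[OF \<open>(\<chi> j. pi) \<in> open_torus\<close>] show False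
      by (simp add: torus_def mem_box_cart)
  qed
  ultimately show ?thesis by (simp add: K_const_def)
qed

text \<open>A positive diagonal gives a point mass a positive Choquard energy, which later makes the
  Nehari manifold nonempty. The weight is bounded below because the symbol is at most 12.\<close>

lemma green_0_pos:
  assumes "0 < \<alpha>" "\<alpha> < 3"
  shows "0 < green \<alpha> 0"
proof -
  let ?w = "\<lambda>k. lap_symbol k powr (- \<alpha>/2)"
  have I: "?w integrable_on torus"
    using lap_symbol_powr_integrable[OF assms] by (simp add: absolutely_integrable_on_def)
  have "integral open_torus (\<lambda>k. 12 powr (-\<alpha>/2)) \<le> integral open_torus ?w"
  proof (rule integral_le)
    show "?w integrable_on open_torus" using I by (simp add: integrable_torus_open)
    show "(\<lambda>k. 12 powr (-\<alpha>/2)) integrable_on open_torus"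
      by (simp add: integrable_torus_open[symmetric] integrable_torus_continuous)
    show "12 powr (-\<alpha>/2) \<le> ?w k" if "k \<in> open_torus" for k
      using lap_symbol_pos[OF that] lap_symbol_le[of k] assms by (intro powr_mono2') auto
  qed
  moreover have "0 < integral open_torus (\<lambda>k::real^3. 12 powr (-\<alpha>/2) :: real)"
    by (simp add: integral_torus_open[symmetric] vol_torus)
  ultimately have "0 < cos_coeff ?w 0"
    by (simp add: cos_coeff_def phase_def integral_torus_open)
  then show ?thesis using K_const_pos[OF assms(1)] by (simp add: green_def)
qed

text \<open>A nonnegative weight has its largest coefficient at the mode 0, where the cosine is
  identically 1.\<close>

lemma abs_green_le:
  assumes "0 < \<alpha>" "\<alpha> < 3"
  shows "\<bar>green \<alpha> z\<bar> \<le> green \<alpha> 0"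
proof -
  let ?w = "\<lambda>k. lap_symbol k powr (- \<alpha>/2)"
  note w = lap_symbol_powr_integrable[OF assms]
  have "norm (cos_coeff ?w z) \<le> integral torus ?w"
    unfolding cos_coeff_def
  proof (rule integral_norm_bound_integral)
    show "(\<lambda>k. cos (phase z k) * ?w k) integrable_on torus" by (rule integrable_cos_phase[OF w])
    show "?w integrable_on torus" using w by (simp add: absolutely_integrable_on_def)
    show "norm (cos (phase z k) * ?w k) \<le> ?w k" for k
      using mult_right_mono[of "\<bar>cos (phase z k)\<bar>" 1 "?w k"] by (simp add: abs_mult)
  qed
  then have "\<bar>cos_coeff ?w z\<bar> \<le> cos_coeff ?w 0"
    by (simp add: cos_coeff_def[of _ 0] phase_def)
  then show ?thesis using K_const_pos[OF assms(1)]
    by (simp add: green_def abs_mult divide_simps)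
qed

section \<open>Square-summable functions\<close>

lemma infsum_split_finite:
  fixes f :: "'i \<Rightarrow> real"
  assumes "f summable_on UNIV" "finite F"
  shows "infsum f UNIV = sum f F + infsum f (- F)"
proof -
  have "infsum f (F \<union> - F) = infsum f F + infsum f (- F)"
    using assms by (intro infsum_Un_disjoint summable_on_subset_banach[OF assms(1)]) auto
  with assms show ?thesis by simp
qed

lemma summable_on_real_bound:
  fixes f g :: "'i \<Rightarrow> real"
  assumes "g summable_on A" "\<And>x. x \<in> A \<Longrightarrow> \<bar>f x\<bar> \<le> g x"
  shows "f summable_on A"
  by (rule abs_summable_summable, rule Infinite_Sum.abs_summable_on_comparison_test'[OF assms(1)])
     (use assms(2) in simp)

lemma summable_on_abs_real:
  fixes f :: "'i \<Rightarrow> real"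
  shows "f summable_on A \<Longrightarrow> (\<lambda>x. \<bar>f x\<bar>) summable_on A"
  unfolding real_norm_def[symmetric] by (rule summable_on_iff_abs_summable_on_real[THEN iffD1])

lemma infsum_tail_small:
  fixes f :: "'i \<Rightarrow> real"
  assumes "f summable_on UNIV" "\<And>x. 0 \<le> f x" "0 < e"
  obtains F where "finite F" "infsum f (- F) \<le> e"
proof -
  obtain F where F: "finite F" "dist (sum f F) (infsum f UNIV) \<le> e"
    using infsum_finite_approximation[OF assms(1,3)] by auto
  with infsum_split_finite[OF assms(1) F(1)] have "infsum f (- F) \<le> e"
    by (auto simp: dist_real_def)
  with F(1) show ?thesis by (rule that)
qed

text \<open>A Vitali-type criterion: pointwise convergence settles a finite set, the uniform tail
  bound its complement. It serves where uniform tails, but no common summable majorant, are at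
  hand.\<close>

lemma infsum_tendsto_0_tight:
  fixes f :: "nat \<Rightarrow> 'i \<Rightarrow> real"
  assumes sm: "\<And>n. f n summable_on UNIV" and nn: "\<And>n x. 0 \<le> f n x"
    and pt: "\<And>x. (\<lambda>n. f n x) \<longlonglongrightarrow> 0"
    and tight: "\<And>e. 0 < e \<Longrightarrow> \<exists>F. finite F \<and> (\<forall>n. infsum (f n) (- F) \<le> e)"
  shows "(\<lambda>n. infsum (f n) UNIV) \<longlonglongrightarrow> 0"
proof (rule tendstoI)
  fix e :: real assume e: "0 < e"
  obtain F where F: "finite F" "\<And>n. infsum (f n) (- F) \<le> e/2"
    using tight[of "e/2"] e by auto
  have "(\<lambda>n. sum (f n) F) \<longlonglongrightarrow> (\<Sum>x\<in>F. 0)"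
    by (intro tendsto_sum pt)
  then have "eventually (\<lambda>n. sum (f n) F < e/2) sequentially"
    using e by (intro order_tendstoD(2)[where y = "\<Sum>x\<in>F. 0"]) auto
  then show "eventually (\<lambda>n. dist (infsum (f n) UNIV) 0 < e) sequentially"
  proof eventually_elim
    case (elim n)
    have "infsum (f n) UNIV < e"
      using infsum_split_finite[OF sm[of n] F(1)] F(2)[of n] elim by linarith
    moreover have "0 \<le> infsum (f n) UNIV" by (rule infsum_nonneg) (use nn in auto)
    ultimately show ?case by simp
  qed
qed

lemma infsum_le_infsum_UNIV:
  fixes f :: "'i \<Rightarrow> real"
  assumes "f summable_on UNIV" "\<And>x. 0 \<le> f x"
  shows "infsum f A \<le> infsum f UNIV"
  using assms by (intro infsum_mono2 summable_on_subset_banach[OF assms(1)]) auto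

definition l2 :: "('i \<Rightarrow> real) set" where
  "l2 = {u. (\<lambda>x. (u x)\<^sup>2) summable_on UNIV}"

text \<open>A divergent infinite sum has the default value 0. Hence the additivity rules below ask
  for membership in \<open>l2\<close>, while the scaling rules hold for all functions.\<close>

definition ip :: "('i \<Rightarrow> real) \<Rightarrow> ('i \<Rightarrow> real) \<Rightarrow> real" where
  "ip u v = (\<Sum>\<^sub>\<infinity>x. u x * v x)"

text \<open>Young's inequality with a free weight \<eta>, which balances a factor with small tail
  against a factor that is merely bounded.\<close>

lemma abs_mult_le_squares: "0 < \<eta> \<Longrightarrow> \<bar>s * t\<bar> \<le> s\<^sup>2 / (2 * \<eta>) + \<eta> / 2 * t\<^sup>2" for s t \<eta> :: real
proof -
  assume \<eta>: "0 < \<eta>"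
  have "0 \<le> (\<bar>s\<bar> - \<eta> * \<bar>t\<bar>)\<^sup>2" by simp
  then have "2 * \<eta> * \<bar>s * t\<bar> \<le> s\<^sup>2 + \<eta>\<^sup>2 * t\<^sup>2" by (simp add: power2_diff power_mult_distrib abs_mult mult_ac)
  with \<eta> show ?thesis by (simp add: field_simps power2_eq_square)
qed

lemma l2_mult_summable:
  assumes "u \<in> l2" "v \<in> l2"
  shows "(\<lambda>x. u x * v x) summable_on UNIV"
proof (rule summable_on_real_bound)
  have "(\<lambda>x. 1 / 2 * (u x)\<^sup>2 + 1 / 2 * (v x)\<^sup>2) summable_on UNIV"
    using assms unfolding l2_def by (intro summable_on_add summable_on_cmult_right) auto
  then show "(\<lambda>x. (u x)\<^sup>2 / (2*1) + 1 / 2 * (v x)\<^sup>2) summable_on UNIV" by simp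
  show "\<bar>u x * v x\<bar> \<le> (u x)\<^sup>2 / (2*1) + 1 / 2 * (v x)\<^sup>2" for x
    by (rule abs_mult_le_squares) simp
qed

lemma l2_abs_mult_summable:
  "u \<in> l2 \<Longrightarrow> v \<in> l2 \<Longrightarrow> (\<lambda>x. \<bar>u x * v x\<bar>) summable_on UNIV"
  by (intro summable_on_abs_real l2_mult_summable)

lemma l2_scale: "u \<in> l2 \<Longrightarrow> (\<lambda>x. c * u x) \<in> l2"
  unfolding l2_def by (auto simp: power_mult_distrib intro: summable_on_cmult_right)

lemma l2_add:
  assumes "u \<in> l2" "v \<in> l2"
  shows "(\<lambda>x. u x + v x) \<in> l2"
proof -
  have "(\<lambda>x. (u x)\<^sup>2 + 2 * (u x * v x) + (v x)\<^sup>2) summable_on UNIV"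
    using assms l2_mult_summable[OF assms] unfolding l2_def
    by (intro summable_on_add summable_on_cmult_right) auto
  then show ?thesis by (simp add: l2_def power2_sum algebra_simps)
qed

lemma l2_diff: "u \<in> l2 \<Longrightarrow> v \<in> l2 \<Longrightarrow> (\<lambda>x. u x - v x) \<in> l2"
  using l2_add[of u "\<lambda>x. -1 * v x"] l2_scale[of v "-1"] by simp

lemma summable_on_shift:
  fixes f :: "'a::group_add \<Rightarrow> real"
  shows "(\<lambda>x. f (x + c)) summable_on UNIV \<longleftrightarrow> f summable_on UNIV"
  by (rule summable_on_reindex_bij_betw[of "\<lambda>x. x + c" UNIV UNIV f])
     (auto intro!: bij_betwI[of _ _ _ "\<lambda>x. x - c"])

lemma infsum_shift:
  fixes f :: "'a::group_add \<Rightarrow> real"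
  shows "(\<Sum>\<^sub>\<infinity>x. f (x + c)) = infsum f UNIV"
  by (rule infsum_reindex_bij_betw[of "\<lambda>x. x + c" UNIV UNIV f])
     (auto intro!: bij_betwI[of _ _ _ "\<lambda>x. x - c"])

lemma l2_shift: "(\<lambda>x. u (x + c)) \<in> l2 \<longleftrightarrow> u \<in> l2" for c :: "'a::group_add"
  unfolding l2_def using summable_on_shift[of "\<lambda>x. (u x)\<^sup>2" c] by simp

lemma ip_shift: "ip (\<lambda>x. u (x + c)) (\<lambda>x. v (x + c)) = ip u v" for c :: "'a::group_add"
  unfolding ip_def using infsum_shift[of "\<lambda>x. u x * v x" c] by simp

lemma ip_commute: "ip u v = ip v u"
  unfolding ip_def by (simp add: mult.commute)

lemma ip_nonneg: "0 \<le> ip u u"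
  unfolding ip_def by (rule infsum_nonneg) auto

lemma ip_scale_left: "ip (\<lambda>x. c * u x) v = c * ip u v"
  unfolding ip_def by (simp add: mult.assoc infsum_cmult_right')

lemma ip_scale_right: "ip u (\<lambda>x. c * v x) = c * ip u v"
  using ip_scale_left[of c v u] by (simp add: ip_commute)

lemma ip_add_left:
  "u \<in> l2 \<Longrightarrow> v \<in> l2 \<Longrightarrow> w \<in> l2 \<Longrightarrow> ip (\<lambda>x. u x + v x) w = ip u w + ip v w"
  unfolding ip_def by (simp add: distrib_right infsum_add l2_mult_summable)

lemma ip_diff_left:
  "u \<in> l2 \<Longrightarrow> v \<in> l2 \<Longrightarrow> w \<in> l2 \<Longrightarrow> ip (\<lambda>x. u x - v x) w = ip u w - ip v w"
  using ip_add_left[of u "\<lambda>x. -1 * v x" w] ip_scale_left[of "-1" v w] by (simp add: l2_scale[of v "-1", simplified])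

lemma ip_add_scale_self:
  assumes "u \<in> l2" "v \<in> l2"
  shows "ip (\<lambda>x. u x + t * v x) (\<lambda>x. u x + t * v x) = ip u u + 2 * t * ip u v + t\<^sup>2 * ip v v"
proof -
  let ?w = "\<lambda>x. u x + t * v x"
  have w: "?w \<in> l2" using assms by (intro l2_add l2_scale)
  have "ip ?w ?w = ip u ?w + t * ip v ?w"
    using ip_add_left[OF assms(1) l2_scale[OF assms(2), of t] w] by (simp add: ip_scale_left)
  also have "ip u ?w = ip u u + t * ip v u"
    using ip_add_left[OF assms(1) l2_scale[OF assms(2), of t] assms(1)]
    by (simp add: ip_scale_left ip_commute[of u ?w])
  also have "ip v ?w = ip u v + t * ip v v"
    using ip_add_left[OF assms(1) l2_scale[OF assms(2), of t] assms(2)]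
    by (simp add: ip_scale_left ip_commute[of v ?w])
  finally show ?thesis by (simp add: algebra_simps power2_eq_square ip_commute[of v u])
qed

lemma ip_pos:
  assumes "u \<in> l2" "u x \<noteq> 0"
  shows "0 < ip u u"
proof -
  have s: "(\<lambda>x. u x * u x) summable_on UNIV" using assms by (intro l2_mult_summable)
  have "sum (\<lambda>x. u x * u x) {x} \<le> ip u u"
    unfolding ip_def by (rule finite_sum_le_infsum[OF s]) auto
  moreover have "0 < u x * u x" using assms(2) by (simp add: zero_less_mult_iff) linarith
  ultimately show ?thesis by simp
qed

lemma power2_le_ip_self:
  assumes "u \<in> l2"
  shows "(u x)\<^sup>2 \<le> ip u u"
proof -
  have s: "(\<lambda>x. u x * u x) summable_on UNIV" using assms by (intro l2_mult_summable)
  have "sum (\<lambda>x. u x * u x) {x} \<le> ip u u"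
    unfolding ip_def by (rule finite_sum_le_infsum[OF s]) auto
  then show ?thesis by (simp add: power2_eq_square)
qed

text \<open>Fatou's lemma for counting measure: each finite partial sum passes to the limit and
  keeps the bound \<open>M\<close>.\<close>

lemma l2_fatou:
  assumes l2: "\<And>n. v n \<in> l2" and bd: "\<And>n. ip (v n) (v n) \<le> M" and pt: "\<And>x. (\<lambda>n. v n x) \<longlonglongrightarrow> u x"
  shows "u \<in> l2"
proof -
  have "sum (\<lambda>x. (u x)\<^sup>2) F \<le> M" if F: "finite F" for F
  proof (rule LIMSEQ_le_const2)
    show "(\<lambda>n. \<Sum>x\<in>F. (v n x)\<^sup>2) \<longlonglongrightarrow> (\<Sum>x\<in>F. (u x)\<^sup>2)"
      by (intro tendsto_intros pt)
    have "(\<Sum>x\<in>F. (v n x)\<^sup>2) \<le> ip (v n) (v n)" for n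
      unfolding ip_def using finite_sum_le_infsum[OF l2_mult_summable[OF l2 l2] F, of n n]
      by (simp add: power2_eq_square)
    then show "\<exists>N. \<forall>n\<ge>N. (\<Sum>x\<in>F. (v n x)\<^sup>2) \<le> M" using bd order_trans by blast
  qed
  then have "bdd_above (sum (\<lambda>x. (u x)\<^sup>2) ` {F. F \<subseteq> UNIV \<and> finite F})"
    by (intro bdd_aboveI[of _ M]) auto
  then show ?thesis unfolding l2_def
    by (auto intro!: nonneg_bdd_above_summable_on)
qed

lemma tail_product_bound:
  assumes u: "u \<in> l2" and v: "v \<in> l2" and \<eta>: "0 < \<eta>"
  shows "(\<Sum>\<^sub>\<infinity>x\<in>A. \<bar>u x * v x\<bar>) \<le> (\<Sum>\<^sub>\<infinity>x\<in>A. (u x)\<^sup>2) / (2 * \<eta>) + \<eta> / 2 * ip v v"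
proof -
  have su: "(\<lambda>x. (u x)\<^sup>2) summable_on A" and sv: "(\<lambda>x. (v x)\<^sup>2) summable_on A"
    using u v summable_on_subset_banach unfolding l2_def by blast+
  have sv': "(\<lambda>x. (v x)\<^sup>2) summable_on UNIV" using v by (simp add: l2_def)
  have su2: "(\<lambda>x. (u x)\<^sup>2 / (2 * \<eta>)) summable_on A"
    using summable_on_cmult_left[OF su, of "1/(2*\<eta>)"] by simp
  have "(\<Sum>\<^sub>\<infinity>x\<in>A. \<bar>u x * v x\<bar>) \<le> (\<Sum>\<^sub>\<infinity>x\<in>A. (u x)\<^sup>2 / (2 * \<eta>) + \<eta> / 2 * (v x)\<^sup>2)"
    using abs_mult_le_squares[OF \<eta>]
    by (intro infsum_mono summable_on_add summable_on_cmult_right su2 sv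
          summable_on_subset_banach[OF l2_abs_mult_summable[OF u v]]) auto
  also have "\<dots> = (\<Sum>\<^sub>\<infinity>x\<in>A. (u x)\<^sup>2 / (2 * \<eta>)) + (\<Sum>\<^sub>\<infinity>x\<in>A. \<eta> / 2 * (v x)\<^sup>2)"
    by (intro infsum_add summable_on_cmult_right su2 sv)
  also have "(\<Sum>\<^sub>\<infinity>x\<in>A. (u x)\<^sup>2 / (2 * \<eta>)) = (\<Sum>\<^sub>\<infinity>x\<in>A. (u x)\<^sup>2) / (2 * \<eta>)"
    using infsum_cmult_left'[of "\<lambda>x. (u x)\<^sup>2" "1/(2*\<eta>)" A] by simp
  also have "(\<Sum>\<^sub>\<infinity>x\<in>A. \<eta> / 2 * (v x)\<^sup>2) = \<eta> / 2 * (\<Sum>\<^sub>\<infinity>x\<in>A. (v x)\<^sup>2)"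
    by (rule infsum_cmult_right')
  also have "(\<Sum>\<^sub>\<infinity>x\<in>A. (v x)\<^sup>2) \<le> ip v v"
    unfolding ip_def power2_eq_square[symmetric] by (rule infsum_le_infsum_UNIV[OF sv']) simp
  finally show ?thesis using \<eta> by simp
qed

text \<open>The fixed factor alone supplies the small tail, so the set \<open>F\<close> can be
  chosen independently of n even if the mass of \<open>v n\<close> escapes to infinity.\<close>

lemma l2_product_tight:
  fixes v :: "nat \<Rightarrow> 'i \<Rightarrow> real"
  assumes u: "u \<in> l2" and v: "\<And>n. v n \<in> l2" and bd: "\<And>n. ip (v n) (v n) \<le> M" and e: "0 < e"
  shows "\<exists>F. finite F \<and> (\<forall>n. (\<Sum>\<^sub>\<infinity>x\<in>-F. \<bar>u x * v n x\<bar>) \<le> e)"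
proof -
  have M: "0 \<le> M" using bd[of 0] ip_nonneg[of "v 0"] by linarith
  \<comment> \<open>With a tail of \<open>u\<close> of size at most \<eta> e, Young's inequality
    gives e/2 for the first term, and \<eta> M \<le> e gives at most e/2 for the second. Adding 1 to
    \<open>M\<close> avoids division by 0.\<close>
  define \<eta> where "\<eta> = e / (M + 1)"
  have \<eta>: "0 < \<eta>" using e M by (simp add: \<eta>_def)
  have "\<eta> * M \<le> e" using e M by (simp add: \<eta>_def field_simps)
  obtain F where F: "finite F" "(\<Sum>\<^sub>\<infinity>x\<in>-F. (u x)\<^sup>2) \<le> \<eta> * e"
    using infsum_tail_small[of "\<lambda>x. (u x)\<^sup>2" "\<eta> * e"] u \<eta> e by (auto simp: l2_def)
  have "(\<Sum>\<^sub>\<infinity>x\<in>-F. \<bar>u x * v n x\<bar>) \<le> e" for n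
  proof -
    have "(\<Sum>\<^sub>\<infinity>x\<in>-F. \<bar>u x * v n x\<bar>) \<le> (\<Sum>\<^sub>\<infinity>x\<in>-F. (u x)\<^sup>2) / (2 * \<eta>) + \<eta> / 2 * ip (v n) (v n)"
      by (rule tail_product_bound[OF u v \<eta>])
    also have "\<dots> \<le> (\<eta> * e) / (2 * \<eta>) + \<eta> / 2 * M"
      using F(2) bd[of n] \<eta> by (intro add_mono divide_right_mono mult_left_mono) auto
    also have "\<dots> \<le> e" using \<eta> \<open>\<eta> * M \<le> e\<close> by simp
    finally show ?thesis .
  qed
  with F(1) show ?thesis by blast
qed

lemma ip_weak_tendsto_0:
  fixes v :: "nat \<Rightarrow> 'i \<Rightarrow> real"
  assumes u: "u \<in> l2" and v: "\<And>n. v n \<in> l2" and bd: "\<And>n. ip (v n) (v n) \<le> M"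
    and pt: "\<And>x. (\<lambda>n. v n x) \<longlonglongrightarrow> 0"
  shows "(\<lambda>n. ip u (v n)) \<longlonglongrightarrow> 0"
proof (rule tendsto_rabs_zero_cancel, rule tendsto_sandwich[of "\<lambda>_. 0"])
  show "(\<lambda>n. \<Sum>\<^sub>\<infinity>x. \<bar>u x * v n x\<bar>) \<longlonglongrightarrow> 0"
  proof (rule infsum_tendsto_0_tight)
    show "(\<lambda>n. \<bar>u x * v n x\<bar>) \<longlonglongrightarrow> 0" for x
      by (intro tendsto_rabs_zero tendsto_mult_right_zero pt)
  qed (use l2_product_tight[of u v, OF u v bd] l2_abs_mult_summable[OF u v] in auto)
  show "\<forall>\<^sub>F n in sequentially. \<bar>ip u (v n)\<bar> \<le> (\<Sum>\<^sub>\<infinity>x. \<bar>u x * v n x\<bar>)"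
    unfolding ip_def
    by (intro always_eventually allI)
       (use norm_infsum_bound[of "\<lambda>x. u x * v _ x" UNIV] l2_abs_mult_summable[OF u v] in simp)
qed auto

section \<open>Inequalities and derivatives of real powers\<close>

lemma Bernoulli_powr:
  fixes x q :: real
  assumes "0 \<le> x" "1 \<le> q"
  shows "1 + q * (x - 1) \<le> x powr q"
proof (cases "x = 0")
  case False
  \<comment> \<open>Convexity: the power lies above its tangent at 1.\<close>
  have "q * 1 powr (q-1) * (x - 1) \<le> x powr q - 1 powr q"
  proof (rule f''_imp_f'[of "{0<..}" "\<lambda>x. x powr q" "\<lambda>x. q * x powr (q-1)" "\<lambda>x. q * ((q-1) * x powr (q-1-1))" 1 x])
    show "((\<lambda>x. x powr q) has_real_derivative q * x powr (q - 1)) (at x)" if "x \<in> {0<..}" for x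
      using that by (auto intro!: derivative_eq_intros)
    show "((\<lambda>x. q * x powr (q - 1)) has_real_derivative q * ((q-1) * x powr (q - 1 - 1))) (at x)"
      if "x \<in> {0<..}" for x
      using that by (auto intro!: derivative_eq_intros)
  qed (use assms False in auto)
  then show ?thesis by simp
qed (use assms in simp)

lemma powr_diff_le:
  fixes A B q :: real
  assumes "0 \<le> A" "0 \<le> B" "1 \<le> q"
  shows "A powr q - B powr q \<le> q * A powr (q - 1) * (A - B)"
proof (cases "A = 0")
  case False
  with assms have A: "0 < A" by simp
  have "A powr q * (1 + q * (B/A - 1)) \<le> A powr q * (B/A) powr q"
    using assms A by (intro mult_left_mono Bernoulli_powr) auto
  also have "\<dots> = B powr q" using A assms by (simp add: powr_divide)
  finally have *: "A powr q * (1 + q * (B/A - 1)) \<le> B powr q" .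
  have "A powr q = A * A powr (q - 1)" using A by (simp add: powr_diff)
  then have "A powr q * (1 + q * (B/A - 1)) = A powr q - q * A powr (q - 1) * (A - B)"
    using A by (simp add: field_simps)
  with * show ?thesis by linarith
qed (use assms in simp)

text \<open>Every term of the bound carries a factor s, since s will be a fixed function with small
  tails and t a term of a bounded sequence. The tangent inequality in both directions yields the p
  in the constant, and the power of |s| yields the extra 1.\<close>

lemma abs_powr_add_diff_le:
  fixes s t p M :: real
  assumes p: "2 \<le> p" and M: "\<bar>s\<bar> + \<bar>t\<bar> \<le> M"
  shows "\<bar>\<bar>s + t\<bar> powr p - \<bar>t\<bar> powr p - \<bar>s\<bar> powr p\<bar> \<le> (p + 1) * M powr (p - 2) * (s\<^sup>2 + \<bar>s * t\<bar>)"
proof -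
  let ?S = "\<bar>s\<bar> + \<bar>t\<bar>"
  have key: "q powr (p - 1) * \<bar>s\<bar> \<le> M powr (p - 2) * (s\<^sup>2 + \<bar>s * t\<bar>)" if q: "0 \<le> q" "q \<le> ?S" for q
  proof -
    have "q powr (p - 1) \<le> ?S powr (p - 1)" using q p by (intro powr_mono2) auto
    also have "?S powr (p - 1) = ?S * ?S powr (p - 2)"
    proof (cases "?S = 0")
      case False
      then have "0 < ?S" by (smt (verit) abs_ge_zero)
      then show ?thesis using powr_add[of ?S 1 "p - 2"] by simp
    next
      case True
      then have "s = 0 \<and> t = 0" by linarith
      then show ?thesis by simp
    qed
    also have "\<dots> \<le> ?S * M powr (p - 2)"
      using M p by (intro mult_left_mono powr_mono2) auto
    finally have "q powr (p - 1) * \<bar>s\<bar> \<le> ?S * M powr (p - 2) * \<bar>s\<bar>"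
      by (rule mult_right_mono) simp
    also have "\<dots> = M powr (p - 2) * (s\<^sup>2 + \<bar>s * t\<bar>)"
      by (simp add: algebra_simps abs_mult power2_eq_square)
    finally show ?thesis .
  qed
  have a: "\<bar>s + t\<bar> powr p - \<bar>t\<bar> powr p \<le> p * (M powr (p - 2) * (s\<^sup>2 + \<bar>s * t\<bar>))"
  proof -
    have "\<bar>s + t\<bar> powr p - \<bar>t\<bar> powr p \<le> p * \<bar>s + t\<bar> powr (p - 1) * (\<bar>s + t\<bar> - \<bar>t\<bar>)"
      using p by (intro powr_diff_le) auto
    also have "\<dots> \<le> p * \<bar>s + t\<bar> powr (p - 1) * \<bar>s\<bar>"
      using p by (intro mult_left_mono) auto
    also have "\<dots> \<le> p * (M powr (p - 2) * (s\<^sup>2 + \<bar>s * t\<bar>))"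
      using key[of "\<bar>s + t\<bar>"] p by (simp add: mult.assoc)
    finally show ?thesis .
  qed
  have b: "\<bar>t\<bar> powr p - \<bar>s + t\<bar> powr p \<le> p * (M powr (p - 2) * (s\<^sup>2 + \<bar>s * t\<bar>))"
  proof -
    have "\<bar>t\<bar> powr p - \<bar>s + t\<bar> powr p \<le> p * \<bar>t\<bar> powr (p - 1) * (\<bar>t\<bar> - \<bar>s + t\<bar>)"
      using p by (intro powr_diff_le) auto
    also have "\<dots> \<le> p * \<bar>t\<bar> powr (p - 1) * \<bar>s\<bar>"
      using p by (intro mult_left_mono) auto
    also have "\<dots> \<le> p * (M powr (p - 2) * (s\<^sup>2 + \<bar>s * t\<bar>))"
      using key[of "\<bar>t\<bar>"] p by (simp add: mult.assoc)
    finally show ?thesis .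
  qed
  have "\<bar>s\<bar> powr p = \<bar>s\<bar> powr (p - 1) * \<bar>s\<bar>"
    using powr_add[of "\<bar>s\<bar>" "p - 1" 1] by simp
  with key[of "\<bar>s\<bar>"] have "\<bar>s\<bar> powr p \<le> M powr (p - 2) * (s\<^sup>2 + \<bar>s * t\<bar>)" by simp
  with a b show ?thesis by (simp add: algebra_simps abs_le_iff) (smt (verit) powr_ge_zero)
qed

lemma abs_powr_has_derivative:
  fixes x p :: real
  assumes p: "2 < p"
  shows "((\<lambda>x. \<bar>x\<bar> powr p) has_real_derivative p * (\<bar>x\<bar> powr (p - 2) * x)) (at x)"
proof -
  consider "x > 0" | "x < 0" | "x = 0" by linarith
  then show ?thesis
  proof cases
    case 1
    have "((\<lambda>x. x powr p) has_real_derivative p * (\<bar>x\<bar> powr (p - 2) * x)) (at x)"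
      using 1 powr_add[of x "p-2" 1] by (auto intro!: derivative_eq_intros)
    moreover have "eventually (\<lambda>y. \<bar>y\<bar> powr p = y powr p) (nhds x)"
      using eventually_nhds_in_open[of "{0<..}" x] 1 by (auto elim!: eventually_mono)
    ultimately show ?thesis by (subst DERIV_cong_ev[OF refl _ refl])
  next
    case 2
    have "((\<lambda>x. (-x) powr p) has_real_derivative p * (\<bar>x\<bar> powr (p - 2) * x)) (at x)"
      using 2 powr_add[of "-x" "p-2" 1] by (auto intro!: derivative_eq_intros)
    moreover have "eventually (\<lambda>y. \<bar>y\<bar> powr p = (-y) powr p) (nhds x)"
      using eventually_nhds_in_open[of "{..<0}" x] 2 by (auto elim!: eventually_mono)
    ultimately show ?thesis by (subst DERIV_cong_ev[OF refl _ refl])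
  next
    case 3
    \<comment> \<open>At the origin the difference quotient has absolute value
      \<open>\<bar>y\<bar> powr (p - 1)\<close>, which tends to 0; taking absolute values disposes
      of the sign of y.\<close>
    have "((\<lambda>y::real. \<bar>y\<bar> powr (p - 1)) \<longlongrightarrow> 0) (at 0)"
    proof -
      have "((\<lambda>y::real. \<bar>y\<bar> powr (p - 1)) \<longlongrightarrow> \<bar>0\<bar> powr (p - 1)) (at 0)"
        using p by (intro tendsto_powr' tendsto_rabs tendsto_ident_at tendsto_const) (auto simp: eventually_at_filter)
      then show ?thesis by simp
    qed
    then have "((\<lambda>y::real. \<bar>\<bar>y\<bar> powr p / y\<bar>) \<longlongrightarrow> 0) (at 0)"
    proof (rule Lim_transform_eventually)
      have "\<bar>y\<bar> powr (p - 1) = \<bar>\<bar>y\<bar> powr p / y\<bar>" if "y \<noteq> 0" for y :: real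
        using that by (simp add: powr_diff abs_divide)
      then show "\<forall>\<^sub>F y in at 0. \<bar>y\<bar> powr (p - 1) = \<bar>\<bar>y\<bar> powr p / y\<bar>" 
        by (auto simp: eventually_at_filter)
    qed
    then have "((\<lambda>y::real. \<bar>y\<bar> powr p / y) \<longlongrightarrow> 0) (at 0)" by (rule tendsto_rabs_zero_cancel)
    then show ?thesis using 3 p by (simp add: has_field_derivative_iff)
  qed
qed

section \<open>Convolution with a bounded decaying kernel\<close>

lemma infsum_abs_le_infsum_abs:
  fixes f :: "'i \<Rightarrow> real"
  assumes "f summable_on A"
  shows "\<bar>infsum f A\<bar> \<le> (\<Sum>\<^sub>\<infinity>x\<in>A. \<bar>f x\<bar>)"
  using norm_infsum_bound[of f A] summable_on_abs_real[OF assms] by simp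

lemma summable_on_mult_bounded:
  fixes f g :: "'i \<Rightarrow> real"
  assumes "f summable_on A" "\<And>x. \<bar>g x\<bar> \<le> C"
  shows "(\<lambda>x. g x * f x) summable_on A"
proof (rule summable_on_real_bound)
  show "(\<lambda>x. C * \<bar>f x\<bar>) summable_on A"
    by (intro summable_on_cmult_right summable_on_abs_real assms)
  show "\<bar>g x * f x\<bar> \<le> C * \<bar>f x\<bar>" for x
    unfolding abs_mult by (intro mult_right_mono assms) auto
qed

lemma infsum_mult_bounded:
  fixes f g :: "'i \<Rightarrow> real"
  assumes f: "f summable_on A" and g: "\<And>x. x \<in> A \<Longrightarrow> \<bar>g x\<bar> \<le> C" "\<And>x. \<bar>g x\<bar> \<le> C'"
  shows "(\<Sum>\<^sub>\<infinity>x\<in>A. \<bar>g x * f x\<bar>) \<le> C * (\<Sum>\<^sub>\<infinity>x\<in>A. \<bar>f x\<bar>)"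
proof -
  have "(\<Sum>\<^sub>\<infinity>x\<in>A. \<bar>g x * f x\<bar>) \<le> (\<Sum>\<^sub>\<infinity>x\<in>A. C * \<bar>f x\<bar>)"
  proof (rule infsum_mono)
    show "(\<lambda>x. \<bar>g x * f x\<bar>) summable_on A"
      by (intro summable_on_abs_real summable_on_mult_bounded[OF f, OF g(2)])
    show "(\<lambda>x. C * \<bar>f x\<bar>) summable_on A"
      by (intro summable_on_cmult_right summable_on_abs_real f)
    show "\<bar>g x * f x\<bar> \<le> C * \<bar>f x\<bar>" if "x \<in> A" for x
      unfolding abs_mult by (intro mult_right_mono g that) auto
  qed
  then show ?thesis by (simp add: infsum_cmult_right')
qed

abbreviation l1norm :: "('i \<Rightarrow> real) \<Rightarrow> real" where
  "l1norm f \<equiv> \<Sum>\<^sub>\<infinity>x. \<bar>f x\<bar>"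

text \<open>Boundedness makes the double sum continuous on summable functions, evenness makes it
  symmetric, and decay makes it weakly continuous in one argument.\<close>

locale bounded_kernel =
  fixes r :: "'a::ab_group_add \<Rightarrow> real" and C :: real
  assumes bound: "\<bar>r z\<bar> \<le> C"
    and even: "r (- z) = r z"
    and decay: "(r \<longlongrightarrow> 0) cofinite"
begin

definition cv :: "('a \<Rightarrow> real) \<Rightarrow> 'a \<Rightarrow> real" where
  "cv f x = (\<Sum>\<^sub>\<infinity>y. r (x - y) * f y)"

text \<open>Kept bilinear so that perturbations of the density can be expanded into cross
  terms.\<close>

definition DD :: "('a \<Rightarrow> real) \<Rightarrow> ('a \<Rightarrow> real) \<Rightarrow> real" where
  "DD f g = (\<Sum>\<^sub>\<infinity>x. cv f x * g x)"

lemma C_nonneg: "0 \<le> C"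
  using bound[of 0] by linarith

lemma cv_summable: "f summable_on UNIV \<Longrightarrow> (\<lambda>y. r (x - y) * f y) summable_on UNIV"
  by (rule summable_on_mult_bounded[OF _ bound])

lemma cv_bound:
  assumes "f summable_on UNIV"
  shows "\<bar>cv f x\<bar> \<le> C * l1norm f"
  unfolding cv_def
  using infsum_abs_le_infsum_abs[OF cv_summable[OF assms]]
     infsum_mult_bounded[OF assms bound bound, of "\<lambda>y. x - y"]
  by (rule order_trans)

lemma cv_add:
  "f summable_on UNIV \<Longrightarrow> g summable_on UNIV \<Longrightarrow> cv (\<lambda>x. f x + g x) x = cv f x + cv g x"
  unfolding cv_def by (simp add: distrib_left infsum_add cv_summable)

lemma cv_scale: "cv (\<lambda>x. c * f x) x = c * cv f x"
  unfolding cv_def by (subst infsum_cmult_right'[symmetric]) (simp add: mult_ac)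

text \<open>Over a finite set carrying nearly all of the mass of f, the sum is a finite combination
  of translates of the decaying kernel; the rest contributes at most \<open>C\<close> times the
  remaining mass.\<close>

lemma cv_tendsto_0:
  assumes f: "f summable_on UNIV"
  shows "(cv f \<longlongrightarrow> 0) cofinite"
proof (rule tendstoI)
  fix e :: real assume e: "0 < e"
  \<comment> \<open>Chosen so that \<open>C\<close> times \<eta> is at most e/2; the added 1 covers
    the case in which \<open>C\<close> is 0.\<close>
  define \<eta> where "\<eta> = e / (2 * (C + 1))"
  have \<eta>: "0 < \<eta>" using e C_nonneg by (simp add: \<eta>_def)
  have C\<eta>: "C * \<eta> \<le> e/2" using e C_nonneg by (simp add: \<eta>_def field_simps)
  obtain F where F: "finite F" "(\<Sum>\<^sub>\<infinity>x\<in>-F. \<bar>f x\<bar>) \<le> \<eta>"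
    using infsum_tail_small[OF summable_on_abs_real[OF f] _ \<eta>] by auto
  have "((\<lambda>x. \<Sum>y\<in>F. r (x - y) * f y) \<longlongrightarrow> (\<Sum>y\<in>F. 0 * f y)) cofinite"
    by (intro tendsto_intros filterlim_compose[OF decay] filterlim_diff_cofinite)
  then have "eventually (\<lambda>x. dist (\<Sum>y\<in>F. r (x - y) * f y) 0 < e/2) cofinite"
    using e by (intro tendstoD) auto
  then show "eventually (\<lambda>x. dist (cv f x) 0 < e) cofinite"
  proof eventually_elim
    case (elim x)
    have fm: "f summable_on -F" using f by (rule summable_on_subset_banach) auto
    have "\<bar>\<Sum>\<^sub>\<infinity>y\<in>-F. r (x - y) * f y\<bar> \<le> (\<Sum>\<^sub>\<infinity>y\<in>-F. \<bar>r (x - y) * f y\<bar>)"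
      by (intro infsum_abs_le_infsum_abs summable_on_mult_bounded[OF fm, OF bound])
    also have "\<dots> \<le> C * (\<Sum>\<^sub>\<infinity>y\<in>-F. \<bar>f y\<bar>)"
      by (rule infsum_mult_bounded[OF fm bound bound])
    also have "\<dots> \<le> C * \<eta>" using F(2) C_nonneg by (intro mult_left_mono)
    also note C\<eta>
    finally have "\<bar>\<Sum>\<^sub>\<infinity>y\<in>-F. r (x - y) * f y\<bar> \<le> e/2" .
    moreover have "cv f x = (\<Sum>y\<in>F. r (x - y) * f y) + (\<Sum>\<^sub>\<infinity>y\<in>-F. r (x - y) * f y)"
      unfolding cv_def by (rule infsum_split_finite[OF cv_summable[OF f] F(1)])
    ultimately show ?case using elim by (simp add: dist_real_def)
  qed
qed

lemma DD_summable:
  "f summable_on UNIV \<Longrightarrow> g summable_on UNIV \<Longrightarrow> (\<lambda>x. cv f x * g x) summable_on UNIV"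
  by (rule summable_on_mult_bounded[OF _ cv_bound])

lemma DD_bound:
  assumes "f summable_on UNIV" "g summable_on UNIV"
  shows "\<bar>DD f g\<bar> \<le> C * l1norm f * l1norm g"
  unfolding DD_def
  using infsum_abs_le_infsum_abs[OF DD_summable[OF assms]]
     infsum_mult_bounded[OF assms(2) cv_bound cv_bound, OF assms(1) assms(1)]
  by (rule order_trans)

lemma DD_add_left:
  "f summable_on UNIV \<Longrightarrow> g summable_on UNIV \<Longrightarrow> h summable_on UNIV \<Longrightarrow>
    DD (\<lambda>x. f x + g x) h = DD f h + DD g h"
  unfolding DD_def by (simp add: cv_add distrib_right infsum_add DD_summable)

lemma DD_add_right:
  "f summable_on UNIV \<Longrightarrow> g summable_on UNIV \<Longrightarrow> h summable_on UNIV \<Longrightarrow>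
    DD h (\<lambda>x. f x + g x) = DD h f + DD h g"
  unfolding DD_def by (simp add: distrib_left infsum_add DD_summable)

lemma DD_scale: "DD (\<lambda>x. c * f x) (\<lambda>x. d * g x) = c * d * DD f g"
  unfolding DD_def by (subst infsum_cmult_right'[symmetric]) (simp add: cv_scale mult_ac)

text \<open>The product of |f| and |g|, multiplied by \<open>C\<close>, is summable over pairs and
  dominates the double sum, so the order of summation may be exchanged; evenness of the kernel then
  exchanges the roles of x and y.\<close>

lemma DD_commute:
  assumes f: "f summable_on UNIV" and g: "g summable_on UNIV"
  shows "DD f g = DD g f"
proof -
  let ?k = "\<lambda>x y. r (x - y) * f y * g x"
  have "(\<lambda>z. norm (case z of (x, y) \<Rightarrow> C * (\<bar>g x\<bar> * \<bar>f y\<bar>))) summable_on (UNIV \<times> UNIV)"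
    unfolding Infinite_Sum.abs_summable_on_Sigma_iff
    using summable_on_abs_real[OF f] summable_on_abs_real[OF g] C_nonneg
    by (auto simp: abs_mult infsum_cmult_right' infsum_cmult_left' infsum_nonneg mult_ac
          intro!: summable_on_cmult_right summable_on_cmult_left)
  then have "(\<lambda>(x, y). C * (\<bar>g x\<bar> * \<bar>f y\<bar>)) summable_on (UNIV \<times> UNIV)"
    by (rule abs_summable_summable)
  then have S: "(\<lambda>(x, y). ?k x y) summable_on (UNIV \<times> UNIV)"
  proof (rule summable_on_real_bound, clarsimp)
    fix x y
    show "\<bar>r (x - y) * f y * g x\<bar> \<le> C * (\<bar>g x\<bar> * \<bar>f y\<bar>)"
      using mult_right_mono[OF bound[of "x - y"], of "\<bar>f y\<bar> * \<bar>g x\<bar>"]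
      by (simp add: abs_mult mult_ac)
  qed
  have "DD f g = (\<Sum>\<^sub>\<infinity>x. \<Sum>\<^sub>\<infinity>y. ?k x y)"
    unfolding DD_def cv_def by (simp add: infsum_cmult_left')
  also have "\<dots> = (\<Sum>\<^sub>\<infinity>y. \<Sum>\<^sub>\<infinity>x. ?k x y)"
    by (rule infsum_swap_banach[OF S])
  also have "\<dots> = (\<Sum>\<^sub>\<infinity>y. cv g y * f y)"
  proof (rule infsum_cong)
    fix y
    have "?k x y = r (y - x) * g x * f y" for x
      using even[of "x - y"] by (simp add: mult_ac)
    then show "(\<Sum>\<^sub>\<infinity>x. ?k x y) = cv g y * f y"
      unfolding cv_def by (simp only: infsum_cmult_left')
  qed
  finally show ?thesis by (simp add: DD_def)
qed

lemma cv_shift: "cv (\<lambda>x. f (x + c)) x = cv f (x + c)"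
  unfolding cv_def using infsum_shift[of "\<lambda>y. r (x + c - y) * f y" c]
  by (simp add: algebra_simps)

lemma DD_shift: "DD (\<lambda>x. f (x + c)) (\<lambda>x. g (x + c)) = DD f g"
  unfolding DD_def cv_shift by (rule infsum_shift)

text \<open>The \<open>g n\<close> may lose mass at infinity, so the small tail has to come from the
  potential: \<open>cv f\<close> is below \<eta> off a finite set, while the masses of the
  \<open>g n\<close> stay bounded.\<close>

lemma DD_weak_tendsto_0:
  fixes g :: "nat \<Rightarrow> 'a \<Rightarrow> real"
  assumes f: "f summable_on UNIV" and g: "\<And>n. g n summable_on UNIV"
    and bd: "\<And>n. l1norm (g n) \<le> M" and pt: "\<And>x. (\<lambda>n. g n x) \<longlonglongrightarrow> 0"
  shows "(\<lambda>n. DD f (g n)) \<longlonglongrightarrow> 0"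
proof (rule tendsto_rabs_zero_cancel, rule tendsto_sandwich[of "\<lambda>_. 0"])
  have M: "0 \<le> M" using order_trans[OF infsum_nonneg bd[of 0]] by simp
  show "(\<lambda>n. \<Sum>\<^sub>\<infinity>x. \<bar>cv f x * g n x\<bar>) \<longlonglongrightarrow> 0"
  proof (rule infsum_tendsto_0_tight)
    show "(\<lambda>n. \<bar>cv f x * g n x\<bar>) \<longlonglongrightarrow> 0" for x
      by (intro tendsto_rabs_zero tendsto_mult_right_zero pt)
    fix e :: real assume e: "0 < e"
    define \<eta> where "\<eta> = e / (M + 1)"
    have \<eta>: "0 < \<eta>" using e M by (simp add: \<eta>_def)
    have M\<eta>: "\<eta> * M \<le> e" using e M by (simp add: \<eta>_def field_simps)
    define F where "F = {x. \<not> dist (cv f x) 0 < \<eta>}"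
    have "finite F"
      using tendstoD[OF cv_tendsto_0[OF f] \<eta>] by (simp add: eventually_cofinite F_def)
    moreover have "(\<Sum>\<^sub>\<infinity>x\<in>-F. \<bar>cv f x * g n x\<bar>) \<le> e" for n
    proof -
      have gm: "g n summable_on -F" using g by (rule summable_on_subset_banach) auto
      have "(\<Sum>\<^sub>\<infinity>x\<in>-F. \<bar>cv f x * g n x\<bar>) \<le> \<eta> * (\<Sum>\<^sub>\<infinity>x\<in>-F. \<bar>g n x\<bar>)"
        by (rule infsum_mult_bounded[OF gm _ cv_bound[OF f]]) (auto simp: F_def)
      also have "\<dots> \<le> \<eta> * l1norm (g n)"
        using \<eta> by (intro mult_left_mono infsum_le_infsum_UNIV summable_on_abs_real g) auto
      also have "\<dots> \<le> \<eta> * M" using bd \<eta> by (intro mult_left_mono) auto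
      finally show ?thesis using M\<eta> by linarith
    qed
    ultimately show "\<exists>F. finite F \<and> (\<forall>n. (\<Sum>\<^sub>\<infinity>x\<in>-F. \<bar>cv f x * g n x\<bar>) \<le> e)" by blast
  qed (use summable_on_abs_real[OF DD_summable[OF f g]] in auto)
  show "\<forall>\<^sub>F n in sequentially. \<bar>DD f (g n)\<bar> \<le> (\<Sum>\<^sub>\<infinity>x. \<bar>cv f x * g n x\<bar>)"
    unfolding DD_def
    by (intro always_eventually allI infsum_abs_le_infsum_abs DD_summable f g)
qed auto

text \<open>The error \<open>s n\<close> tends to 0 in norm, so its cross terms vanish by
  \<open>DD_bound\<close>. The one genuine interaction, between f and \<open>g n\<close>, vanishes
  by weak convergence.\<close>

lemma DD_splitting:
  fixes g s :: "nat \<Rightarrow> 'a \<Rightarrow> real"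
  assumes f: "f summable_on UNIV" and g: "\<And>n. g n summable_on UNIV" and s: "\<And>n. s n summable_on UNIV"
    and bd: "\<And>n. l1norm (g n) \<le> M" and pt: "\<And>x. (\<lambda>n. g n x) \<longlonglongrightarrow> 0"
    and s0: "(\<lambda>n. l1norm (s n)) \<longlonglongrightarrow> 0"
  shows "(\<lambda>n. DD (\<lambda>x. f x + g n x + s n x) (\<lambda>x. f x + g n x + s n x) - DD f f - DD (g n) (g n)) \<longlonglongrightarrow> 0"
proof -
  have fg: "(\<lambda>x. f x + g n x) summable_on UNIV" for n by (intro summable_on_add f g)
  have eq: "DD (\<lambda>x. f x + g n x + s n x) (\<lambda>x. f x + g n x + s n x) - DD f f - DD (g n) (g n)
     = 2 * DD f (g n) + 2 * DD f (s n) + 2 * DD (g n) (s n) + DD (s n) (s n)" for n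
    using DD_commute[OF f g[of n]] DD_commute[OF f s[of n]] DD_commute[OF g[of n] s[of n]]
    by (simp add: DD_add_left DD_add_right f g s fg summable_on_add)
  have fs: "(\<lambda>n. DD f (s n)) \<longlonglongrightarrow> 0"
  proof (rule Lim_null_comparison)
    show "(\<lambda>n. C * l1norm f * l1norm (s n)) \<longlonglongrightarrow> 0" by (rule tendsto_mult_right_zero[OF s0])
  qed (use DD_bound[OF f s] in auto)
  have gs: "(\<lambda>n. DD (g n) (s n)) \<longlonglongrightarrow> 0"
  proof (rule Lim_null_comparison)
    show "(\<lambda>n. C * M * l1norm (s n)) \<longlonglongrightarrow> 0" by (rule tendsto_mult_right_zero[OF s0])
    have "\<bar>DD (g n) (s n)\<bar> \<le> C * M * l1norm (s n)" for n
      using DD_bound[OF g[of n] s[of n]] mult_right_mono[OF mult_left_mono[OF bd[of n] C_nonneg], of "l1norm (s n)"]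
      by (simp add: infsum_nonneg)
    then show "\<forall>\<^sub>F n in sequentially. norm (DD (g n) (s n)) \<le> C * M * l1norm (s n)" by simp
  qed
  have ss: "(\<lambda>n. DD (s n) (s n)) \<longlonglongrightarrow> 0"
  proof (rule Lim_null_comparison)
    have "(\<lambda>n. C * l1norm (s n) * l1norm (s n)) \<longlonglongrightarrow> C * 0 * 0" by (intro tendsto_intros s0)
    then show "(\<lambda>n. C * l1norm (s n) * l1norm (s n)) \<longlonglongrightarrow> 0" by simp
  qed (use DD_bound[OF s s] in auto)
  have "(\<lambda>n. 2 * DD f (g n) + 2 * DD f (s n) + 2 * DD (g n) (s n) + DD (s n) (s n))
      \<longlonglongrightarrow> 2 * 0 + 2 * 0 + 2 * 0 + 0"
    by (intro tendsto_intros DD_weak_tendsto_0[OF f g bd pt] fs gs ss)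
  then show ?thesis by (simp add: eq)
qed

end

text \<open>Factoring the power p as p - 2 and 2 moves p - 2 powers to the sup norm. The
  quantitative form shows that a function with small sup norm has little Choquard mass compared with
  its square sum.\<close>

lemma l2_powr_summable:
  assumes u: "u \<in> l2" and p: "2 \<le> p"
  shows "(\<lambda>x. \<bar>u x\<bar> powr p) summable_on UNIV"
    and "(\<And>x. \<bar>u x\<bar> \<le> m) \<Longrightarrow> (\<Sum>\<^sub>\<infinity>x. \<bar>u x\<bar> powr p) \<le> m powr (p - 2) * ip u u"
proof -
  have b: "\<bar>u x\<bar> powr p \<le> m powr (p - 2) * (u x * u x)" if "\<And>x. \<bar>u x\<bar> \<le> m" for m x
  proof (cases "u x = 0")
    case False
    then have "\<bar>u x\<bar> powr p = \<bar>u x\<bar> powr (p - 2) * \<bar>u x\<bar> powr 2"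
      using powr_add[of "\<bar>u x\<bar>" "p - 2" 2] by simp
    also have "\<bar>u x\<bar> powr 2 = u x * u x" using False by (simp add: powr_numeral power2_eq_square)
    also have "\<bar>u x\<bar> powr (p - 2) * (u x * u x) \<le> m powr (p - 2) * (u x * u x)"
      using p that by (intro mult_right_mono powr_mono2) auto
    finally show ?thesis .
  qed simp
  have s: "(\<lambda>x. m * (u x * u x)) summable_on UNIV" for m
    by (intro summable_on_cmult_right l2_mult_summable u)
  have "\<bar>u x\<bar> \<le> sqrt (ip u u)" for x
    using power2_le_ip_self[OF u, of x] real_le_rsqrt[of "\<bar>u x\<bar>" "ip u u"] by simp
  from b[OF this] show *: "(\<lambda>x. \<bar>u x\<bar> powr p) summable_on UNIV"
    by (intro summable_on_real_bound[OF s[of "sqrt (ip u u) powr (p - 2)"]]) auto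
  assume "\<And>x. \<bar>u x\<bar> \<le> m"
  from infsum_mono[OF * s[of "m powr (p - 2)"] b[OF this]]
  show "(\<Sum>\<^sub>\<infinity>x. \<bar>u x\<bar> powr p) \<le> m powr (p - 2) * ip u u"
    by (simp add: ip_def infsum_cmult_right')
qed

text \<open>The pointwise defect is at most a constant times
  \<open>(u x)\<^sup>2 + \<bar>u x * v n x\<bar>\<close>. Both summands contain the fixed function
  \<open>u\<close>, so their tails are small uniformly in n.\<close>

lemma Brezis_Lieb_l1:
  fixes v :: "nat \<Rightarrow> 'i \<Rightarrow> real"
  assumes p: "2 < p" and u: "u \<in> l2" and v: "\<And>n. v n \<in> l2" and bd: "\<And>n. ip (v n) (v n) \<le> M"
    and pt: "\<And>x. (\<lambda>n. v n x) \<longlonglongrightarrow> 0"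
  shows "(\<lambda>n. \<Sum>\<^sub>\<infinity>x. \<bar>\<bar>u x + v n x\<bar> powr p - \<bar>v n x\<bar> powr p - \<bar>u x\<bar> powr p\<bar>) \<longlonglongrightarrow> 0"
proof (rule infsum_tendsto_0_tight)
  define m where "m = sqrt (ip u u) + sqrt M"
  define K where "K = (p + 1) * m powr (p - 2)"
  have K: "0 \<le> K" using p by (simp add: K_def)
  have m: "\<bar>u x\<bar> + \<bar>v n x\<bar> \<le> m" for n x
    unfolding m_def using power2_le_ip_self[OF u, of x] power2_le_ip_self[OF v, of n x] bd[of n]
    by (intro add_mono real_le_rsqrt) auto
  have b: "\<bar>\<bar>u x + v n x\<bar> powr p - \<bar>v n x\<bar> powr p - \<bar>u x\<bar> powr p\<bar> \<le> K * ((u x)\<^sup>2 + \<bar>u x * v n x\<bar>)" for n x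
    unfolding K_def using abs_powr_add_diff_le[OF _ m[of x n], of p] p by simp
  have su: "(\<lambda>x. (u x)\<^sup>2) summable_on UNIV" using u by (simp add: l2_def)
  have sb: "(\<lambda>x. (u x)\<^sup>2 + \<bar>u x * v n x\<bar>) summable_on UNIV" for n
    by (intro summable_on_add su l2_abs_mult_summable u v)
  show sm: "(\<lambda>x. \<bar>\<bar>u x + v n x\<bar> powr p - \<bar>v n x\<bar> powr p - \<bar>u x\<bar> powr p\<bar>) summable_on UNIV" for n
    by (rule summable_on_real_bound[OF summable_on_cmult_right[OF sb, of K]]) (use b in auto)
  show "(\<lambda>n. \<bar>\<bar>u x + v n x\<bar> powr p - \<bar>v n x\<bar> powr p - \<bar>u x\<bar> powr p\<bar>) \<longlonglongrightarrow> 0" for x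
  proof -
    have "(\<lambda>n. \<bar>\<bar>u x + v n x\<bar> powr p - \<bar>v n x\<bar> powr p - \<bar>u x\<bar> powr p\<bar>)
       \<longlonglongrightarrow> \<bar>\<bar>u x + 0\<bar> powr p - \<bar>0\<bar> powr p - \<bar>u x\<bar> powr p\<bar>"
      using p by (intro tendsto_rabs tendsto_diff tendsto_powr' tendsto_add pt tendsto_const) auto
    then show ?thesis by simp
  qed
  fix e :: real assume e: "0 < e"
  define d where "d = e / (2 * (K + 1))"
  have d: "0 < d" using e K by (simp add: d_def)
  have "d + d = e / (K + 1)" by (simp add: d_def divide_simps)
  then have "(K + 1) * (d + d) = e" using K by simp
  moreover have "K * (d + d) \<le> (K + 1) * (d + d)" using d by (intro mult_right_mono) auto
  ultimately have Kd: "K * (d + d) \<le> e" by linarith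
  obtain F1 where F1: "finite F1" "(\<Sum>\<^sub>\<infinity>x\<in>-F1. (u x)\<^sup>2) \<le> d"
    using infsum_tail_small[OF su _ d] by auto
  obtain F2 where F2: "finite F2" "\<And>n. (\<Sum>\<^sub>\<infinity>x\<in>-F2. \<bar>u x * v n x\<bar>) \<le> d"
    using l2_product_tight[of u v, OF u v bd d] by auto
  let ?F = "F1 \<union> F2"
  have "(\<Sum>\<^sub>\<infinity>x\<in>-?F. \<bar>\<bar>u x + v n x\<bar> powr p - \<bar>v n x\<bar> powr p - \<bar>u x\<bar> powr p\<bar>) \<le> e" for n
  proof -
    have sub: "f summable_on UNIV \<Longrightarrow> f summable_on A" for f :: "'i \<Rightarrow> real" and A
      by (rule summable_on_subset_banach) auto
    have "(\<Sum>\<^sub>\<infinity>x\<in>-?F. \<bar>\<bar>u x + v n x\<bar> powr p - \<bar>v n x\<bar> powr p - \<bar>u x\<bar> powr p\<bar>)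
       \<le> (\<Sum>\<^sub>\<infinity>x\<in>-?F. K * ((u x)\<^sup>2 + \<bar>u x * v n x\<bar>))"
      by (intro infsum_mono sub[OF sm] sub[OF summable_on_cmult_right] sb b)
    also have "\<dots> = K * ((\<Sum>\<^sub>\<infinity>x\<in>-?F. (u x)\<^sup>2) + (\<Sum>\<^sub>\<infinity>x\<in>-?F. \<bar>u x * v n x\<bar>))"
      unfolding infsum_cmult_right'
      by (subst infsum_add[OF sub[OF su] sub[OF l2_abs_mult_summable[OF u v]]]) (rule refl)
    also have "\<dots> \<le> K * ((\<Sum>\<^sub>\<infinity>x\<in>-F1. (u x)\<^sup>2) + (\<Sum>\<^sub>\<infinity>x\<in>-F2. \<bar>u x * v n x\<bar>))"
      by (intro mult_left_mono add_mono infsum_mono2 sub[OF su] sub[OF l2_abs_mult_summable] u v K) auto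
    also have "\<dots> \<le> K * (d + d)"
      using F1(2) F2(2)[of n] K by (intro mult_left_mono add_mono) auto
    finally show ?thesis using Kd by linarith
  qed
  then show "\<exists>F. finite F \<and> (\<forall>n. (\<Sum>\<^sub>\<infinity>x\<in>-F. \<bar>\<bar>u x + v n x\<bar> powr p - \<bar>v n x\<bar> powr p - \<bar>u x\<bar> powr p\<bar>) \<le> e)"
    using F1(1) F2(1) by (intro exI[of _ ?F]) auto
qed auto

section \<open>The variational setting\<close>

lemma
  fixes f :: "'j \<Rightarrow> 'i \<Rightarrow> real"
  assumes "finite J" "\<And>j. j \<in> J \<Longrightarrow> f j summable_on A"
  shows summable_on_finite_sum: "(\<lambda>x. \<Sum>j\<in>J. f j x) summable_on A"
    and infsum_finite_sum: "(\<Sum>\<^sub>\<infinity>x\<in>A. \<Sum>j\<in>J. f j x) = (\<Sum>j\<in>J. infsum (f j) A)"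
proof -
  have "(\<lambda>x. \<Sum>j\<in>J. f j x) summable_on A \<and> (\<Sum>\<^sub>\<infinity>x\<in>A. \<Sum>j\<in>J. f j x) = (\<Sum>j\<in>J. infsum (f j) A)"
    using assms by (induction J) (auto simp: infsum_add summable_on_add)
  then show "(\<lambda>x. \<Sum>j\<in>J. f j x) summable_on A"
    "(\<Sum>\<^sub>\<infinity>x\<in>A. \<Sum>j\<in>J. f j x) = (\<Sum>j\<in>J. infsum (f j) A)" by auto
qed

text \<open>Forward differences orient each edge once, which turns the gradient form into three
  \<open>l2\<close> inner products.\<close>

definition fdiff :: "3 \<Rightarrow> (int^3 \<Rightarrow> real) \<Rightarrow> int^3 \<Rightarrow> real" where
  "fdiff j u x = u (x + axis j 1) - u x"

text \<open>Since \<open>nbrs x\<close> is a set, the six neighbours have to be seen to be distinct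
  before the sum splits by direction.\<close>

lemma sum_nbrs: "(\<Sum>y\<in>nbrs x. g y) = (\<Sum>j\<in>UNIV. g (x + axis j 1) + g (x - axis j 1))"
proof -
  have "x + axis i 1 \<noteq> x - axis j 1" for i j :: 3
  proof
    assume "x + axis i 1 = x - axis j (1::int)"
    then have "(x + axis i 1) $ i = (x - axis j 1) $ i" by (rule arg_cong)
    then show False by (auto simp: axis_def split: if_splits)
  qed
  then have "(\<lambda>j. x + axis j 1) ` UNIV \<inter> (\<lambda>j. x - axis j (1::int)) ` UNIV = {}" by blast
  moreover have "nbrs x = (\<lambda>j. x + axis j 1) ` UNIV \<union> (\<lambda>j. x - axis j 1) ` UNIV"
    unfolding nbrs_def by blast
  moreover have "inj (\<lambda>j::3. x + axis j 1)" "inj (\<lambda>j::3. x - axis j 1)"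
    by (auto simp: inj_on_def axis_eq_axis)
  ultimately show ?thesis
    by (simp add: sum.union_disjoint sum.reindex sum.distrib)
qed

lemma half_sum_nbrs:
  "(1/2) * (\<Sum>y\<in>nbrs x. (u y - u x) * (v y - v x))
    = (\<Sum>j\<in>UNIV. 1/2 * (fdiff j u x * fdiff j v x) + 1/2 * (fdiff j u (x - axis j 1) * fdiff j v (x - axis j 1)))"
  unfolding sum_nbrs fdiff_def by (simp add: sum_distrib_left algebra_simps)

lemma grad_sq_eq: "grad_sq u x = (1/2) * (\<Sum>y\<in>nbrs x. (u y - u x) * (u y - u x))"
  unfolding grad_sq_def power2_eq_square ..

lemma fdiff_l2: "u \<in> l2 \<Longrightarrow> fdiff j u \<in> l2"
  unfolding fdiff_def [abs_def] by (intro l2_diff) (simp_all add: l2_shift)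

text \<open>Each edge is counted from both endpoints with weight 1/2. The backward half is a
  translate of the forward half and thus has the same sum.\<close>

lemma
  assumes u: "u \<in> l2" and v: "v \<in> l2"
  shows grad_inner_summable: "(\<lambda>x. (1/2) * (\<Sum>y\<in>nbrs x. (u y - u x) * (v y - v x))) summable_on UNIV"
    and grad_inner_eq: "grad_inner u v = (\<Sum>j\<in>UNIV. ip (fdiff j u) (fdiff j v))"
proof -
  have s: "(\<lambda>x. fdiff j u x * fdiff j v x) summable_on UNIV" for j
    by (intro l2_mult_summable fdiff_l2 u v)
  have s': "(\<lambda>x. fdiff j u (x - axis j 1) * fdiff j v (x - axis j 1)) summable_on UNIV" for j
    using summable_on_shift[of "\<lambda>x. fdiff j u x * fdiff j v x" "- axis j 1"] s by simp
  have e': "(\<Sum>\<^sub>\<infinity>x. fdiff j u (x - axis j 1) * fdiff j v (x - axis j 1)) = ip (fdiff j u) (fdiff j v)" for j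
    unfolding ip_def using infsum_shift[of "\<lambda>x. fdiff j u x * fdiff j v x" "- axis j 1"] by simp
  have s2: "(\<lambda>x. 1/2 * (fdiff j u x * fdiff j v x) + 1/2 * (fdiff j u (x - axis j 1) * fdiff j v (x - axis j 1))) summable_on UNIV" for j
    by (intro summable_on_add summable_on_cmult_right s s')
  have e2: "(\<Sum>\<^sub>\<infinity>x. 1/2 * (fdiff j u x * fdiff j v x) + 1/2 * (fdiff j u (x - axis j 1) * fdiff j v (x - axis j 1))) = ip (fdiff j u) (fdiff j v)" for j
    by (subst infsum_add) (auto intro: s s' summable_on_cmult_right simp only: infsum_cmult_right' e' ip_def[symmetric])
  show "(\<lambda>x. (1/2) * (\<Sum>y\<in>nbrs x. (u y - u x) * (v y - v x))) summable_on UNIV"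
    unfolding half_sum_nbrs by (intro summable_on_finite_sum s2) simp
  show "grad_inner u v = (\<Sum>j\<in>UNIV. ip (fdiff j u) (fdiff j v))"
    unfolding grad_inner_def half_sum_nbrs by (subst infsum_finite_sum) (simp_all only: s2 e2 finite)
qed

lemma
  assumes "u \<in> l2"
  shows grad_sq_summable: "grad_sq u summable_on UNIV"
    and infsum_grad_sq: "infsum (grad_sq u) UNIV = grad_inner u u"
  using grad_inner_summable[OF assms assms] grad_sq_eq[of u]
  by (auto simp: grad_inner_def grad_sq_eq[abs_def])

lemma grad_inner_add_scale:
  assumes "u \<in> l2" "v \<in> l2"
  shows "grad_inner (\<lambda>x. u x + t * v x) (\<lambda>x. u x + t * v x)
    = grad_inner u u + 2 * t * grad_inner u v + t\<^sup>2 * grad_inner v v"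
proof -
  have "fdiff j (\<lambda>x. u x + t * v x) = (\<lambda>x. fdiff j u x + t * fdiff j v x)" for j
    by (auto simp: fdiff_def algebra_simps)
  then show ?thesis
    using assms by (simp add: grad_inner_eq l2_add l2_scale ip_add_scale_self fdiff_l2 sum.distrib sum_distrib_left)
qed

lemma grad_inner_scale: "u \<in> l2 \<Longrightarrow> grad_inner (\<lambda>x. c * u x) (\<lambda>x. c * u x) = c\<^sup>2 * grad_inner u u"
proof -
  assume "u \<in> l2"
  moreover have "fdiff j (\<lambda>x. c * u x) = (\<lambda>x. c * fdiff j u x)" for j
    by (auto simp: fdiff_def algebra_simps)
  ultimately show ?thesis
    by (simp add: grad_inner_eq l2_scale ip_scale_left ip_scale_right sum_distrib_left power2_eq_square mult_ac)
qed

lemma grad_inner_nonneg: "u \<in> l2 \<Longrightarrow> 0 \<le> grad_inner u u"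
  by (simp add: grad_inner_eq sum_nonneg ip_nonneg)

lemma grad_inner_shift: 
  assumes "u \<in> l2" 
  shows "grad_inner (\<lambda>x. u (x + c)) (\<lambda>x. u (x + c)) = grad_inner u u"
proof -
  have "fdiff j (\<lambda>x. u (x + c)) = (\<lambda>x. fdiff j u (x + c))" for j
    by (auto simp: fdiff_def algebra_simps)
  then show ?thesis using assms by (simp add: grad_inner_eq l2_shift ip_shift)
qed

lemma ip_fdiff_self_le:
  assumes "v \<in> l2"
  shows "ip (fdiff j v) (fdiff j v) \<le> grad_inner v v"
  unfolding grad_inner_eq[OF assms assms] by (rule member_le_sum) (auto simp: ip_nonneg)

lemma grad_inner_weak_tendsto_0:
  assumes u: "u \<in> l2" and v: "\<And>n. v n \<in> l2" and bd: "\<And>n. grad_inner (v n) (v n) \<le> M"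
    and pt: "\<And>x. (\<lambda>n. v n x) \<longlonglongrightarrow> 0"
  shows "(\<lambda>n. grad_inner u (v n)) \<longlonglongrightarrow> 0"
proof -
  have "(\<lambda>n. ip (fdiff j u) (fdiff j (v n))) \<longlonglongrightarrow> 0" for j
  proof (rule ip_weak_tendsto_0)
    show "ip (fdiff j (v n)) (fdiff j (v n)) \<le> M" for n
      using ip_fdiff_self_le[OF v, of j n] bd[of n] by linarith
    have "(\<lambda>n. v n (x + axis j 1) - v n x) \<longlonglongrightarrow> 0 - 0" for x
      by (intro tendsto_diff pt)
    then show "(\<lambda>n. fdiff j (v n) x) \<longlonglongrightarrow> 0" for x by (simp add: fdiff_def)
  qed (use u v fdiff_l2 in auto)
  then have "(\<lambda>n. \<Sum>j\<in>UNIV. ip (fdiff j u) (fdiff j (v n))) \<longlonglongrightarrow> (\<Sum>j\<in>(UNIV::3 set). 0)"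
    by (intro tendsto_sum) auto
  then show ?thesis using u v by (simp add: grad_inner_eq)
qed

text \<open>Translation invariance of \<open>ip\<close> moves the difference from \<open>v\<close>
  to \<open>u\<close>. This turns the gradient part of the derivative into summation against a
  function on the lattice.\<close>

lemma grad_inner_by_parts:
  assumes u: "u \<in> l2" and v: "v \<in> l2"
  shows "(\<lambda>x. - lap u x) \<in> l2" "grad_inner u v = ip (\<lambda>x. - lap u x) v"
proof -
  let ?b = "\<lambda>j x. fdiff j u (x - axis j 1)"
  have lap: "- lap u x = (\<Sum>j\<in>UNIV. ?b j x - fdiff j u x)" for x
    unfolding lap_def sum_nbrs fdiff_def by (simp add: sum_negf[symmetric] algebra_simps)
  have bl: "?b j \<in> l2" for j
    using l2_shift[of "fdiff j u" "- axis j 1"] fdiff_l2[OF u] by simp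
  have dl: "(\<lambda>x. ?b j x - fdiff j u x) \<in> l2" for j
    by (intro l2_diff bl fdiff_l2 u)
  have "(\<lambda>x. \<Sum>j\<in>J. ?b j x - fdiff j u x) \<in> l2" if "finite J" for J
    using that
  proof (induction J)
    case (insert i J)
    then show ?case using l2_add[OF dl[of i] insert.IH] by simp
  qed (simp add: l2_def)
  then show lap_l2: "(\<lambda>x. - lap u x) \<in> l2" unfolding lap by simp
  have "ip (fdiff j u) (fdiff j v) = ip (\<lambda>x. ?b j x - fdiff j u x) v" for j
  proof -
    have "ip (fdiff j u) (fdiff j v) = ip (fdiff j u) (\<lambda>x. v (x + axis j 1)) - ip (fdiff j u) v"
      using ip_diff_left[of "\<lambda>x. v (x + axis j 1)" v "fdiff j u"] u v
      by (simp add: fdiff_def[of j v, abs_def] ip_commute[of "fdiff j u"] l2_shift fdiff_l2)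
    also have "ip (fdiff j u) (\<lambda>x. v (x + axis j 1)) = ip (?b j) v"
      using ip_shift[of "?b j" "axis j 1" v] by simp
    finally show ?thesis using ip_diff_left[OF bl fdiff_l2[OF u] v] by simp
  qed
  then have "grad_inner u v = (\<Sum>j\<in>UNIV. ip (\<lambda>x. ?b j x - fdiff j u x) v)"
    by (simp add: grad_inner_eq u v)
  also have "\<dots> = ip (\<lambda>x. - lap u x) v"
    unfolding lap ip_def sum_distrib_right
    by (subst infsum_finite_sum) (auto intro: l2_mult_summable dl v)
  finally show "grad_inner u v = ip (\<lambda>x. - lap u x) v" .
qed

section \<open>The energy functional and its constituents\<close>

locale kirchhoff_choquard =
  fixes a b \<alpha> p :: real and h :: "int^3 \<Rightarrow> real" and \<tau> :: int and h0 :: real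
  assumes a: "0 < a" and b: "0 < b" and \<alpha>: "0 < \<alpha>" "\<alpha> < 3" and p: "2 < p"
    and h0: "0 < h0" and h: "\<And>x. h0 \<le> h x"
    and \<tau>: "1 \<le> \<tau>" and periodic: "\<And>x j. h (x + axis j \<tau>) = h x"
begin

sublocale bounded_kernel "green \<alpha>" "green \<alpha> 0"
  using abs_green_le green_minus green_tendsto_0 \<alpha> by unfold_locales auto

abbreviation "X \<equiv> Hsp h"

text \<open>The square root of the potential is absorbed into the function, so that the potential
  energy becomes a plain \<open>l2\<close> inner product.\<close>

definition sq where "sq u x = sqrt (h x) * u x" for u :: "int^3 \<Rightarrow> real" and x

lemma h_nonneg: "0 \<le> h x"
  using h[of x] h0 by linarith

lemma sq_mult: "sq u x * sq v x = h x * u x * v x"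
proof -
  have "sq u x * sq v x = (sqrt (h x) * sqrt (h x)) * (u x * v x)" by (simp add: sq_def)
  then show ?thesis using h_nonneg[of x] by simp
qed

lemma l2_if_weighted:
  assumes s: "(\<lambda>x. h x * (u x)\<^sup>2) summable_on UNIV"
  shows "u \<in> l2"
proof -
  have "(u x)\<^sup>2 \<le> 1/h0 * (h x * (u x)\<^sup>2)" for x
    using mult_right_mono[OF h[of x], of "(u x)\<^sup>2"] h0 by (simp add: field_simps)
  then show ?thesis
    unfolding l2_def by (auto intro!: summable_on_real_bound[OF summable_on_cmult_right[OF s, of "1/h0"]])
qed

lemma X_l2: "u \<in> X \<Longrightarrow> u \<in> l2"
  by (rule l2_if_weighted) (simp add: Hsp_def)

text \<open>The lower bound on h turns weighted into plain square summability, and differences of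
  \<open>l2\<close> functions on the lattice are again in \<open>l2\<close>.\<close>

lemma X_iff: "u \<in> X \<longleftrightarrow> sq u \<in> l2"
proof
  assume "u \<in> X"
  then have "(\<lambda>x. h x * (u x)\<^sup>2) summable_on UNIV" by (simp add: Hsp_def)
  then show "sq u \<in> l2" by (simp add: l2_def power2_eq_square sq_mult mult.assoc)
next
  assume "sq u \<in> l2"
  then have s: "(\<lambda>x. h x * (u x)\<^sup>2) summable_on UNIV"
    by (simp add: l2_def power2_eq_square sq_mult mult.assoc)
  with l2_if_weighted[OF s] show "u \<in> X"
    by (auto simp: Hsp_def H1_def l2_def intro!: summable_on_add grad_sq_summable)
qed

lemma X_sq: "u \<in> X \<Longrightarrow> sq u \<in> l2"
  by (simp add: X_iff)

definition A :: "(int^3 \<Rightarrow> real) \<Rightarrow> (int^3 \<Rightarrow> real) \<Rightarrow> real" where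
  "A u v = a * grad_inner u v + ip (sq u) (sq v)"

abbreviation "G \<equiv> grad_inner"

abbreviation pw :: "(int^3 \<Rightarrow> real) \<Rightarrow> int^3 \<Rightarrow> real" where
  "pw u \<equiv> (\<lambda>x. \<bar>u x\<bar> powr p)"

abbreviation D :: "(int^3 \<Rightarrow> real) \<Rightarrow> real" where "D u \<equiv> DD (pw u) (pw u)"

text \<open>The Nehari functional \<open>J' u u\<close>. For nonzero \<open>u\<close>, a nonpositive
  value means that the ray through \<open>u\<close> meets the Nehari manifold at a multiple of at
  most 1.\<close>

definition I :: "(int^3 \<Rightarrow> real) \<Rightarrow> real" where "I u = A u u + b * (G u u)\<^sup>2 - D u"

abbreviation "J \<equiv> energy a b \<alpha> p h"
abbreviation "J' \<equiv> energy_deriv a b \<alpha> p h"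
abbreviation "N \<equiv> nehari a b \<alpha> p h"

lemma conv_eq_cv: "conv \<alpha> f x = cv f x"
  unfolding conv_def cv_def by (simp add: R_alpha_eq_green \<alpha>)

lemma pw_summable: "u \<in> X \<Longrightarrow> pw u summable_on UNIV"
  using l2_powr_summable(1)[OF X_l2, of u p] p by simp

lemma Hnorm_sq_eq:
  assumes "u \<in> X"
  shows "Hnorm_sq a h u = A u u"
proof -
  have s: "(\<lambda>x. h x * (u x)\<^sup>2) summable_on UNIV" using assms by (simp add: Hsp_def)
  have "Hnorm_sq a h u = a * infsum (grad_sq u) UNIV + (\<Sum>\<^sub>\<infinity>x. h x * (u x)\<^sup>2)"
    unfolding Hnorm_sq_def
    by (subst infsum_add) (auto intro: s summable_on_cmult_right grad_sq_summable X_l2 assms simp: infsum_cmult_right')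
  then show ?thesis
    by (simp add: A_def infsum_grad_sq X_l2 assms ip_def sq_mult power2_eq_square mult.assoc)
qed

lemma J_eq: "u \<in> X \<Longrightarrow> J u = 1/2 * A u u + b/4 * (G u u)\<^sup>2 - 1/(2*p) * D u"
  unfolding energy_def by (simp add: Hnorm_sq_eq infsum_grad_sq X_l2 conv_eq_cv DD_def)

lemma J'_eq: "u \<in> X \<Longrightarrow> J' u \<phi> = A u \<phi> + b * G u u * G u \<phi>
    - (\<Sum>\<^sub>\<infinity>x. cv (pw u) x * \<bar>u x\<bar> powr (p - 2) * u x * \<phi> x)"
  unfolding energy_deriv_def
  by (simp add: infsum_grad_sq X_l2 conv_eq_cv A_def ip_def sq_mult)

lemma powr_minus_2: "\<bar>x\<bar> powr (p - 2) * x * x = \<bar>x\<bar> powr p" for x :: real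
proof (cases "x = 0")
  case False
  have "\<bar>x\<bar> powr p = \<bar>x\<bar> powr (p - 2) * \<bar>x\<bar> powr 2"
    using powr_add[of "\<bar>x\<bar>" "p - 2" 2] by simp
  also have "\<bar>x\<bar> powr 2 = x * x" using False by (simp add: powr_numeral power2_eq_square)
  finally show ?thesis by simp
qed simp

lemma J'_self: "u \<in> X \<Longrightarrow> J' u u = I u"
  by (simp add: J'_eq I_def DD_def mult.assoc powr_minus_2[unfolded mult.assoc] power2_eq_square)

lemma N_iff: "u \<in> N \<longleftrightarrow> u \<in> X \<and> u \<noteq> (\<lambda>_. 0) \<and> I u = 0"
  by (auto simp: nehari_def J'_self)

lemma X_add_scale: "u \<in> X \<Longrightarrow> v \<in> X \<Longrightarrow> (\<lambda>x. u x + t * v x) \<in> X"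
  using l2_add[OF X_sq l2_scale[OF X_sq, of v t], of u]
  by (simp add: X_iff sq_def[abs_def] algebra_simps)

lemma X_scale: "u \<in> X \<Longrightarrow> (\<lambda>x. t * u x) \<in> X"
  using l2_scale[OF X_sq, of u t] by (simp add: X_iff sq_def[abs_def] algebra_simps)

lemma A_add_scale:
  assumes "u \<in> X" "v \<in> X"
  shows "A (\<lambda>x. u x + t * v x) (\<lambda>x. u x + t * v x) = A u u + 2 * t * A u v + t\<^sup>2 * A v v"
proof -
  have "sq (\<lambda>x. u x + t * v x) = (\<lambda>x. sq u x + t * sq v x)" by (auto simp: sq_def algebra_simps)
  then show ?thesis
    using assms by (simp add: A_def grad_inner_add_scale X_l2 X_sq ip_add_scale_self algebra_simps)
qed

lemma A_scale: "u \<in> X \<Longrightarrow> A (\<lambda>x. t * u x) (\<lambda>x. t * u x) = t\<^sup>2 * A u u"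
proof -
  assume u: "u \<in> X"
  have "sq (\<lambda>x. t * u x) = (\<lambda>x. t * sq u x)" by (auto simp: sq_def algebra_simps)
  then show ?thesis using u
    by (simp add: A_def grad_inner_scale X_l2 ip_scale_left ip_scale_right algebra_simps power2_eq_square)
qed

lemma D_scale: "0 \<le> t \<Longrightarrow> D (\<lambda>x. t * u x) = t powr (2 * p) * D u"
  using DD_scale[of "t powr p" "pw u" "t powr p" "pw u"]
  by (simp add: abs_mult powr_mult powr_add[symmetric])

lemma A_ge: "u \<in> X \<Longrightarrow> a * G u u + h0 * ip u u \<le> A u u"
proof -
  assume u: "u \<in> X"
  have "(\<Sum>\<^sub>\<infinity>x. h0 * (u x * u x)) \<le> (\<Sum>\<^sub>\<infinity>x. sq u x * sq u x)"
    by (intro infsum_mono summable_on_cmult_right l2_mult_summable X_l2 X_sq u)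
       (simp add: sq_mult mult.assoc mult_right_mono h)
  then show ?thesis by (simp add: A_def ip_def infsum_cmult_right')
qed

lemma A_nonneg: "u \<in> X \<Longrightarrow> 0 \<le> A u u"
  using A_ge[of u] a h0 grad_inner_nonneg[OF X_l2, of u] ip_nonneg[of u]
  by (smt (verit) mult_nonneg_nonneg)

lemma A_pos:
  assumes "u \<in> X" "u \<noteq> (\<lambda>_. 0)"
  shows "0 < A u u"
proof -
  obtain x where "u x \<noteq> 0" using assms(2) by auto
  then have "0 < ip u u" by (rule ip_pos[OF X_l2[OF assms(1)]])
  then have "0 < h0 * ip u u" using h0 by simp
  moreover have "0 \<le> a * G u u" using a grad_inner_nonneg[OF X_l2[OF assms(1)]] by simp
  ultimately show ?thesis using A_ge[OF assms(1)] by linarith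
qed

lemma A_weak_tendsto_0:
  assumes u: "u \<in> X" and v: "\<And>n. v n \<in> X" and bd: "\<And>n. A (v n) (v n) \<le> M"
    and pt: "\<And>x. (\<lambda>n. v n x) \<longlonglongrightarrow> 0"
  shows "(\<lambda>n. A u (v n)) \<longlonglongrightarrow> 0" "(\<lambda>n. G u (v n)) \<longlonglongrightarrow> 0"
proof -
  have bd1: "ip (sq (v n)) (sq (v n)) \<le> M" for n
    using bd[of n] grad_inner_nonneg[OF X_l2[OF v], of n] a
    by (smt (verit) A_def mult_nonneg_nonneg)
  have bd2: "G (v n) (v n) \<le> M / a" for n
    using bd[of n] ip_nonneg[of "sq (v n)"] a by (simp add: A_def field_simps)
  have "(\<lambda>n. sq (v n) x) \<longlonglongrightarrow> 0" for x
    unfolding sq_def by (intro tendsto_mult_right_zero pt)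
  then have 1: "(\<lambda>n. ip (sq u) (sq (v n))) \<longlonglongrightarrow> 0"
    by (intro ip_weak_tendsto_0[OF X_sq[OF u] X_sq[OF v] bd1])
  show 2: "(\<lambda>n. G u (v n)) \<longlonglongrightarrow> 0"
    by (rule grad_inner_weak_tendsto_0[OF X_l2[OF u] X_l2[OF v] bd2 pt])
  have "(\<lambda>n. a * G u (v n) + ip (sq u) (sq (v n))) \<longlonglongrightarrow> a * 0 + 0"
    by (intro tendsto_intros 1 2)
  then show "(\<lambda>n. A u (v n)) \<longlonglongrightarrow> 0" by (simp add: A_def)
qed

section \<open>Invariance under periodic translations\<close>

lemma periodic_multiple: "h (x + axis j (\<tau> * m)) = h x"
proof (induction m rule: int_induct[where k = 0])
  case base
  have "axis j 0 = (0 :: int^3)" by simp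
  from arg_cong[OF this, of "\<lambda>y. h (x + y)"] show ?case by simp
next
  case (step1 i)
  have "x + axis j (\<tau> * (i + 1)) = (x + axis j (\<tau> * i)) + axis j \<tau>"
    by (simp add: vec_eq_iff axis_def algebra_simps)
  then show ?case using step1 periodic by metis
next
  case (step2 i)
  have "x + axis j (\<tau> * i) = (x + axis j (\<tau> * (i - 1))) + axis j \<tau>"
    by (simp add: vec_eq_iff axis_def algebra_simps)
  then show ?case using step2 periodic by metis
qed

lemma periodic_lattice: "h (x + (\<chi> j. \<tau> * z $ j)) = h x"
proof -
  have "h (x + (\<Sum>j\<in>S. axis j (\<tau> * z $ j))) = h x" if "finite S" for S :: "3 set"
    using that
  proof (induction S)
    case (insert i S)
    have "x + (\<Sum>j\<in>insert i S. axis j (\<tau> * z $ j)) = (x + (\<Sum>j\<in>S. axis j (\<tau> * z $ j))) + axis i (\<tau> * z $ i)"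
      using insert(1,2) by (simp add: algebra_simps)
    then show ?case using insert(3) periodic_multiple by metis
  qed simp
  moreover have "(\<Sum>j\<in>UNIV. axis j (\<tau> * z $ j)) = (\<chi> j. \<tau> * z $ j)"
    by (simp add: vec_eq_iff axis_def if_distrib cong: if_cong)
  ultimately show ?thesis by (metis finite)
qed

lemma shift_invariant:
  fixes z :: "int^3"
  assumes u: "u \<in> X"
  defines "v \<equiv> \<lambda>x. u (x + (\<chi> j. \<tau> * z $ j))"
  shows "v \<in> X" "A v v = A u u" "G v v = G u u" "D v = D u" "I v = I u" "J v = J u"
proof -
  let ?c = "\<chi> j. \<tau> * z $ j"
  have sq: "sq v = (\<lambda>x. sq u (x + ?c))" by (auto simp: sq_def v_def periodic_lattice)
  show v: "v \<in> X" using u by (simp add: X_iff sq l2_shift)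
  show G: "G v v = G u u" unfolding v_def by (rule grad_inner_shift[OF X_l2[OF u]])
  show A: "A v v = A u u" by (simp add: A_def G sq ip_shift)
  show D: "D v = D u" unfolding v_def by (rule DD_shift)
  show "I v = I u" by (simp add: I_def A G D)
  show "J v = J u" by (simp add: J_eq u v A G D)
qed

end

section \<open>Fibering maps and pointwise subsequences\<close>

text \<open>When D = A + B, the energy along the ray is largest at t = 1. Bernoulli's inequality
  treats the two contributions separately, with exponent p at \<open>t\<^sup>2\<close> for A and
  exponent p/2 at \<open>t^4\<close> for B; the latter exponent is at least 1 because p > 2.\<close>

lemma fibering_map_le:
  fixes A B p t :: real
  assumes "0 \<le> A" "0 \<le> B" "2 < p" "0 < t"
  shows "t\<^sup>2/2 * A + t^4/4 * B - t powr (2*p) / (2*p) * (A + B) \<le> A/2 + B/4 - (A + B) / (2*p)"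
proof -
  have 1: "1 + p * (t\<^sup>2 - 1) \<le> t powr (2*p)"
    using Bernoulli_powr[of "t\<^sup>2" p] assms powr_powr[of t 2 p] by (simp add: powr_numeral)
  have 2: "1 + p/2 * (t^4 - 1) \<le> t powr (2*p)"
    using Bernoulli_powr[of "t^4" "p/2"] assms powr_powr[of t 4 "p/2"] by (simp add: powr_numeral)
  have "(1 + p * (t\<^sup>2 - 1)) / (2*p) \<le> t powr (2*p) / (2*p)"
    using 1 assms by (intro divide_right_mono) auto
  moreover have "(1 + p * (t\<^sup>2 - 1)) / (2*p) = 1/(2*p) + t\<^sup>2/2 - 1/2"
    using assms by (simp add: field_simps)
  ultimately have "t\<^sup>2/2 - t powr (2*p) / (2*p) \<le> 1/2 - 1/(2*p)" by linarith
  from mult_right_mono[OF this assms(1)]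
  have "t\<^sup>2/2 * A - t powr (2*p) / (2*p) * A \<le> A/2 - A/(2*p)" by (simp add: left_diff_distrib)
  moreover have "t^4/4 - t powr (2*p) / (2*p) \<le> 1/4 - 1/(2*p)"
  proof -
    have "(1 + p/2 * (t^4 - 1)) / (2*p) \<le> t powr (2*p) / (2*p)"
      using 2 assms by (intro divide_right_mono) auto
    moreover have "(1 + p/2 * (t^4 - 1)) / (2*p) = 1/(2*p) + t^4/4 - 1/4"
      using assms by (simp add: field_simps)
    ultimately show ?thesis by linarith
  qed
  from mult_right_mono[OF this assms(2)]
  have "t^4/4 * B - t powr (2*p) / (2*p) * B \<le> B/4 - B/(2*p)" by (simp add: left_diff_distrib)
  ultimately show ?thesis by (simp add: distrib_left add_divide_distrib)
qed

text \<open>One-sided optimality along a curve \<open>s \<mapsto> w s\<close> through a minimiser: \<open>A s\<close>, \<open>B s\<close>, \<open>D s\<close> are the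
  coefficients of the fibering map of \<open>w s\<close>. The Nehari multiplier \<open>t\<close> of \<open>w s\<close> is located near 1 by the
  intermediate value theorem, so neither its uniqueness nor its smoothness in \<open>s\<close> is needed.\<close>

lemma fibering_first_order:
  fixes A B D :: "real \<Rightarrow> real" and p A' B' D' c :: real
  assumes p: "2 < p" and A0: "0 < A 0" and B0: "0 \<le> B 0" and D0: "D 0 = A 0 + B 0"
    and dA: "(A has_real_derivative A') (at 0)"
    and dB: "(B has_real_derivative B') (at 0)"
    and dD: "(D has_real_derivative D') (at 0)"
    and c: "c = A 0 / 2 + B 0 / 4 - D 0 / (2*p)"
    and min: "\<And>s t. 0 < t \<Longrightarrow> 0 < A s \<Longrightarrow> A s + t\<^sup>2 * B s - t powr (2*p-2) * D s = 0 \<Longrightarrow>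
      c \<le> t\<^sup>2/2 * A s + t^4/4 * B s - t powr (2*p) / (2*p) * D s"
  shows "0 \<le> A'/2 + B'/4 - D'/(2*p)"
proof (rule ccontr)
  assume "\<not> ?thesis"
  then have L: "A'/2 + B'/4 - D'/(2*p) < 0" by simp
  define \<psi> where "\<psi> s t = A s + t\<^sup>2 * B s - t powr (2*p-2) * D s" for s t
  \<comment> \<open>The difference quotient in s of the fibering maps at a common multiplier t.
    Taking its limit jointly as s tends to 0 and t to 1 allows a multiplier that depends on s in an
    uncontrolled way.\<close>
  define F where "F z = (snd z)\<^sup>2/2 * ((A (fst z) - A 0) / fst z) + (snd z)^4/4 * ((B (fst z) - B 0) / fst z)
     - (snd z) powr (2*p) / (2*p) * ((D (fst z) - D 0) / fst z)" for z
  have q: "((\<lambda>s. (f s - f 0) / s) \<longlongrightarrow> f') (at_right 0)" if "(f has_real_derivative f') (at 0)" for f f'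
    using that by (auto simp: has_field_derivative_iff intro: tendsto_mono[OF at_le])
  have fst: "filterlim fst (at_right 0) (at_right 0 \<times>\<^sub>F nhds (1::real))" by (rule filterlim_fst)
  have snd: "(snd \<longlongrightarrow> 1) (at_right (0::real) \<times>\<^sub>F nhds (1::real))" by (rule filterlim_snd)
  have "(F \<longlongrightarrow> 1\<^sup>2/2 * A' + 1^4/4 * B' - 1 powr (2*p) / (2*p) * D') (at_right 0 \<times>\<^sub>F nhds 1)"
    unfolding F_def using p
    by (intro tendsto_intros snd filterlim_compose[OF q[OF dA] fst] filterlim_compose[OF q[OF dB] fst]
          filterlim_compose[OF q[OF dD] fst]) auto
  then have "eventually (\<lambda>z. F z < 0) (at_right 0 \<times>\<^sub>F nhds 1)"
    using L by (intro order_tendstoD(2)) auto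
  then obtain P Q where P: "eventually P (at_right 0)" and Q: "eventually Q (nhds 1)"
    and PQ: "\<And>s t. P s \<Longrightarrow> Q t \<Longrightarrow> F (s, t) < 0"
    unfolding eventually_prod_filter by auto
  from Q obtain d where d: "0 < d" "\<And>t. dist t 1 < d \<Longrightarrow> Q t" by (auto simp: eventually_nhds_metric)
  define \<epsilon> where "\<epsilon> = min (d/2) (1/2)"
  have \<epsilon>: "0 < \<epsilon>" "\<epsilon> < 1" "\<epsilon> < d" using d by (auto simp: \<epsilon>_def)
  have A: "(A \<longlongrightarrow> A 0) (at_right 0)" and B: "(B \<longlongrightarrow> B 0) (at_right 0)" and D: "(D \<longlongrightarrow> D 0) (at_right 0)"
    using DERIV_isCont[OF dA] DERIV_isCont[OF dB] DERIV_isCont[OF dD]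
    by (auto simp: isCont_def intro: tendsto_mono[OF at_le])
  have lim: "((\<lambda>s. \<psi> s t) \<longlongrightarrow> \<psi> 0 t) (at_right 0)" for t
    unfolding \<psi>_def by (intro tendsto_intros A B D)
  \<comment> \<open>Eliminating \<open>D 0\<close> exhibits the sign change of \<psi> at t = 1: both
    brackets are nonnegative below 1 and nonpositive above it, since 2p - 2 exceeds 2.\<close>
  have \<psi>0: "\<psi> 0 t = A 0 * (1 - t powr (2*p-2)) + B 0 * (t powr 2 - t powr (2*p-2))" if "0 < t" for t
    using that by (simp add: \<psi>_def D0 powr_numeral algebra_simps)
  have "0 < \<psi> 0 (1 - \<epsilon>)"
  proof -
    have "(1 - \<epsilon>) powr (2*p-2) < 1" using \<epsilon> p powr_less_mono2[of "2*p-2" "1-\<epsilon>" 1] by simp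
    moreover have "(1 - \<epsilon>) powr (2*p-2) \<le> (1 - \<epsilon>) powr 2" using \<epsilon> p by (intro powr_mono') auto
    ultimately have "0 < A 0 * (1 - (1 - \<epsilon>) powr (2*p-2))" "0 \<le> B 0 * ((1 - \<epsilon>) powr 2 - (1 - \<epsilon>) powr (2*p-2))"
      using A0 B0 by auto
    then show ?thesis using \<psi>0[of "1 - \<epsilon>"] \<epsilon> by simp
  qed
  then have e1: "eventually (\<lambda>s. 0 < \<psi> s (1 - \<epsilon>)) (at_right 0)"
    using lim by (intro order_tendstoD(1))
  have "\<psi> 0 (1 + \<epsilon>) < 0"
  proof -
    have "1 < (1 + \<epsilon>) powr (2*p-2)" using \<epsilon> p powr_less_mono2[of "2*p-2" 1 "1+\<epsilon>"] by simp
    moreover have "(1 + \<epsilon>) powr 2 \<le> (1 + \<epsilon>) powr (2*p-2)" using \<epsilon> p by (intro powr_mono) auto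
    ultimately have "A 0 * (1 - (1 + \<epsilon>) powr (2*p-2)) < 0" "B 0 * ((1 + \<epsilon>) powr 2 - (1 + \<epsilon>) powr (2*p-2)) \<le> 0"
      using A0 B0 by (auto simp: mult_less_0_iff mult_le_0_iff)
    then show ?thesis using \<psi>0[of "1 + \<epsilon>"] \<epsilon> by simp
  qed
  then have e2: "eventually (\<lambda>s. \<psi> s (1 + \<epsilon>) < 0) (at_right 0)"
    using lim by (intro order_tendstoD(2))
  have e3: "eventually (\<lambda>s. 0 < A s) (at_right 0)" using A A0 by (intro order_tendstoD(1))
  have e4: "eventually (\<lambda>s::real. 0 < s) (at_right 0)" by (simp add: eventually_at_right_less)
  have "eventually (\<lambda>s. P s \<and> 0 < \<psi> s (1 - \<epsilon>) \<and> \<psi> s (1 + \<epsilon>) < 0 \<and> 0 < A s \<and> 0 < s) (at_right 0)"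
    using P e1 e2 e3 e4 by eventually_elim auto
  then obtain s where s: "P s" "0 < \<psi> s (1 - \<epsilon>)" "\<psi> s (1 + \<epsilon>) < 0" "0 < A s" "0 < s"
    using eventually_happens[of _ "at_right (0::real)"] by (auto simp: trivial_limit_at_right_real)
  have "continuous_on {1-\<epsilon>..1+\<epsilon>} (\<psi> s)"
    unfolding \<psi>_def using \<epsilon> p by (intro continuous_intros) auto
  then obtain t where t: "1 - \<epsilon> \<le> t" "t \<le> 1 + \<epsilon>" "\<psi> s t = 0"
    using IVT2'[of "\<psi> s" "1 + \<epsilon>" 0 "1 - \<epsilon>"] s \<epsilon> by auto
  have t0: "0 < t" using t \<epsilon> by linarith
  have "Q t" using t \<epsilon> d by (auto simp: dist_real_def abs_less_iff)
  then have "F (s, t) < 0" using PQ s by blast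
  then have "s * F (s, t) < 0" using s by (simp add: mult_less_0_iff)
  \<comment> \<open>The difference of two energies at the same t. The first is at least c by
    minimality, the second at most c because t = 1 is optimal on the ray at s = 0, so the product
    cannot be negative.\<close>
  moreover have "s * F (s, t) = (t\<^sup>2/2 * A s + t^4/4 * B s - t powr (2*p) / (2*p) * D s)
      - (t\<^sup>2/2 * A 0 + t^4/4 * B 0 - t powr (2*p) / (2*p) * D 0)"
    using s p by (simp add: F_def field_simps)
  moreover have "c \<le> t\<^sup>2/2 * A s + t^4/4 * B s - t powr (2*p) / (2*p) * D s"
    using min[OF t0 s(4)] t(3) by (simp add: \<psi>_def)
  moreover have "t\<^sup>2/2 * A 0 + t^4/4 * B 0 - t powr (2*p) / (2*p) * D 0 \<le> c"
    using fibering_map_le[of "A 0" "B 0" p t] A0 B0 p t0 by (simp add: c D0)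
  ultimately show False by linarith
qed

text \<open>The cube is compact by Tychonoff's theorem, and countability of the index type makes the
  product topology first countable, so compactness yields subsequences.\<close>

lemma bounded_pointwise_subsequence:
  fixes v :: "nat \<Rightarrow> 'a::countable \<Rightarrow> real"
  assumes "\<And>n x. \<bar>v n x\<bar> \<le> m"
  obtains u r where "strict_mono r" "\<And>x. (\<lambda>n. v (r n) x) \<longlonglongrightarrow> u x"
proof -
  let ?K = "PiE UNIV (\<lambda>_::'a. {-m..m})"
  have "compactin (product_topology (\<lambda>_. euclidean) UNIV) ?K"
    by (simp add: compactin_PiE)
  then have "compact ?K" by (simp add: euclidean_product_topology)
  then have "seq_compact ?K" by (rule compact_imp_seq_compact)
  moreover have "v n \<in> ?K" for n using assms[of n] by (auto simp: PiE_iff abs_le_iff) (smt (verit))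
  ultimately obtain u r where r: "strict_mono r" and lim: "(v \<circ> r) \<longlonglongrightarrow> u"
    unfolding seq_compact_def by blast
  have "(\<lambda>n. v (r n) x) \<longlonglongrightarrow> u x" for x
    using continuous_on_tendsto_compose[OF continuous_on_product_coordinates lim, of x] by (simp add: o_def)
  with r show ?thesis by (rule that)
qed

section \<open>The Nehari manifold\<close>

context kirchhoff_choquard begin

text \<open>The coefficients left after eliminating D = A + B from the energy. The second is
  positive because the Choquard exponent 2p exceeds the Kirchhoff exponent 4.\<close>

definition \<kappa>1 :: real where "\<kappa>1 = 1/2 - 1/(2*p)"
definition \<kappa>2 :: real where "\<kappa>2 = 1/4 - 1/(2*p)"

lemma \<kappa>_pos: "0 < \<kappa>1" "0 < \<kappa>2"
  using p by (simp_all add: \<kappa>1_def \<kappa>2_def field_simps)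

abbreviation "B u \<equiv> b * (G u u)\<^sup>2"

lemma B_nonneg: "0 \<le> B u"
  using b by simp

lemma I_scale:
  assumes "u \<in> X" "0 < t"
  shows "I (\<lambda>x. t * u x) = t\<^sup>2 * (A u u + t\<^sup>2 * B u - t powr (2*p-2) * D u)"
proof -
  have "t powr (2*p) = t\<^sup>2 * t powr (2*p-2)"
    using powr_add[of t 2 "2*p-2"] assms(2) by (simp add: powr_numeral)
  then show ?thesis using assms
    by (simp add: I_def A_scale D_scale grad_inner_scale X_l2 power_mult_distrib algebra_simps power2_eq_square)
qed

lemma J_scale:
  assumes "u \<in> X" "0 < t"
  shows "J (\<lambda>x. t * u x) = t\<^sup>2/2 * A u u + t^4/4 * B u - t powr (2*p) / (2*p) * D u"
  using assms by (simp add: J_eq X_scale A_scale D_scale grad_inner_scale X_l2 power_mult_distrib flip: power_mult)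

lemma J_on_N: "u \<in> N \<Longrightarrow> J u = \<kappa>1 * A u u + \<kappa>2 * B u"
proof -
  assume u: "u \<in> N"
  then have "D u = A u u + B u" by (simp add: N_iff I_def)
  with u show ?thesis by (simp add: N_iff J_eq \<kappa>1_def \<kappa>2_def algebra_simps add_divide_distrib)
qed

lemma scale_nonzero: "u \<noteq> (\<lambda>_. 0) \<Longrightarrow> 0 < t \<Longrightarrow> (\<lambda>x. t * u x) \<noteq> (\<lambda>_. 0)" for t :: real
  by (auto simp: fun_eq_iff)

lemma nehari_projection:
  assumes u: "u \<in> X" "u \<noteq> (\<lambda>_. 0)" and I: "I u \<le> 0"
  obtains t where "0 < t" "t \<le> 1" "(\<lambda>x. t * u x) \<in> N"
proof -
  \<comment> \<open>Dividing the Nehari condition by \<open>t\<^sup>2\<close> leaves a function that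
    is continuous down to t = 0, with the positive value \<open>A u u\<close> there; its value at 1
    is \<open>I u\<close>.\<close>
  define \<psi> where "\<psi> t = A u u + t\<^sup>2 * B u - t powr (2*p-2) * D u" for t
  have "continuous_on {0..1} \<psi>"
    unfolding \<psi>_def using p by (intro continuous_intros continuous_on_powr') auto
  moreover have 0: "0 < \<psi> 0" using A_pos[OF u] by (simp add: \<psi>_def)
  moreover have "\<psi> 1 \<le> 0" using I by (simp add: \<psi>_def I_def)
  ultimately obtain t where t: "0 \<le> t" "t \<le> 1" "\<psi> t = 0"
    using IVT2'[of \<psi> 1 0 0] by auto
  with 0 have "0 < t" by (cases "t = 0") auto
  with t u have "(\<lambda>x. t * u x) \<in> N"
    by (simp add: N_iff X_scale scale_nonzero I_scale \<psi>_def)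
  with \<open>0 < t\<close> t show ?thesis by (intro that)
qed

section \<open>Point masses\<close>

definition spike :: "int^3 \<Rightarrow> int^3 \<Rightarrow> real" where
  "spike x y = (if y = x then 1 else 0)"

lemma spike_X: "spike x \<in> X"
proof -
  have "(\<lambda>y. (sq (spike x) y)\<^sup>2) summable_on UNIV"
    by (rule finite_nonzero_values_imp_summable_on) (auto simp: sq_def spike_def)
  then show ?thesis by (simp add: X_iff l2_def)
qed

lemma infsum_spike: "(\<Sum>\<^sub>\<infinity>y. f y * spike x y) = f x"
proof -
  have "(\<Sum>\<^sub>\<infinity>y. f y * spike x y) = (\<Sum>\<^sub>\<infinity>y\<in>{x}. f y * spike x y)"
    by (rule infsum_cong_neutral) (auto simp: spike_def)
  then show ?thesis by (simp add: spike_def)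
qed

lemma spike_summable: "spike x summable_on UNIV"
  by (rule finite_nonzero_values_imp_summable_on) (simp add: spike_def)

lemma cv_spike: "cv (spike x) y = green \<alpha> (y - x)"
  unfolding cv_def by (rule infsum_spike)

lemma DD_spike: "DD f (spike x) = cv f x"
  unfolding DD_def by (rule infsum_spike)

lemma N_nonempty: "N \<noteq> {}"
proof -
  let ?u = "spike 0"
  have "pw ?u = ?u" by (auto simp: spike_def)
  then have D: "0 < D ?u" using green_0_pos[OF \<alpha>] by (simp add: DD_spike cv_spike)
  have nz: "?u \<noteq> (\<lambda>_. 0)" by (auto simp: spike_def fun_eq_iff)
  let ?c = "A ?u ?u + B ?u"
  have c: "0 \<le> ?c" using A_nonneg[OF spike_X] B_nonneg by (simp add: add_nonneg_nonneg)
  \<comment> \<open>Solves \<open>T powr (2*p-4) * D ?u = D ?u + ?c\<close>, so that at the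
    multiplier \<open>T\<close> the Choquard term outweighs \<open>A\<close> and \<open>B\<close>
    together. As T \<ge> 1, the lower power of \<open>T\<close> in front of \<open>A\<close> does no
    harm.\<close>
  define T where "T = (1 + ?c / D ?u) powr (1/(2*p-4))"
  have base: "1 \<le> 1 + ?c / D ?u" using c D by simp
  have T: "1 \<le> T" unfolding T_def using base p by (intro ge_one_powr_ge_zero) auto
  have "T powr (2*p-4) = 1 + ?c / D ?u" unfolding T_def using base p by (simp add: powr_powr)
  then have "T powr (2*p-4) * D ?u = D ?u + ?c" using D by (simp add: field_simps)
  moreover have "T powr (2*p-2) = T\<^sup>2 * T powr (2*p-4)"
    using powr_add[of T 2 "2*p-4"] T by (simp add: powr_numeral)
  ultimately have "T powr (2*p-2) * D ?u = T\<^sup>2 * (D ?u + ?c)" by simp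
  moreover have "A ?u ?u \<le> T\<^sup>2 * A ?u ?u"
    using T A_nonneg[OF spike_X, of 0] mult_right_mono[of 1 "T\<^sup>2"] by simp
  moreover have "0 \<le> T\<^sup>2 * D ?u" using D by simp
  ultimately have "A ?u ?u + T\<^sup>2 * B ?u - T powr (2*p-2) * D ?u \<le> 0"
    by (simp only: distrib_left)
  then have "I (\<lambda>x. T * ?u x) \<le> 0"
    using T by (simp add: I_scale spike_X mult_le_0_iff)
  moreover have "(\<lambda>x. T * ?u x) \<noteq> (\<lambda>_. 0)" using T by (intro scale_nonzero[OF nz]) auto
  ultimately show ?thesis using nehari_projection[OF X_scale[OF spike_X]] by blast
qed

section \<open>The ground state level and bounds on the Nehari manifold\<close>

definition c_min :: real where "c_min = (INF v\<in>N. J v)"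

lemma J_N_nonneg: "v \<in> N \<Longrightarrow> 0 \<le> J v"
  using \<kappa>_pos A_nonneg[of v] B_nonneg[of v] by (simp add: J_on_N N_iff)

lemma c_min_le: "v \<in> N \<Longrightarrow> c_min \<le> J v"
  unfolding c_min_def by (rule cINF_lower) (auto intro!: bdd_belowI[of _ 0] J_N_nonneg)

lemma c_min_approx: "c_min < y \<Longrightarrow> \<exists>v\<in>N. J v < y"
  unfolding c_min_def using cINF_less_iff[of N J y] N_nonempty J_N_nonneg
  by (auto simp: bdd_below_def)

lemma l2_le_A: "u \<in> X \<Longrightarrow> ip u u \<le> A u u / h0"
proof -
  assume u: "u \<in> X"
  have "0 \<le> a * G u u" using a grad_inner_nonneg[OF X_l2[OF u]] by simp
  with A_ge[OF u] have "h0 * ip u u \<le> A u u" by linarith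
  then show ?thesis using h0 by (simp add: field_simps)
qed

lemma sup_le_A: "u \<in> X \<Longrightarrow> \<bar>u x\<bar> \<le> sqrt (A u u / h0)"
  using power2_le_ip_self[OF X_l2, of u x] l2_le_A[of u]
  by (intro real_le_rsqrt) auto

text \<open>This excludes vanishing. On the manifold \<open>A\<close> is at most \<open>D\<close>,
  while \<open>D\<close> is at most quadratic in the mass of |u|^p; that mass is at most a small
  multiple of \<open>A\<close> if the sup norm is small.\<close>

lemma N_nonvanishing:
  obtains \<epsilon> where "0 < \<epsilon>" "\<And>u. u \<in> N \<Longrightarrow> A u u \<le> M \<Longrightarrow> \<exists>x. \<epsilon> \<le> \<bar>u x\<bar>"
proof -
  define C where "C = green \<alpha> 0"
  define M' where "M' = max M 0"
  have C: "0 \<le> C" unfolding C_def by (rule C_nonneg)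
  have CM: "0 \<le> C * M'" using C by (simp add: M'_def)
  \<comment> \<open>Small enough that C (s A / h0)^2 < A whenever 0 < A \<le> M; the added 1 makes
    the inequality strict and the denominator positive.\<close>
  define s where "s = h0 / sqrt (C * M' + 1)"
  have s: "0 < s" using h0 CM by (simp add: s_def)
  have s2: "s\<^sup>2 * (C * M') < h0\<^sup>2"
    using CM h0 by (simp add: s_def power_divide field_simps)
  define \<epsilon> where "\<epsilon> = s powr (1/(p-2))"
  have \<epsilon>: "0 < \<epsilon>" "\<epsilon> powr (p-2) = s" using s p by (simp_all add: \<epsilon>_def powr_powr)
  have "\<exists>x. \<epsilon> \<le> \<bar>u x\<bar>" if u: "u \<in> N" and M: "A u u \<le> M" for u
  proof (rule ccontr)
    assume "\<not> ?thesis"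
    then have small: "\<bar>u x\<bar> \<le> \<epsilon>" for x by (simp add: not_le less_imp_le)
    have uX: "u \<in> X" and pos: "0 < A u u" and D: "D u = A u u + B u"
      using u A_pos by (auto simp: N_iff I_def)
    have "l1norm (pw u) \<le> s * ip u u"
      using l2_powr_summable(2)[OF X_l2[OF uX] _ small, of p] p \<epsilon> by simp
    also have "\<dots> \<le> s * (A u u / h0)" using s l2_le_A[OF uX] by (intro mult_left_mono) auto
    finally have l1: "l1norm (pw u) \<le> s * (A u u / h0)" .
    have "A u u \<le> D u" using D B_nonneg[of u] by linarith
    also have "\<dots> \<le> C * l1norm (pw u) * l1norm (pw u)"
      using DD_bound[OF pw_summable[OF uX] pw_summable[OF uX]] by (simp add: C_def)
    also have "\<dots> \<le> C * (s * (A u u / h0)) * (s * (A u u / h0))"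
      using l1 C s pos h0 by (intro mult_mono mult_left_mono) (auto intro!: infsum_nonneg)
    also have "\<dots> = s\<^sup>2 * (C * A u u) / h0\<^sup>2 * A u u"
      by (simp add: power2_eq_square)
    finally have "1 * A u u \<le> s\<^sup>2 * (C * A u u) / h0\<^sup>2 * A u u" by simp
    then have "1 \<le> s\<^sup>2 * (C * A u u) / h0\<^sup>2" using pos by (rule mult_right_le_imp_le)
    also have "\<dots> \<le> s\<^sup>2 * (C * M') / h0\<^sup>2"
      using M C by (intro divide_right_mono mult_left_mono) (auto simp: M'_def)
    also have "\<dots> < 1" using s2 h0 by simp
    finally show False by simp
  qed
  with \<epsilon>(1) show ?thesis by (rule that)
qed

lemma finite_period_box: "finite {y::int^3. \<forall>j. 0 \<le> y $ j \<and> y $ j < \<tau>}"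
proof (rule finite_subset)
  show "{y::int^3. \<forall>j. 0 \<le> y $ j \<and> y $ j < \<tau>} \<subseteq> (\<lambda>f. \<chi> j. f j) ` PiE UNIV (\<lambda>_. {0..<\<tau>})"
  proof
    fix y :: "int^3" assume "y \<in> {y. \<forall>j. 0 \<le> y $ j \<and> y $ j < \<tau>}"
    then have "y = (\<chi> j. y $ j)" "(\<lambda>j. y $ j) \<in> PiE UNIV (\<lambda>_. {0..<\<tau>})"
      by (auto simp: vec_eq_iff)
    then show "y \<in> (\<lambda>f. \<chi> j. f j) ` PiE UNIV (\<lambda>_. {0..<\<tau>})" by (rule image_eqI)
  qed
qed (auto intro!: finite_imageI finite_PiE)

lemma N_shift: "u \<in> N \<Longrightarrow> (\<lambda>x. u (x + (\<chi> j. \<tau> * z $ j))) \<in> N"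
proof -
  let ?c = "\<chi> j. \<tau> * z $ j"
  assume u: "u \<in> N"
  then obtain x where "u x \<noteq> 0" by (auto simp: N_iff)
  then have "u ((x - ?c) + ?c) \<noteq> 0" by simp
  then have "(\<lambda>x. u (x + ?c)) \<noteq> (\<lambda>_. 0)" by metis
  with u shift_invariant[of u z] show ?thesis by (auto simp: N_iff)
qed

text \<open>One null sequence serves all three estimates, each in the direction that makes the parts
  of the Nehari functional add up to at most the whole, up to \<delta>. For \<open>B\<close> the
  nonnegative cross product of Dirichlet sums is dropped, and the other errors are controlled by
  \<open>G u (q n)\<close>.\<close>

lemma energy_splitting:
  fixes v :: "nat \<Rightarrow> int^3 \<Rightarrow> real"
  assumes v: "\<And>n. v n \<in> X" and bd: "\<And>n. A (v n) (v n) \<le> M" and pt: "\<And>x. (\<lambda>n. v n x) \<longlonglongrightarrow> u x"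
  obtains \<delta> where "u \<in> X" "\<delta> \<longlonglongrightarrow> 0" 
    "\<And>n. A u u + A (\<lambda>x. v n x - u x) (\<lambda>x. v n x - u x) - \<delta> n \<le> A (v n) (v n)"
    "\<And>n. B u + B (\<lambda>x. v n x - u x) - \<delta> n \<le> B (v n)"
    "\<And>n. D (v n) \<le> D u + D (\<lambda>x. v n x - u x) + \<delta> n"
proof -
  have "sq u \<in> l2"
  proof (rule l2_fatou)
    show "sq (v n) \<in> l2" for n by (rule X_sq[OF v])
    show "ip (sq (v n)) (sq (v n)) \<le> M" for n
      using bd[of n] grad_inner_nonneg[OF X_l2[OF v], of n] a
      by (smt (verit) A_def mult_nonneg_nonneg)
    show "(\<lambda>n. sq (v n) x) \<longlonglongrightarrow> sq u x" for x
      unfolding sq_def by (intro tendsto_intros pt)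
  qed
  then have u: "u \<in> X" by (simp add: X_iff)
  define q where "q n x = v n x - u x" for n x
  have veq: "v n = (\<lambda>x. u x + 1 * q n x)" for n by (auto simp: q_def)
  have q: "q n \<in> X" for n
    using X_add_scale[OF v u, of n "-1"] by (simp add: q_def[abs_def])
  have qpt: "(\<lambda>n. q n x) \<longlonglongrightarrow> 0" for x
    unfolding q_def using tendsto_diff[OF pt tendsto_const, of x "u x"] by simp
  \<comment> \<open>The parallelogram identity bounds \<open>A\<close> of the difference by twice
    the sum of the two values.\<close>
  define M' where "M' = 2 * M + 2 * A u u"
  have qbd: "A (q n) (q n) \<le> M'" for n
  proof -
    have "A (q n) (q n) = A (v n) (v n) - 2 * A (v n) u + A u u"
      using A_add_scale[OF v u, of n "-1"] by (simp add: q_def[abs_def])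
    moreover have "0 \<le> A (v n) (v n) + 2 * A (v n) u + A u u"
      using A_add_scale[OF v u, of n 1] A_nonneg[OF X_add_scale[OF v u], of n 1] by simp
    ultimately show ?thesis using bd[of n] by (simp add: M'_def)
  qed
  have aG: "a * G w w \<le> A w w" for w using ip_nonneg[of "sq w"] by (simp add: A_def)
  have Aq: "(\<lambda>n. A u (q n)) \<longlonglongrightarrow> 0" and Gq: "(\<lambda>n. G u (q n)) \<longlonglongrightarrow> 0"
    using A_weak_tendsto_0[of u q, OF u q qbd qpt] by auto
  define K where "K = (A u u + M') / a"
  have K: "G u u + G (q n) (q n) \<le> K" for n
    using aG[of u] aG[of "q n"] qbd[of n] a by (simp add: K_def field_simps)
  have Gn: "0 \<le> G u u + G (q n) (q n)" for n
    using grad_inner_nonneg[OF X_l2[OF u]] grad_inner_nonneg[OF X_l2[OF q], of n] by simp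
  define \<gamma> where "\<gamma> n = D (v n) - D u - D (q n)" for n
  have \<gamma>: "\<gamma> \<longlonglongrightarrow> 0"
  proof -
    define s where "s n x = \<bar>u x + q n x\<bar> powr p - \<bar>q n x\<bar> powr p - \<bar>u x\<bar> powr p" for n x
    define m where "m = sqrt (M' / h0)"
    have qsup: "\<bar>q n x\<bar> \<le> m" for n x
    proof -
      have "A (q n) (q n) / h0 \<le> M' / h0" using qbd h0 by (intro divide_right_mono) auto
      then show ?thesis using sup_le_A[OF q, of n x] unfolding m_def
        by (meson order_trans real_sqrt_le_mono)
    qed
    have qip: "ip (q n) (q n) \<le> M' / h0" for n
      using l2_le_A[OF q, of n] qbd[of n] h0 by (meson divide_right_mono less_imp_le order_trans)
    have s: "s n summable_on UNIV" for n
    proof -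
      have "pw (\<lambda>x. u x + 1 * q n x) summable_on UNIV" by (rule pw_summable[OF X_add_scale[OF u q]])
      then have "(\<lambda>x. \<bar>u x + q n x\<bar> powr p + - 1 * \<bar>q n x\<bar> powr p + - 1 * \<bar>u x\<bar> powr p) summable_on UNIV"
        by (intro summable_on_add summable_on_cmult_right pw_summable[OF u] pw_summable[OF q]) simp
      then show ?thesis by (simp add: s_def[abs_def])
    qed
    have "(\<lambda>n. DD (\<lambda>x. pw u x + pw (q n) x + s n x) (\<lambda>x. pw u x + pw (q n) x + s n x) - D u - D (q n)) \<longlonglongrightarrow> 0"
    proof (rule DD_splitting)
      show "pw u summable_on UNIV" "\<And>n. pw (q n) summable_on UNIV" "\<And>n. s n summable_on UNIV"
        by (intro pw_summable u q s)+
      show "l1norm (pw (q n)) \<le> m powr (p - 2) * (M' / h0)" for n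
      proof -
        have "l1norm (pw (q n)) \<le> m powr (p - 2) * ip (q n) (q n)"
          using l2_powr_summable(2)[OF X_l2[OF q] _ qsup, of p n] p by simp
        also have "\<dots> \<le> m powr (p - 2) * (M' / h0)" by (intro mult_left_mono qip) simp
        finally show ?thesis .
      qed
      show "(\<lambda>n. pw (q n) x) \<longlonglongrightarrow> 0" for x
      proof -
        have "(\<lambda>n. pw (q n) x) \<longlonglongrightarrow> \<bar>0\<bar> powr p"
          using p by (intro tendsto_powr' tendsto_rabs qpt tendsto_const) auto
        then show ?thesis by simp
      qed
      show "(\<lambda>n. l1norm (s n)) \<longlonglongrightarrow> 0"
        unfolding s_def by (rule Brezis_Lieb_l1[of p u q, OF p X_l2[OF u] X_l2[OF q] qip qpt])
    qed
    moreover have "(\<lambda>x. pw u x + pw (q n) x + s n x) = pw (v n)" for n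
      by (auto simp: s_def veq)
    ultimately show ?thesis by (simp add: \<gamma>_def[abs_def])
  qed
  define \<delta> where "\<delta> n = 2 * \<bar>A u (q n)\<bar> + 4 * b * K * \<bar>G u (q n)\<bar> + \<bar>\<gamma> n\<bar>" for n
  have nn: "0 \<le> 4 * b * K * \<bar>G u (q n)\<bar>" for n
    using b K[of n] Gn[of n] by (intro mult_nonneg_nonneg) auto
  have "(\<lambda>n. 2 * \<bar>A u (q n)\<bar> + 4 * b * K * \<bar>G u (q n)\<bar> + \<bar>\<gamma> n\<bar>) \<longlonglongrightarrow> 2 * \<bar>0\<bar> + 4 * b * K * \<bar>0\<bar> + \<bar>0\<bar>"
    by (intro tendsto_intros Aq Gq \<gamma>)
  then have \<delta>: "\<delta> \<longlonglongrightarrow> 0" by (simp add: \<delta>_def[abs_def])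
  have dA: "A u u + A (q n) (q n) - \<delta> n \<le> A (v n) (v n)" for n
  proof -
    have "A (v n) (v n) = A u u + 2 * A u (q n) + A (q n) (q n)"
      unfolding veq using A_add_scale[OF u q, of 1 n] by simp
    then show ?thesis using nn[of n] unfolding \<delta>_def by linarith
  qed
  have dB: "B u + B (q n) - \<delta> n \<le> B (v n)" for n
  proof -
    let ?x = "G u u" and ?y = "G (q n) (q n)" and ?g = "G u (q n)"
    have "G (v n) (v n) = ?x + 2 * ?g + ?y"
      unfolding veq using grad_inner_add_scale[OF X_l2[OF u] X_l2[OF q], of 1 n] by simp
    then have "(G (v n) (v n))\<^sup>2 = (?x\<^sup>2 + ?y\<^sup>2) + 2 * ?x * ?y + 4 * (?g * (?x + ?y)) + 4 * ?g\<^sup>2"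
      by (simp add: power2_eq_square algebra_simps)
    moreover have "0 \<le> 2 * ?x * ?y"
      using grad_inner_nonneg[OF X_l2[OF u]] grad_inner_nonneg[OF X_l2[OF q], of n] by simp
    moreover have "\<bar>?g * (?x + ?y)\<bar> \<le> \<bar>?g\<bar> * K"
      unfolding abs_mult using K[of n] Gn[of n] by (intro mult_left_mono) auto
    moreover have "0 \<le> ?g\<^sup>2" by simp
    ultimately have "?x\<^sup>2 + ?y\<^sup>2 - 4 * (\<bar>?g\<bar> * K) \<le> (G (v n) (v n))\<^sup>2" by linarith
    from mult_left_mono[OF this, of b] b
    have "B u + B (q n) - 4 * b * K * \<bar>?g\<bar> \<le> B (v n)" by (simp add: algebra_simps)
    then show ?thesis unfolding \<delta>_def by linarith
  qed
  have dD: "D (v n) \<le> D u + D (q n) + \<delta> n" for n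
    using nn[of n] unfolding \<delta>_def \<gamma>_def by linarith
  show ?thesis
    by (rule that[OF u \<delta>]) (use dA dB dD in \<open>simp_all add: q_def[abs_def]\<close>)
qed

section \<open>Ground states\<close>

lemma minimizing_sequence:
  obtains w where "\<And>n. w n \<in> N" "(\<lambda>n. J (w n)) \<longlonglongrightarrow> c_min" "\<And>n. J (w n) \<le> c_min + 1"
proof -
  have "\<exists>w. \<forall>n. w n \<in> N \<and> J (w n) < c_min + 1 / real (Suc n)"
    using c_min_approx by (intro choice) (auto simp: Bex_def)
  then obtain w where w: "\<And>n. w n \<in> N" "\<And>n. J (w n) < c_min + 1 / real (Suc n)" by blast
  have "(\<lambda>n. J (w n)) \<longlonglongrightarrow> c_min"
  proof (rule tendsto_sandwich[of "\<lambda>_. c_min" _ _ "\<lambda>n. c_min + 1 / real (Suc n)"])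
    show "(\<lambda>n. c_min + 1 / real (Suc n)) \<longlonglongrightarrow> c_min"
      using tendsto_add[OF tendsto_const lim_inverse_n'[THEN LIMSEQ_Suc], of c_min] by simp
    show "(\<lambda>n. c_min) \<longlonglongrightarrow> c_min" by simp
    show "\<forall>\<^sub>F n in sequentially. c_min \<le> J (w n)" using w(1) c_min_le by simp
    show "\<forall>\<^sub>F n in sequentially. J (w n) \<le> c_min + 1 / real (Suc n)" using w(2) by (intro always_eventually allI less_imp_le)
  qed
  moreover have "J (w n) \<le> c_min + 1" for n
  proof -
    have "1 / real (Suc n) \<le> 1" by simp
    with w(2)[of n] show ?thesis by linarith
  qed
  ultimately show ?thesis using w(1) by (intro that)
qed

text \<open>Only translations by multiples of \<tau> preserve the energy. Division with remainder
  therefore moves a point where |w n| is at least \<epsilon> into a fixed period box; the box is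
  finite, so pointwise convergence is uniform on it and the limit cannot vanish there.\<close>

lemma minimizing_sequence_convergent:
  obtains v u where "\<And>n. v n \<in> N" "(\<lambda>n. J (v n)) \<longlonglongrightarrow> c_min" "\<And>n. A (v n) (v n) \<le> (c_min + 1) / \<kappa>1"
    "\<And>x. (\<lambda>n. v n x) \<longlonglongrightarrow> u x" "u \<noteq> (\<lambda>_. 0)"
proof -
  obtain w where w: "\<And>n. w n \<in> N" "(\<lambda>n. J (w n)) \<longlonglongrightarrow> c_min" "\<And>n. J (w n) \<le> c_min + 1"
    by (rule minimizing_sequence) blast
  define M where "M = (c_min + 1) / \<kappa>1"
  have wM: "A (w n) (w n) \<le> M" for n
  proof -
    have "0 \<le> \<kappa>2 * B (w n)" using \<kappa>_pos B_nonneg[of "w n"] by simp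
    with w(3)[of n] J_on_N[OF w(1)] have "\<kappa>1 * A (w n) (w n) \<le> c_min + 1" by (smt (verit))
    then show ?thesis using \<kappa>_pos by (simp add: M_def field_simps)
  qed
  obtain \<epsilon> where \<epsilon>: "0 < \<epsilon>" "\<And>u. u \<in> N \<Longrightarrow> A u u \<le> M \<Longrightarrow> \<exists>x. \<epsilon> \<le> \<bar>u x\<bar>"
    using N_nonvanishing by blast
  then have "\<exists>x. \<forall>n. \<epsilon> \<le> \<bar>w n (x n)\<bar>" using w(1) wM by (intro choice) blast
  then obtain x where x: "\<And>n. \<epsilon> \<le> \<bar>w n (x n)\<bar>" by blast
  define z where "z n = (\<chi> j. (x n $ j) div \<tau>)" for n
  define y where "y n = (\<chi> j. (x n $ j) mod \<tau>)" for n
  have xyz: "x n = y n + (\<chi> j. \<tau> * z n $ j)" for n by (simp add: vec_eq_iff y_def z_def)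
  define t where "t n = (\<lambda>x. w n (x + (\<chi> j. \<tau> * z n $ j)))" for n
  have wX: "w n \<in> X" for n using w(1) by (simp add: N_iff)
  have tN: "t n \<in> N" for n unfolding t_def by (rule N_shift[OF w(1)])
  have tX: "t n \<in> X" for n using tN by (simp add: N_iff)
  have tA: "A (t n) (t n) \<le> M" for n unfolding t_def using shift_invariant(2)[OF wX] wM by simp
  have tJ: "J (t n) = J (w n)" for n unfolding t_def by (rule shift_invariant(6)[OF wX])
  let ?box = "{y::int^3. \<forall>j. 0 \<le> y $ j \<and> y $ j < \<tau>}"
  have ybox: "y n \<in> ?box" for n using \<tau> by (simp add: y_def)
  have ty: "\<epsilon> \<le> \<bar>t n (y n)\<bar>" for n using x[of n] by (simp add: t_def flip: xyz)
  have "\<bar>t n x\<bar> \<le> sqrt (M / h0)" for n x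
  proof -
    have "A (t n) (t n) / h0 \<le> M / h0" using tA h0 by (intro divide_right_mono) auto
    then show ?thesis using sup_le_A[OF tX, of n x] by (meson order_trans real_sqrt_le_mono)
  qed
  then obtain u r where r: "strict_mono r" and u: "\<And>x. (\<lambda>n. t (r n) x) \<longlonglongrightarrow> u x"
    using bounded_pointwise_subsequence[of t] by blast
  have "u \<noteq> (\<lambda>_. 0)"
  proof
    assume "u = (\<lambda>_. 0)"
    then have "eventually (\<lambda>n. \<bar>t (r n) y\<bar> < \<epsilon>) sequentially" for y
      using tendstoD[OF u[of y] \<epsilon>(1)] by simp
    then have "eventually (\<lambda>n. \<forall>y\<in>?box. \<bar>t (r n) y\<bar> < \<epsilon>) sequentially"
      by (intro eventually_ball_finite finite_period_box) auto
    then obtain n where "\<forall>y\<in>?box. \<bar>t (r n) y\<bar> < \<epsilon>"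
      using eventually_happens'[OF sequentially_bot] by blast
    with ybox[of "r n"] ty[of "r n"] show False by force
  qed
  moreover have "(\<lambda>n. J (t (r n))) \<longlonglongrightarrow> c_min"
    using LIMSEQ_subseq_LIMSEQ[OF w(2) r] by (simp add: tJ o_def)
  ultimately show ?thesis
    using that[of "\<lambda>n. t (r n)" u] tN tA u by (simp add: M_def)
qed

lemma minimizer_exists: "\<exists>u\<in>N. J u = c_min"
proof -
  obtain v u where v: "\<And>n. v n \<in> N" "(\<lambda>n. J (v n)) \<longlonglongrightarrow> c_min" 
    "\<And>n. A (v n) (v n) \<le> (c_min + 1) / \<kappa>1" "\<And>x. (\<lambda>n. v n x) \<longlonglongrightarrow> u x" "u \<noteq> (\<lambda>_. 0)"
    by (rule minimizing_sequence_convergent) blast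
  have vX: "v n \<in> X" for n using v(1) by (simp add: N_iff)
  define q where "q n = (\<lambda>x. v n x - u x)" for n
  obtain \<delta> where u: "u \<in> X" and \<delta>: "\<delta> \<longlonglongrightarrow> 0"
    and sA: "\<And>n. A u u + A (q n) (q n) - \<delta> n \<le> A (v n) (v n)"
    and sB: "\<And>n. B u + B (q n) - \<delta> n \<le> B (v n)"
    and sD: "\<And>n. D (v n) \<le> D u + D (q n) + \<delta> n"
    by (rule energy_splitting[of v _ u, OF vX v(3) v(4)]) (rule that, simp_all add: q_def)
  have q: "q n \<in> X" for n using X_add_scale[OF vX u, of n "-1"] by (simp add: q_def)
  note \<kappa> = \<kappa>_pos
  \<comment> \<open>On the Nehari manifold the energy no longer contains \<open>D\<close>, so the
    two lower splittings combine with the positive coefficients.\<close>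
  have JS: "\<kappa>1 * A u u + \<kappa>2 * B u + (\<kappa>1 * A (q n) (q n) + \<kappa>2 * B (q n)) \<le> J (v n) + (\<kappa>1 + \<kappa>2) * \<delta> n" for n
    using mult_left_mono[OF sA[of n], of \<kappa>1] mult_left_mono[OF sB[of n], of \<kappa>2] \<kappa> J_on_N[OF v(1)[of n]]
    by (simp add: algebra_simps)
  have lim: "(\<lambda>n. J (v n) + (\<kappa>1 + \<kappa>2) * \<delta> n) \<longlonglongrightarrow> c_min"
    using tendsto_add[OF v(2) tendsto_mult_right_zero[OF \<delta>, of "\<kappa>1 + \<kappa>2"]] by simp
  show ?thesis
  proof (cases "I u \<le> 0")
    case True
    obtain t where t: "0 < t" "t \<le> 1" "(\<lambda>x. t * u x) \<in> N"
      by (rule nehari_projection[OF u v(5) True])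
    let ?w = "\<lambda>x. t * u x"
    have le_c: "\<kappa>1 * A u u + \<kappa>2 * B u \<le> c_min"
    proof (rule LIMSEQ_le_const[OF lim], intro exI allI impI)
      fix n
      have "0 \<le> \<kappa>1 * A (q n) (q n) + \<kappa>2 * B (q n)"
        using \<kappa> A_nonneg[OF q] B_nonneg by simp
      with JS[of n] show "\<kappa>1 * A u u + \<kappa>2 * B u \<le> J (v n) + (\<kappa>1 + \<kappa>2) * \<delta> n" by linarith
    qed
    have "c_min \<le> J ?w" by (rule c_min_le[OF t(3)])
    also have "\<dots> = \<kappa>1 * (t\<^sup>2 * A u u) + \<kappa>2 * (t^4 * B u)"
      using J_on_N[OF t(3)] u
      by (simp add: A_scale grad_inner_scale X_l2 power_mult_distrib flip: power_mult)
    finally have ge: "c_min \<le> \<kappa>1 * (t\<^sup>2 * A u u) + \<kappa>2 * (t^4 * B u)" .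
    have "t^4 * B u \<le> B u" using t B_nonneg[of u] mult_right_mono[of "t^4" 1 "B u"] by (simp add: power_le_one)
    then have "\<kappa>2 * (t^4 * B u) \<le> \<kappa>2 * B u" using \<kappa> by simp
    \<comment> \<open>The bounds on \<open>c_min\<close> from both sides squeeze the multiplier: as
      t is at most 1, they are compatible only for t = 1.\<close>
    with ge le_c have "\<kappa>1 * A u u \<le> \<kappa>1 * (t\<^sup>2 * A u u)" by linarith
    then have "1 \<le> t\<^sup>2" using \<kappa> A_pos[OF u v(5)] by simp
    moreover have "t\<^sup>2 \<le> t * 1" unfolding power2_eq_square using t by (intro mult_left_mono) auto
    ultimately have "t = 1" using t by linarith
    then have "u \<in> N" using t(3) by simp
    moreover have "J u = c_min" using le_c J_on_N[OF \<open>u \<in> N\<close>] c_min_le[OF \<open>u \<in> N\<close>] by linarith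
    ultimately show ?thesis by blast
  next
    case False
    \<comment> \<open>The splittings of \<open>A\<close>, \<open>B\<close> and \<open>D\<close> cost
      one \<delta> each, and \<open>I (v n)\<close> is 0; hence \<open>I (q n)\<close> is at most
      this sequence and eventually negative.\<close>
    have "(\<lambda>n. - I u + 3 * \<delta> n) \<longlonglongrightarrow> - I u + 3 * 0" by (intro tendsto_intros \<delta>)
    then have "eventually (\<lambda>n. - I u + 3 * \<delta> n < 0) sequentially"
      using False by (intro order_tendstoD(2)[where y = "- I u + 3 * 0"]) auto
    then have "eventually (\<lambda>n. c_min \<le> J (v n) + (\<kappa>1 + \<kappa>2) * \<delta> n - \<kappa>1 * A u u) sequentially"
    proof eventually_elim
      case (elim n)
      have "I (v n) = 0" using v(1) by (simp add: N_iff)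
      then have In: "I (q n) < 0"
        using elim sA[of n] sB[of n] sD[of n] by (simp add: I_def)
      have "q n \<noteq> (\<lambda>_. 0)"
      proof
        assume "q n = (\<lambda>_. 0)"
        then have "q n = (\<lambda>x. 0 * q n x)" by simp
        then have "A (q n) (q n) = 0" "G (q n) (q n) = 0" "D (q n) = 0"
          using A_scale[OF q, of 0 n] grad_inner_scale[OF X_l2[OF q], of 0 n] D_scale[of 0 "q n"] p by auto
        with In show False by (simp add: I_def)
      qed
      then obtain t where t: "0 < t" "t \<le> 1" "(\<lambda>x. t * q n x) \<in> N"
        using nehari_projection[OF q] In by (metis less_imp_le)
      have "c_min \<le> J (\<lambda>x. t * q n x)" by (rule c_min_le[OF t(3)])
      also have "\<dots> = \<kappa>1 * (t\<^sup>2 * A (q n) (q n)) + \<kappa>2 * (t^4 * B (q n))"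
        using J_on_N[OF t(3)] q
        by (simp add: A_scale grad_inner_scale X_l2 power_mult_distrib flip: power_mult)
      also have "\<dots> \<le> \<kappa>1 * (1 * A (q n) (q n)) + \<kappa>2 * (1 * B (q n))"
        using \<kappa> t A_nonneg[OF q] B_nonneg
        by (intro add_mono mult_left_mono mult_right_mono) (auto simp: power_le_one)
      also have "\<dots> \<le> J (v n) + (\<kappa>1 + \<kappa>2) * \<delta> n - \<kappa>1 * A u u"
        using JS[of n] \<kappa> B_nonneg[of u] by (smt (verit) mult_nonneg_nonneg)
      finally show ?case .
    qed
    moreover have "(\<lambda>n. J (v n) + (\<kappa>1 + \<kappa>2) * \<delta> n - \<kappa>1 * A u u) \<longlonglongrightarrow> c_min - \<kappa>1 * A u u"
      by (intro tendsto_diff lim tendsto_const)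
    ultimately have "c_min \<le> c_min - \<kappa>1 * A u u"
      by (intro tendsto_lowerbound) auto
    then show ?thesis using \<kappa> A_pos[OF u v(5)] by (smt (verit) mult_pos_pos)
  qed
qed

section \<open>Minimizers are critical points\<close>

lemma D_add_spike:
  assumes u: "u \<in> X"
  shows "D (\<lambda>y. u y + s * spike x y) = D u + 2 * (\<bar>u x + s\<bar> powr p - \<bar>u x\<bar> powr p) * cv (pw u) x
     + (\<bar>u x + s\<bar> powr p - \<bar>u x\<bar> powr p)\<^sup>2 * green \<alpha> 0"
proof -
  define g where "g = \<bar>u x + s\<bar> powr p - \<bar>u x\<bar> powr p"
  \<comment> \<open>The density changes at the single site \<open>x\<close>, hence by a multiple of
    a point mass; bilinearity then gives a quadratic polynomial in that multiple.\<close>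
  have eq: "pw (\<lambda>y. u y + s * spike x y) = (\<lambda>y. pw u y + g * spike x y)"
    by (auto simp: fun_eq_iff spike_def g_def)
  have f: "pw u summable_on UNIV" by (rule pw_summable[OF u])
  have e: "(\<lambda>y. g * spike x y) summable_on UNIV" by (intro summable_on_cmult_right spike_summable)
  have 1: "DD (pw u) (\<lambda>y. g * spike x y) = g * cv (pw u) x"
    using DD_scale[of 1 "pw u" g "spike x"] by (simp add: DD_spike)
  have 2: "DD (\<lambda>y. g * spike x y) (\<lambda>y. g * spike x y) = g\<^sup>2 * green \<alpha> 0"
    using DD_scale[of g "spike x" g "spike x"] by (simp add: DD_spike cv_spike power2_eq_square)
  show ?thesis
    unfolding eq
    by (simp add: DD_add_left DD_add_right f e summable_on_add 1 DD_commute[OF e f] 2 flip: g_def)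
qed

text \<open>The first-order condition is one-sided, so both signs \<sigma> are carried along.
  \<open>A\<close> and the Dirichlet sum are quadratic in s, and \<open>D\<close> depends on s only
  through \<open>g\<close>, whose square contributes nothing to the derivative at 0 because
  \<open>g 0 = 0\<close>.\<close>

lemma minimizer_critical_spike:
  assumes u: "u \<in> N" and min: "J u = c_min" and \<sigma>: "\<sigma> = 1 \<or> \<sigma> = -1"
  shows "0 \<le> \<sigma> * J' u (spike x)"
proof -
  have uX: "u \<in> X" and u0: "u \<noteq> (\<lambda>_. 0)" and I0: "I u = 0" using u by (auto simp: N_iff)
  let ?e = "spike x"
  let ?w = "\<lambda>s y. u y + (\<sigma> * s) * ?e y"
  have wX: "?w s \<in> X" for s by (rule X_add_scale[OF uX spike_X])
  define g where "g s = \<bar>u x + \<sigma> * s\<bar> powr p - \<bar>u x\<bar> powr p" for s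
  have g0: "g 0 = 0" by (simp add: g_def)
  have dg: "(g has_real_derivative \<sigma> * (p * (\<bar>u x\<bar> powr (p - 2) * u x))) (at 0)"
  proof -
    have "((\<lambda>s. \<bar>u x + \<sigma> * s\<bar> powr p) has_real_derivative (p * (\<bar>u x + \<sigma> * 0\<bar> powr (p - 2) * (u x + \<sigma> * 0))) * \<sigma>) (at 0)"
      by (rule DERIV_chain2[OF abs_powr_has_derivative[OF p]]) (auto intro!: derivative_eq_intros)
    from DERIV_diff[OF this DERIV_const[of "\<bar>u x\<bar> powr p"]] show ?thesis
      unfolding g_def by (simp add: mult_ac)
  qed
  have Aw: "A (?w s) (?w s) = A u u + 2 * (\<sigma> * s) * A u ?e + (\<sigma> * s)\<^sup>2 * A ?e ?e" for s
    by (rule A_add_scale[OF uX spike_X])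
  have Gw: "G (?w s) (?w s) = G u u + 2 * (\<sigma> * s) * G u ?e + (\<sigma> * s)\<^sup>2 * G ?e ?e" for s
    by (rule grad_inner_add_scale[OF X_l2[OF uX] X_l2[OF spike_X]])
  have Dw: "D (?w s) = D u + 2 * g s * cv (pw u) x + (g s)\<^sup>2 * green \<alpha> 0" for s
    unfolding g_def by (rule D_add_spike[OF uX])
  have "0 \<le> (2 * \<sigma> * A u ?e)/2 + (4 * \<sigma> * b * G u u * G u ?e)/4
     - (2 * (\<sigma> * (p * (\<bar>u x\<bar> powr (p - 2) * u x))) * cv (pw u) x)/(2*p)"
  proof (rule fibering_first_order[where A = "\<lambda>s. A (?w s) (?w s)" and B = "\<lambda>s. B (?w s)" and D = "\<lambda>s. D (?w s)" and c = c_min])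
    show "2 < p" by (rule p)
    show "0 < A (?w 0) (?w 0)" using A_pos[OF uX u0] by simp
    show "0 \<le> B (?w 0)" by (rule B_nonneg)
    show "D (?w 0) = A (?w 0) (?w 0) + B (?w 0)" using I0 by (simp add: I_def)
    show "((\<lambda>s. A (?w s) (?w s)) has_real_derivative 2 * \<sigma> * A u ?e) (at 0)"
      unfolding Aw by (auto intro!: derivative_eq_intros)
    show "((\<lambda>s. B (?w s)) has_real_derivative 4 * \<sigma> * b * G u u * G u ?e) (at 0)"
      unfolding Gw by (auto intro!: derivative_eq_intros)
    show "((\<lambda>s. D (?w s)) has_real_derivative 2 * (\<sigma> * (p * (\<bar>u x\<bar> powr (p - 2) * u x))) * cv (pw u) x) (at 0)"
      unfolding Dw by (auto intro!: derivative_eq_intros dg simp: g0)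
    show "c_min = A (?w 0) (?w 0) / 2 + B (?w 0) / 4 - D (?w 0) / (2*p)"
      using min J_eq[OF uX] by simp
  next
    fix s t :: real
    assume t: "0 < t" and As: "0 < A (?w s) (?w s)"
      and root: "A (?w s) (?w s) + t\<^sup>2 * B (?w s) - t powr (2*p-2) * D (?w s) = 0"
    have "?w s \<noteq> (\<lambda>_. 0)"
    proof
      assume "?w s = (\<lambda>_. 0)"
      then have "A (?w s) (?w s) = A (\<lambda>y. 0 * u y) (\<lambda>y. 0 * u y)" by simp
      with As A_scale[OF uX, of 0] show False by simp
    qed
    then have "(\<lambda>y. t * ?w s y) \<in> N"
      using root scale_nonzero[of "?w s" t] t unfolding N_iff I_scale[OF wX t]
      by (intro conjI X_scale wX) auto
    from c_min_le[OF this] show "c_min \<le> t\<^sup>2/2 * A (?w s) (?w s) + t^4/4 * B (?w s) - t powr (2*p) / (2*p) * D (?w s)"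
      using J_scale[OF wX t] by simp
  qed
  also have "\<dots> = \<sigma> * (A u ?e + b * G u u * G u ?e - cv (pw u) x * \<bar>u x\<bar> powr (p - 2) * u x)"
    using p by (simp add: field_simps)
  also have "\<dots> = \<sigma> * J' u ?e"
    using J'_eq[OF uX, of ?e] infsum_spike[of "\<lambda>y. cv (pw u) y * \<bar>u y\<bar> powr (p - 2) * u y" x] by simp
  finally show ?thesis .
qed

text \<open>The three parts converge separately: the gradient part after summation by parts, the
  potential part as a product of weighted \<open>l2\<close> functions, and the Choquard part because
  \<open>cv (pw u) x * \<bar>u x\<bar> powr (p - 2)\<close> is bounded.\<close>

lemma J'_representation:
  assumes u: "u \<in> X"
  obtains L where "\<And>\<phi>. \<phi> \<in> X \<Longrightarrow> J' u \<phi> = (\<Sum>\<^sub>\<infinity>x. L x * \<phi> x)"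
proof -
  define c where "c = a + b * G u u"
  define W where "W x = cv (pw u) x * \<bar>u x\<bar> powr (p - 2) * u x" for x
  define m where "m = sqrt (A u u / h0)"
  have m: "\<bar>u x\<bar> powr (p - 2) \<le> m powr (p - 2)" for x
    using sup_le_A[OF u, of x] p unfolding m_def by (intro powr_mono2) auto
  have Wb: "\<bar>cv (pw u) x * \<bar>u x\<bar> powr (p - 2)\<bar> \<le> (green \<alpha> 0 * l1norm (pw u)) * m powr (p - 2)" for x
    unfolding abs_mult using cv_bound[OF pw_summable[OF u], of x] m[of x]
    by (intro mult_mono) (auto intro: order_trans[OF abs_ge_zero])
  have "J' u \<phi> = (\<Sum>\<^sub>\<infinity>x. (c * (- lap u x) + h x * u x - W x) * \<phi> x)" if \<phi>: "\<phi> \<in> X" for \<phi>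
  proof -
    have s1: "(\<lambda>x. - lap u x * \<phi> x) summable_on UNIV"
      by (rule l2_mult_summable[OF grad_inner_by_parts(1)[OF X_l2[OF u] X_l2[OF \<phi>]] X_l2[OF \<phi>]])
    have s2: "(\<lambda>x. h x * u x * \<phi> x) summable_on UNIV"
      using l2_mult_summable[OF X_sq[OF u] X_sq[OF \<phi>]] by (simp add: sq_mult)
    have s3: "(\<lambda>x. W x * \<phi> x) summable_on UNIV"
      unfolding W_def using summable_on_mult_bounded[OF l2_mult_summable[OF X_l2[OF u] X_l2[OF \<phi>]] Wb]
      by (simp add: mult.assoc)
    have "J' u \<phi> = c * G u \<phi> + (\<Sum>\<^sub>\<infinity>x. h x * u x * \<phi> x) - (\<Sum>\<^sub>\<infinity>x. W x * \<phi> x)"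
      by (simp add: J'_eq[OF u] A_def c_def W_def ip_def sq_mult algebra_simps)
    also have "G u \<phi> = (\<Sum>\<^sub>\<infinity>x. - lap u x * \<phi> x)"
      using grad_inner_by_parts(2)[OF X_l2[OF u] X_l2[OF \<phi>]] by (simp add: ip_def)
    also have "c * (\<Sum>\<^sub>\<infinity>x. - lap u x * \<phi> x) = (\<Sum>\<^sub>\<infinity>x. c * (- lap u x * \<phi> x))"
      by (rule infsum_cmult_right'[symmetric])
    also have "\<dots> + (\<Sum>\<^sub>\<infinity>x. h x * u x * \<phi> x) = (\<Sum>\<^sub>\<infinity>x. c * (- lap u x * \<phi> x) + h x * u x * \<phi> x)"
      by (rule infsum_add[symmetric]) (intro summable_on_cmult_right s1 s2)+
    also have "\<dots> - (\<Sum>\<^sub>\<infinity>x. W x * \<phi> x) = \<dots> + (\<Sum>\<^sub>\<infinity>x. - (W x * \<phi> x))"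
      by (simp add: infsum_uminus)
    also have "\<dots> = (\<Sum>\<^sub>\<infinity>x. (c * (- lap u x * \<phi> x) + h x * u x * \<phi> x) + - (W x * \<phi> x))"
      by (rule infsum_add[symmetric])
         (intro summable_on_add summable_on_cmult_right summable_on_uminus[THEN iffD2] s1 s2 s3)+
    finally show ?thesis by (simp add: algebra_simps)
  qed
  then show ?thesis by (rule that)
qed

lemma minimizer_critical:
  assumes u: "u \<in> N" and min: "J u = c_min" and \<phi>: "\<phi> \<in> X"
  shows "J' u \<phi> = 0"
proof -
  have uX: "u \<in> X" using u by (simp add: N_iff)
  obtain L where L: "\<And>\<phi>. \<phi> \<in> X \<Longrightarrow> J' u \<phi> = (\<Sum>\<^sub>\<infinity>x. L x * \<phi> x)"
    by (rule J'_representation[OF uX]) blast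
  \<comment> \<open>On the point mass at \<open>x\<close> the derivative equals \<open>L x\<close>,
    and the two signs bound it from both sides by 0.\<close>
  have "L x = 0" for x
    using minimizer_critical_spike[OF u min, of 1 x] minimizer_critical_spike[OF u min, of "-1" x]
      L[OF spike_X, of x] infsum_spike[of L x] by simp
  then show ?thesis by (simp add: L[OF \<phi>])
qed

end

theorem theorem1p1:
  fixes a b \<alpha> p :: real and h :: "int^3 \<Rightarrow> real" and \<tau> :: int
  assumes "a > 0" and "b > 0" and "0 < \<alpha>" and "\<alpha> < 3" and "p > 2"
    and "\<exists>h0>0. \<forall>x. h x \<ge> h0"
    and "\<tau> \<ge> 1"
    and "\<forall>x j. h (x + axis j \<tau>) = h x"
  shows "\<exists>u \<in> Hsp h. (\<forall>\<phi> \<in> Hsp h. energy_deriv a b \<alpha> p h u \<phi> = 0)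
              \<and> energy a b \<alpha> p h u = (INF v \<in> nehari a b \<alpha> p h. energy a b \<alpha> p h v)"
proof -
  obtain h0 where "0 < h0" "\<And>x. h0 \<le> h x" using assms(6) by auto
  with assms interpret kirchhoff_choquard a b \<alpha> p h \<tau> h0
    by unfold_locales auto
  obtain u where "u \<in> N" "J u = c_min" using minimizer_exists by blast
  then show ?thesis
    using minimizer_critical[OF \<open>u \<in> N\<close>] by (intro bexI[of _ u]) (auto simp: N_iff c_min_def)
qed

end
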